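(* Fix $\eta>0$, $\epsilon\in(0,(\alpha+2)R]$, $\gamma\in(0,1)$. Suppose the Bandit Algorithm described in the context, with these parameters and with a Barycentric Spanner $\{\mathbf{q}_1,\dots,\mathbf{q}_d\}$ with parameter $\beta>0$ for $\mathcal{K}$, is applied for $T$ rounds, let $\{\mathbf{f}_t\}_{t=1}^T\subseteq\mathcal{F}$ be the sequence of loss/payoff vectors, and let $\{\hat{\mathbf{s}}_t\}_{t=1}^T$ be the sequence of points played by the algorithm. Then $$\mathbb{E}\left[\alpha\text{-regret}\left(\{(\hat{\mathbf{s}}_t,\mathbf{f}_t)\}_{t=1}^T\right)\right]\le\frac{\alpha^2R^2}{\eta T}+\frac{\eta d^2C^2\beta^2}{2\gamma}+3\epsilon F+\gamma C,$$ and the expected number of calls to the approximation oracle $\mathcal{O}_{\mathcal{K}}$ of $\mathcal{K}$ per iteration is upper bounded by $$\mathbb{E}[K(\eta,\epsilon,\gamma)]:=O\left(\left(1+\frac{\eta\alpha\beta dCR+(\eta dC\beta)^2/\gamma}{\epsilon^2}\right)d^2\ln\left(\frac{(\alpha+1)R}{\epsilon}\right)\right).$$ In particular, setting $\eta=\frac{\alpha R}{\beta dC}T^{-2/3}$, $\epsilon=\alpha RT^{-1/3}$, $\gamma=T^{-1/3}$ gives $$\mathbb{E}[\alpha\text{-regret}]=O\left((\alpha\beta dCR+\alpha RF+C)T^{-1/3}\right),\qquad \mathbb{E}[K]=O\left(d^2\ln\left(\frac{\alpha+1}{\alpha}T\right)\right).$$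
   Context: Setting. $\|\cdot\|$ is the Euclidean norm on $\mathbb{R}^d$, $\mathcal{B}(\mathbf{c},r)$ is the Euclidean ball of radius $r$ centered at $\mathbf{c}$, and $\mathbb{R}^d_+$ is the non-negative orthant. $\mathcal{K},\mathcal{F}\subset\mathbb{R}^d_+$ are compact sets with $\max_{\mathbf{x}\in\mathcal{K}}\|\mathbf{x}\|\le R$, $\max_{\mathbf{f}\in\mathcal{F}}\|\mathbf{f}\|\le F$ for some $R,F>0$, and $0\le\mathbf{x}\cdot\mathbf{f}\le C$ for all $\mathbf{x}\in\mathcal{K},\mathbf{f}\in\mathcal{F}$, for some $C>0$. $\mathcal{K}$ is the set of feasible actions (it need not be convex), assumed to span $\mathbb{R}^d$, and $\mathcal{F}$ is the set of possible loss/payoff vectors. The parameter is $\alpha>0$: $\alpha\ge1$ corresponds to loss minimization and $\alpha<1$ to payoff maximization. Write $\alpha\mathcal{K}=\{\alpha\mathbf{x}:\mathbf{x}\in\mathcal{K}\}$ and $\mathrm{CH}$ for convex hull. The number of rounds $T$ is fixed and known in advance. The adversary is oblivious: $\mathbf{f}_1,\dots,\mathbf{f}_T$ are chosen before the first round and do not depend on the player's actions. In the bandit setting the player observes in round $t$ only the scalar loss/payoff of the point played, not $\mathbf{f}_t$. Expectations are over the algorithm's randomness. Approximation oracle. A map $\mathcal{O}_{\mathcal{K}}:\mathbb{R}^d_+\to\mathcal{K}$ such that for all $\mathbf{c}\in\mathbb{R}^d_+$: $\mathcal{O}_{\mathcal{K}}(\mathbf{c})\cdot\mathbf{c}\le\alpha\min_{\mathbf{x}\in\mathcal{K}}\mathbf{x}\cdot\mathbf{c}$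 if $\alpha\ge1$, and $\mathcal{O}_{\mathcal{K}}(\mathbf{c})\cdot\mathbf{c}\ge\alpha\max_{\mathbf{x}\in\mathcal{K}}\mathbf{x}\cdot\mathbf{c}$ if $\alpha<1$. $\alpha$-regret. For $\mathbf{x}_t\in\mathcal{K}$, $\mathbf{f}_t\in\mathcal{F}$, $\alpha\text{-regret}(\{(\mathbf{x}_t,\mathbf{f}_t)\}_{t=1}^T)$ equals $\frac1T\sum_{t=1}^T\mathbf{x}_t\cdot\mathbf{f}_t-\alpha\min_{\mathbf{x}\in\mathcal{K}}\frac1T\sum_{t=1}^T\mathbf{x}\cdot\mathbf{f}_t$ if $\alpha\ge1$, and $\alpha\max_{\mathbf{x}\in\mathcal{K}}\frac1T\sum_{t=1}^T\mathbf{x}\cdot\mathbf{f}_t-\frac1T\sum_{t=1}^T\mathbf{x}_t\cdot\mathbf{f}_t$ if $\alpha<1$. Barycentric Spanner. A set of $d$ vectors $\{\mathbf{q}_1,\dots,\mathbf{q}_d\}\subset\mathbb{R}^d$ is a Barycentric Spanner with parameter $\beta>0$ for a set $\mathcal{S}\subset\mathbb{R}^d$ if $\{\mathbf{q}_1,\dots,\mathbf{q}_d\}\subset\mathcal{S}$, the matrix $\mathbf{Q}:=\sum_{i=1}^d\mathbf{q}_i\mathbf{q}_i^\top$ is not singular, and $\max_{1\le i\le d}\|\mathbf{Q}^{-1}\mathbf{q}_i\|\le\beta$. Extended approximation oracle. For $\mathbf{c}\in\mathbb{R}^d$ write $\mathbf{c}=\mathbf{c}^++\mathbf{c}^-$,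 where $\mathbf{c}^+$ equals $\mathbf{c}$ on its non-negative coordinates and zero elsewhere, and $\mathbf{c}^-$ equals $\mathbf{c}$ on its negative coordinates and zero elsewhere. Let $\bar{\mathbf{v}}=\mathbf{v}/\|\mathbf{v}\|$ if $\|\mathbf{v}\|>0$ and $\bar{\mathbf{v}}=\mathbf{0}$ otherwise; $\bar{\mathbf{c}}^{\pm}$ is the normalization of $\mathbf{c}^{\pm}$. Define $\hat{\mathcal{O}}_{\mathcal{K}}(\mathbf{c})=(\mathbf{v},\mathbf{s})$ by $\mathbf{s}=\mathcal{O}_{\mathcal{K}}(\mathbf{c}^+)$, $\mathbf{v}=\mathbf{s}-\alpha R\,\bar{\mathbf{c}}^-$ if $\alpha\ge1$; and $\mathbf{s}=\mathcal{O}_{\mathcal{K}}(-\mathbf{c}^-)$, $\mathbf{v}=\mathbf{s}-R\,\bar{\mathbf{c}}^+$ if $\alpha<1$. Separation-or-Decomposition procedure with inputs $(\mathbf{x},\epsilon)$, $\mathbf{x}\in\mathbb{R}^d$. Let $N$ be a positive integer with $N\ge c\,d^2\ln\left(\frac{(\alpha+1)R+\|\mathbf{x}\|}{\epsilon}\right)$, where $c$ is a positive universal constant; $N$ is taken of this order, so that one call of the procedure makes $O\left(d^2\ln\left(\frac{(\alpha+1)R+\|\mathbf{x}\|}{\epsilon}\right)\right)$ oracle calls. Attempt to apply the Ellipsoid method for $N$ iterations to the feasibility problem: find $\mathbf{w}\in\mathbb{R}^d$ such that $(\mathbf{x}-\mathbf{z})\cdot\mathbf{w}\ge\epsilon$ for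 all $\mathbf{z}\in\alpha\mathcal{K}$ and $\|\mathbf{w}\|\le1$. Each iteration, with current iterate $\mathbf{w}$, applies the following consecutive steps: (1) $(\mathbf{v},\mathbf{s})\leftarrow\hat{\mathcal{O}}_{\mathcal{K}}(-\mathbf{w})$; if $(\mathbf{x}-\mathbf{v})\cdot\mathbf{w}<\epsilon$, use $\mathbf{v}-\mathbf{x}$ as a separating hyperplane for the Ellipsoid method and continue to the next iteration; (2) if $\|\mathbf{w}\|>1$, use $\mathbf{w}$ as a separating hyperplane for the Ellipsoid method and continue to the next iteration; (3) otherwise declare the problem feasible and return the vector $\mathbf{w}$ (a separating hyperplane). If $N$ iterations are completed without declaring feasibility, return the decomposition consisting of the outputs $(\mathbf{v}_1,\mathbf{s}_1),\dots,(\mathbf{v}_N,\mathbf{s}_N)$ of the extended approximation oracle gathered during the run and an optimal solution $(a_1,\dots,a_N)$ of: minimize $\frac12\|\sum_{i=1}^Na_i\mathbf{v}_i-\mathbf{x}\|^2$ subject to $a_i\ge0$ for all $i$ and $\sum_{i=1}^Na_i=1$. Projection Algorithm ((infeasible) projection onto $\mathrm{CH}(\alpha\mathcal{K})$) with inputs $(\mathbf{y},\epsilon)$. Set $\tilde{\mathbf{y}}\leftarrow\mathbf{y}/\max\{1,\|\mathbf{y}\|/(\alpha R)\}$. Repeat: call the Separation-or-Decomposition procedure with inputs $(\tilde{\mathbf{y}},\epsilon)$; if it outputs a separating hyperplane $\mathbf{w}$, set $\tilde{\mathbf{y}}\leftarrow\tilde{\mathbf{y}}-\epsilon\mathbf{w}$;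 otherwise stop and return $\tilde{\mathbf{y}}$, $(a_1,\dots,a_N)$ and $\{(\mathbf{v}_1,\mathbf{s}_1),\dots,(\mathbf{v}_N,\mathbf{s}_N)\}$. Full-Information Algorithm with learning rate $\eta>0$ and projection error parameter $\epsilon>0$, fed vectors $\mathbf{g}_1,\dots,\mathbf{g}_T\in\mathbb{R}^d$ as the loss/payoff vectors. Let $\mathbf{s}_1$ be some point in $\mathcal{K}$ and set $\tilde{\mathbf{y}}_1=\alpha\mathbf{s}_1$. For $t=1,\dots,T$: output $\mathbf{s}_t$; receive $\mathbf{g}_t$; set $\mathbf{y}_{t+1}=\tilde{\mathbf{y}}_t-\eta\mathbf{g}_t$ if $\alpha\ge1$ and $\mathbf{y}_{t+1}=\tilde{\mathbf{y}}_t+\eta\mathbf{g}_t$ if $\alpha<1$; call the Projection Algorithm with inputs $(\mathbf{y}_{t+1},\epsilon)$ to obtain $\tilde{\mathbf{y}}_{t+1}$, a distribution $(a_1,\dots,a_N)$ and pairs $\{(\mathbf{v}_1,\mathbf{s}_1),\dots,(\mathbf{v}_N,\mathbf{s}_N)\}\subseteq\mathbb{R}^d\times\mathcal{K}$; sample the next output $\mathbf{s}_{t+1}$ from the points $\mathbf{s}_1,\dots,\mathbf{s}_N$ of these returned pairs according to the distribution $(a_1,\dots,a_N)$. Bandit Algorithm with learning rate $\eta>0$, projection error parameter $\epsilon>0$, exploration parameter $\gamma\in(0,1)$, and a Barycentric Spanner $\{\mathbf{q}_1,\dots,\mathbf{q}_d\}$ for $\mathcal{K}$ with some parameter $\beta>0$.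 Instantiate the Full-Information Algorithm with parameters $(\eta,\epsilon)$. For $t=1,\dots,T$: receive $(\mathbf{s}_t,\tilde{\mathbf{y}}_t)\in\mathcal{K}\times\mathcal{B}(0,\alpha R)$ from the Full-Information Algorithm; with probability $\gamma$ explore and with probability $1-\gamma$ exploit. If exploring: sample $i_t\in\{1,\dots,d\}$ uniformly at random, play $\hat{\mathbf{s}}_t=\mathbf{q}_{i_t}$, receive the loss/payoff $\ell_t=\mathbf{q}_{i_t}\cdot\mathbf{f}_t$ and set $\hat{\mathbf{f}}_t=\frac{d\,\ell_t}{\gamma}\mathbf{Q}^{-1}\mathbf{q}_{i_t}$, where $\mathbf{Q}=\sum_{i=1}^d\mathbf{q}_i\mathbf{q}_i^\top$. If exploiting: play $\hat{\mathbf{s}}_t=\mathbf{s}_t$, receive the loss/payoff $\ell_t=\mathbf{s}_t\cdot\mathbf{f}_t$ and set $\hat{\mathbf{f}}_t=\mathbf{0}$. Feed $\mathbf{g}_t=\hat{\mathbf{f}}_t$ to the Full-Information Algorithm as the loss/payoff vector for round $t$.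
   Formalization: The bound on E[K] fails when ln((α+1)R/ε) is near or below 0 (e.g. ε=(α+1)R); it is proved with this log for 2ε≤(α+1)R, and with max{1, ln((α+1)R/ε)} for every ε∈(0,(α+2)R]. Calls per iteration are averaged over the T rounds. *)

theory Defs
  imports "HOL-Probability.Probability" "HOL-Library.While_Combinator"
begin

definition nonneg_orthant :: "(real ^ 'n) set" where
  "nonneg_orthant = {x. \<forall>i. 0 \<le> x $ i}"

definition outer :: "real ^ 'n \<Rightarrow> real ^ 'n \<Rightarrow> real ^ 'n ^ 'n" where
  "outer u v = (\<chi> i j. u $ i * v $ j)"


section \<open>Approximation oracles, regret, barycentric spanners\<close>

text \<open>
  \<open>INF\<close> and \<open>SUP\<close> below are attained whenever \<open>K\<close> is compact and nonempty, so they are the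
  minimum and the maximum.
\<close>

definition approx_oracle ::
  "real \<Rightarrow> (real ^ 'n) set \<Rightarrow> (real ^ 'n \<Rightarrow> real ^ 'n) \<Rightarrow> bool" where
  "approx_oracle \<alpha> K orc \<longleftrightarrow>
     (\<forall>c \<in> nonneg_orthant. orc c \<in> K \<and>
        (if \<alpha> \<ge> 1 then orc c \<bullet> c \<le> \<alpha> * (INF x\<in>K. x \<bullet> c)
         else orc c \<bullet> c \<ge> \<alpha> * (SUP x\<in>K. x \<bullet> c)))"

definition alpha_regret ::
  "real \<Rightarrow> (real ^ 'n) set \<Rightarrow> nat \<Rightarrow> (nat \<Rightarrow> real ^ 'n) \<Rightarrow> (nat \<Rightarrow> real ^ 'n) \<Rightarrow> real" where
  "alpha_regret \<alpha> K T x f =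
     (if \<alpha> \<ge> 1 then
        1 / real T * (\<Sum>t = 1..T. x t \<bullet> f t)
          - \<alpha> * (INF z\<in>K. 1 / real T * (\<Sum>t = 1..T. z \<bullet> f t))
      else
        \<alpha> * (SUP z\<in>K. 1 / real T * (\<Sum>t = 1..T. z \<bullet> f t))
          - 1 / real T * (\<Sum>t = 1..T. x t \<bullet> f t))"

definition spanner_matrix :: "('n \<Rightarrow> real ^ 'n) \<Rightarrow> real ^ 'n ^ 'n" where
  "spanner_matrix q = (\<Sum>i\<in>UNIV. outer (q i) (q i))"

text \<open>The \<open>d\<close> vectors are indexed by the coordinate type \<open>'n\<close>, which has \<open>d\<close> elements.\<close>

definition barycentric_spanner ::
  "real \<Rightarrow> (real ^ 'n) set \<Rightarrow> ('n \<Rightarrow> real ^ 'n) \<Rightarrow> bool" where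
  "barycentric_spanner \<beta> S q \<longleftrightarrow>
     range q \<subseteq> S \<and> invertible (spanner_matrix q) \<and>
     (MAX i\<in>UNIV. norm (matrix_inv (spanner_matrix q) *v q i)) \<le> \<beta>"


section \<open>Extended approximation oracle\<close>

definition pos_part :: "real ^ 'n \<Rightarrow> real ^ 'n" where
  "pos_part c = (\<chi> i. max (c $ i) 0)"

definition neg_part :: "real ^ 'n \<Rightarrow> real ^ 'n" where
  "neg_part c = (\<chi> i. min (c $ i) 0)"

text \<open>In a normed space \<open>sgn v\<close> is \<open>v\<close> divided by its norm, and \<open>sgn 0 = 0\<close>.\<close>

definition ext_oracle ::
  "real \<Rightarrow> real \<Rightarrow> (real ^ 'n \<Rightarrow> real ^ 'n) \<Rightarrow> real ^ 'n \<Rightarrow> (real ^ 'n) \<times> (real ^ 'n)" where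
  "ext_oracle \<alpha> R orc c =
     (if \<alpha> \<ge> 1 then
        let s = orc (pos_part c) in (s - (\<alpha> * R) *\<^sub>R sgn (neg_part c), s)
      else
        let s = orc (- neg_part c) in (s - R *\<^sub>R sgn (pos_part c), s))"


section \<open>Separation or decomposition by the ellipsoid method\<close>

text \<open>
  A pair \<open>(w, A)\<close> with \<open>A\<close> positive definite stands for the ellipsoid of all \<open>u\<close> such that
  \<open>(u - w) \<bullet> (matrix_inv A *v (u - w)) \<le> 1\<close>.  The pair is replaced by the ellipsoid of minimum
  volume containing its part in the half space \<open>g \<bullet> u \<le> g \<bullet> w\<close>.  In dimension 1 the usual
  formula for the new matrix has a vanishing denominator; its limiting value \<open>A / 4\<close> (bisection)
  is used.  If \<open>g = 0\<close> there is no half space to cut with, and the ellipsoid is kept.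
\<close>

definition ellipsoid_cut ::
  "real ^ 'n \<Rightarrow> (real ^ 'n) \<times> (real ^ 'n ^ 'n) \<Rightarrow> (real ^ 'n) \<times> (real ^ 'n ^ 'n)" where
  "ellipsoid_cut g E =
     (case E of (w, A) \<Rightarrow>
        if g = 0 then (w, A)
        else
          let d = real CARD('n);
              b = (1 / sqrt (g \<bullet> (A *v g))) *\<^sub>R (A *v g)
          in (w - (1 / (d + 1)) *\<^sub>R b,
              if CARD('n) = 1 then (1 / 4) *\<^sub>R A
              else (d^2 / (d^2 - 1)) *\<^sub>R (A - (2 / (d + 1)) *\<^sub>R outer b b)))"

text \<open>
  \<open>ellipsoid_run ext x \<epsilon> n E ps\<close> performs up to \<open>n\<close> further iterations from the ellipsoid \<open>E\<close>,
  where \<open>ps\<close> lists the oracle answers \<open>(v, s)\<close> obtained so far.  The first component of the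
  result is the separating hyperplane if feasibility was declared, and \<open>None\<close> otherwise.  The
  second one lists all oracle answers, one per oracle call.
\<close>

primrec ellipsoid_run ::
  "(real ^ 'n \<Rightarrow> (real ^ 'n) \<times> (real ^ 'n)) \<Rightarrow> real ^ 'n \<Rightarrow> real \<Rightarrow> nat
    \<Rightarrow> (real ^ 'n) \<times> (real ^ 'n ^ 'n) \<Rightarrow> ((real ^ 'n) \<times> (real ^ 'n)) list
    \<Rightarrow> (real ^ 'n) option \<times> ((real ^ 'n) \<times> (real ^ 'n)) list" where
  "ellipsoid_run ext x \<epsilon> 0 E ps = (None, ps)"
| "ellipsoid_run ext x \<epsilon> (Suc n) E ps =
     (let w = fst E;
          (v, s) = ext (- w);
          ps' = ps @ [(v, s)]
      in if (x - v) \<bullet> w < \<epsilon> then ellipsoid_run ext x \<epsilon> n (ellipsoid_cut (v - x) E) ps'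
         else if norm w > 1 then ellipsoid_run ext x \<epsilon> n (ellipsoid_cut w E) ps'
         else (Some w, ps'))"

text \<open>
  The feasible set lies in the unit ball \<open>(0, mat 1)\<close>, which is the initial ellipsoid.
  \<open>N x\<close> is the number of iterations used for the input \<open>x\<close>.
\<close>

definition sep_or_dec ::
  "(real ^ 'n \<Rightarrow> (real ^ 'n) \<times> (real ^ 'n)) \<Rightarrow> (real ^ 'n \<Rightarrow> nat) \<Rightarrow> real \<Rightarrow> real ^ 'n
    \<Rightarrow> (real ^ 'n) option \<times> ((real ^ 'n) \<times> (real ^ 'n)) list" where
  "sep_or_dec ext N \<epsilon> x = ellipsoid_run ext x \<epsilon> (N x) (0, mat 1) []"

definition weights :: "nat \<Rightarrow> real list \<Rightarrow> bool" where
  "weights n a \<longleftrightarrow> length a = n \<and> (\<forall>i<n. 0 \<le> a ! i) \<and> (\<Sum>i<n. a ! i) = 1"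

definition decomposition_error :: "real ^ 'n \<Rightarrow> (real ^ 'n) list \<Rightarrow> real list \<Rightarrow> real" where
  "decomposition_error x vs a =
     1 / 2 * (norm ((\<Sum>i<length vs. (a ! i) *\<^sub>R (vs ! i)) - x))^2"

text \<open>\<open>opt\<close> is a solver that returns one (unspecified) optimal solution.\<close>

definition optimal_solver :: "(real ^ 'n \<Rightarrow> (real ^ 'n) list \<Rightarrow> real list) \<Rightarrow> bool" where
  "optimal_solver opt \<longleftrightarrow>
     (\<forall>x vs. vs \<noteq> [] \<longrightarrow>
        weights (length vs) (opt x vs) \<and>
        (\<forall>a. weights (length vs) a \<longrightarrow>
           decomposition_error x vs (opt x vs) \<le> decomposition_error x vs a))"


section \<open>Infeasible projection\<close>

text \<open>
  The result consists of the infeasible projection, the weights, the pairs \<open>(v, s)\<close>, and the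
  number of oracle calls made.
\<close>

definition projection ::
  "real \<Rightarrow> real \<Rightarrow> (real ^ 'n \<Rightarrow> real ^ 'n) \<Rightarrow> (real ^ 'n \<Rightarrow> nat)
    \<Rightarrow> (real ^ 'n \<Rightarrow> (real ^ 'n) list \<Rightarrow> real list) \<Rightarrow> real \<Rightarrow> real ^ 'n
    \<Rightarrow> (real ^ 'n) \<times> real list \<times> ((real ^ 'n) \<times> (real ^ 'n)) list \<times> nat" where
  "projection \<alpha> R orc N opt \<epsilon> y =
     (let sd = sep_or_dec (ext_oracle \<alpha> R orc) N \<epsilon>;
          (y', k) =
            while (\<lambda>(y', k). fst (sd y') \<noteq> None)
              (\<lambda>(y', k). (y' - \<epsilon> *\<^sub>R the (fst (sd y')), k + length (snd (sd y'))))
              ((1 / max 1 (norm y / (\<alpha> * R))) *\<^sub>R y, 0);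
          ps = snd (sd y')
      in (y', opt y' (map fst ps), ps, k + length ps))"


section \<open>The online algorithms\<close>

text \<open>
  One update of the full information algorithm: from the infeasible point \<open>y\<close> of the current
  round and the vector \<open>g\<close> fed to it, the output \<open>s\<close> and the infeasible point of the next round
  and the number of oracle calls.
\<close>

definition full_info_update ::
  "real \<Rightarrow> real \<Rightarrow> (real ^ 'n \<Rightarrow> real ^ 'n) \<Rightarrow> (real ^ 'n \<Rightarrow> nat)
    \<Rightarrow> (real ^ 'n \<Rightarrow> (real ^ 'n) list \<Rightarrow> real list) \<Rightarrow> real \<Rightarrow> real \<Rightarrow> real ^ 'n \<Rightarrow> real ^ 'n
    \<Rightarrow> ((real ^ 'n) \<times> (real ^ 'n) \<times> nat) pmf" where
  "full_info_update \<alpha> R orc N opt \<eta> \<epsilon> y g =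
     (let (y', a, ps, k) =
            projection \<alpha> R orc N opt \<epsilon> (if \<alpha> \<ge> 1 then y - \<eta> *\<^sub>R g else y + \<eta> *\<^sub>R g)
      in map_pmf (\<lambda>s. (s, y', k)) (pmf_of_list (zip (map snd ps) a)))"

text \<open>The point played in a round, and the estimate of the loss or payoff vector \<open>f\<close>.\<close>

definition bandit_play ::
  "real \<Rightarrow> ('n \<Rightarrow> real ^ 'n) \<Rightarrow> real ^ 'n \<Rightarrow> real ^ 'n \<Rightarrow> ((real ^ 'n) \<times> (real ^ 'n)) pmf" where
  "bandit_play \<gamma> q f s =
     do {
       explore \<leftarrow> bernoulli_pmf \<gamma>;
       if explore then do {
         i \<leftarrow> pmf_of_set UNIV;
         let l = q i \<bullet> f;
         return_pmf
           (q i, (real CARD('n) * l / \<gamma>) *\<^sub>R (matrix_inv (spanner_matrix q) *v q i))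
       }
       else return_pmf (s, 0)
     }"

text \<open>
  The state after \<open>t\<close> rounds: the output \<open>s\<close> and the infeasible point \<open>y\<close> of the full information
  algorithm for round \<open>t + 1\<close>, the points \<open>p 1, \<dots>, p t\<close> played so far, and the total number of
  oracle calls so far.  The sequence \<open>f\<close> is fixed beforehand (oblivious adversary).
\<close>

primrec bandit_state ::
  "real \<Rightarrow> real \<Rightarrow> (real ^ 'n \<Rightarrow> real ^ 'n) \<Rightarrow> (real ^ 'n \<Rightarrow> nat)
    \<Rightarrow> (real ^ 'n \<Rightarrow> (real ^ 'n) list \<Rightarrow> real list) \<Rightarrow> real \<Rightarrow> real \<Rightarrow> real
    \<Rightarrow> ('n \<Rightarrow> real ^ 'n) \<Rightarrow> real ^ 'n \<Rightarrow> (nat \<Rightarrow> real ^ 'n) \<Rightarrow> nat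
    \<Rightarrow> ((real ^ 'n) \<times> (real ^ 'n) \<times> (nat \<Rightarrow> real ^ 'n) \<times> nat) pmf" where
  "bandit_state \<alpha> R orc N opt \<eta> \<epsilon> \<gamma> q s1 f 0 =
     return_pmf (s1, \<alpha> *\<^sub>R s1, (\<lambda>_. 0), 0)"
| "bandit_state \<alpha> R orc N opt \<eta> \<epsilon> \<gamma> q s1 f (Suc t) =
     do {
       (s, y, p, k) \<leftarrow> bandit_state \<alpha> R orc N opt \<eta> \<epsilon> \<gamma> q s1 f t;
       (s_hat, f_hat) \<leftarrow> bandit_play \<gamma> q (f (Suc t)) s;
       (s', y', k') \<leftarrow> full_info_update \<alpha> R orc N opt \<eta> \<epsilon> y f_hat;
       return_pmf (s', y', p(Suc t := s_hat), k + k')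
     }"

text \<open>
  Joint distribution of the points played in rounds \<open>1, \<dots>, T\<close> and of the total number of oracle
  calls made in these rounds.
\<close>

definition bandit ::
  "real \<Rightarrow> real \<Rightarrow> (real ^ 'n \<Rightarrow> real ^ 'n) \<Rightarrow> (real ^ 'n \<Rightarrow> nat)
    \<Rightarrow> (real ^ 'n \<Rightarrow> (real ^ 'n) list \<Rightarrow> real list) \<Rightarrow> real \<Rightarrow> real \<Rightarrow> real
    \<Rightarrow> ('n \<Rightarrow> real ^ 'n) \<Rightarrow> real ^ 'n \<Rightarrow> (nat \<Rightarrow> real ^ 'n) \<Rightarrow> nat
    \<Rightarrow> ((nat \<Rightarrow> real ^ 'n) \<times> nat) pmf" where
  "bandit \<alpha> R orc N opt \<eta> \<epsilon> \<gamma> q s1 f T =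
     map_pmf (\<lambda>(s, y, p, k). (p, k)) (bandit_state \<alpha> R orc N opt \<eta> \<epsilon> \<gamma> q s1 f T)"

text \<open>
  Admissible iteration counts of the ellipsoid method, for all inputs \<open>x\<close>.  The constants must
  not depend on the dimension, which is a type here, so they cannot be existentially quantified
  inside a statement; 16 is a concrete admissible value of the universal constant in the lower
  bound, and \<open>c\<close> is the constant in the requirement that \<open>N x\<close> is of this order.  A positive
  integer cannot be bounded by a multiple of the logarithm when the latter is near 0 or negative,
  whence \<open>max 1\<close>.
\<close>

definition admissible_iterations ::
  "real \<Rightarrow> real \<Rightarrow> real \<Rightarrow> real \<Rightarrow> (real ^ 'n \<Rightarrow> nat) \<Rightarrow> bool" where
  "admissible_iterations c \<alpha> R \<epsilon> N \<longleftrightarrow>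
     (\<forall>x. N x > 0 \<and>
        real (N x) \<ge> 16 * real CARD('n)^2 * ln (((\<alpha> + 1) * R + norm x) / \<epsilon>) \<and>
        real (N x) \<le> c * (real CARD('n)^2 * max 1 (ln (((\<alpha> + 1) * R + norm x) / \<epsilon>))))"

end

(*
  If the ellipsoid method finds no hyperplane separating x from the convex hull of alpha K, then no
  unit vector separates x by 3 epsilon from all the collected oracle answers v: such a vector would
  make a whole ball of feasible points survive every cut, against the decay of the volume.  Hence x is
  3 epsilon-close to a convex combination of the v, and the corresponding points s of K are at least
  as good as the v.  Otherwise a step along the hyperplane brings x closer to every point of the hull
  by a fixed amount, so the number of calls made by a projection is paid for by the decrease of the
  squared distance to the hull.  The regret bound is that of online gradient descent, run with the
  unbiased estimates of the loss vectors; the sum of two points of the non-negative orthant is longer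
  than their difference, which gives the constant alpha^2 R^2.

  Volumes are not measured: ellipsoids are images w + L B of the unit ball B, and |det L| replaces the
  volume.
*)

theory Submission
  imports Defs
begin

section \<open>The ellipsoid method\<close>

text \<open>Distances to the hull itself are never formed. Every decrease is shown for the squared
  distance to \<open>\<alpha> *\<^sub>R x\<close>, for each single \<open>x\<close> in
  \<open>K\<close>: the regret bound uses it at the best comparator, the count of calls at the start
  point \<open>s1\<close>, where the initial distance is 0.

  The norm of the later iterates of a projection is controlled only through these distances, which
  stay below \<open>2 * \<alpha> * R\<close>. Norms up to \<open>3 * \<alpha> * R\<close> must be
  allowed, so the logarithm in the number of calls is first bounded with
  \<open>4 * \<alpha> + 1\<close> in place of \<open>\<alpha> + 1\<close>; replacing it afterwards
  costs \<open>2 * ln 2\<close>.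

  What shapes the regret proof is that the point to be played is drawn one round ahead and is good
  only on average, against a vector fixed before the draw. As the adversary is oblivious, the next
  loss vector is such a vector. The comparison of \<open>s\<close> with \<open>y\<close> is
  therefore carried over to the next round with a free vector \<open>\<phi>\<close>, instead of
  being settled in the round of the draw.\<close>

lemma norm_orthogonal_matrix_vector:
  fixes U :: "real ^ 'n ^ 'n"
  assumes "orthogonal_matrix U"
  shows "norm (U *v x) = norm x"
proof -
  have "(U *v x) \<bullet> (U *v x) = ((U *v x) v* U) \<bullet> x"
    by (simp add: dot_lmul_matrix)
  also have "(U *v x) v* U = (transpose U ** U) *v x"
    by (simp flip: matrix_vector_mul_assoc)
  finally show ?thesis
    using assms by (simp add: norm_eq orthogonal_matrix)
qed

text \<open>An ellipsoid fixes its factor \<open>L\<close> only up to an orthogonal matrix on the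
  right. Rotating \<open>axis k 1\<close> to the direction of \<open>g v* L\<close> turns the cut by
  \<open>g\<close> into a coordinate half space of the unit ball and leaves the ellipsoid
  unchanged.\<close>

lemma aligned_factor:
  fixes L :: "real ^ 'n ^ 'n" and k :: 'n
  assumes "det L \<noteq> 0" and "g \<noteq> 0"
  obtains P r where "P ** transpose P = L ** transpose L" "\<bar>det P\<bar> = \<bar>det L\<bar>"
    "0 < r" "g v* P = r *\<^sub>R axis k 1"
    "\<And>u. \<exists>p. norm p = norm u \<and> L *v u = P *v p"
proof -
  have "transpose L *v g \<noteq> 0"
  proof
    assume "transpose L *v g = 0"
    moreover have "invertible (transpose L)"
      using assms by (simp add: invertible_det_nz)
    ultimately show False
      using assms(2) by (metis matrix_left_invertible_ker invertible_def)
  qed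
  then have h: "norm (g v* L) > 0"
    by simp
  obtain U :: "real ^ 'n ^ 'n" where U: "orthogonal_matrix U" and
      Uk: "U *v axis k 1 = (1 / norm (g v* L)) *\<^sub>R (g v* L)"
    by (rule orthogonal_matrix_exists_basis[of "(1 / norm (g v* L)) *\<^sub>R (g v* L)" k]) (use h in auto)
  have UU: "U ** transpose U = mat 1" "transpose U ** U = mat 1"
    using U by (auto simp: orthogonal_matrix_def)
  show ?thesis
  proof
    show "(L ** U) ** transpose (L ** U) = L ** transpose L"
    proof -
      have "(L ** U) ** transpose (L ** U) = L ** (U ** transpose U) ** transpose L"
        by (simp only: matrix_transpose_mul matrix_mul_assoc)
      then show ?thesis
        by (simp add: UU)
    qed
    show "\<bar>det (L ** U)\<bar> = \<bar>det L\<bar>"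
      using det_orthogonal_matrix[OF U] by (auto simp: det_mul abs_mult)
    show "norm (g v* L) > 0"
      by (rule h)
    have "g v* L = norm (g v* L) *\<^sub>R (U *v axis k 1)"
      using h unfolding Uk by simp
    then have "(g v* L) v* U = norm (g v* L) *\<^sub>R ((U *v axis k 1) v* U)"
      by (metis scaleR_vector_matrix_assoc)
    also have "(U *v axis k 1) v* U = (transpose U ** U) *v axis k 1"
      by (simp flip: matrix_vector_mul_assoc)
    finally show "g v* (L ** U) = norm (g v* L) *\<^sub>R axis k 1"
      by (simp add: UU vector_matrix_mul_assoc)
    show "\<exists>p. norm p = norm u \<and> L *v u = (L ** U) *v p" for u
    proof (intro exI conjI)
      show "norm (transpose U *v u) = norm u"
        by (rule norm_orthogonal_matrix_vector) (use U in simp)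
      show "L *v u = (L ** U) *v (transpose U *v u)"
        by (metis UU(1) matrix_vector_mul_assoc matrix_vector_mul_lid)
    qed
  qed
qed

text \<open>The left side is the determinant of the update: one axis shrinks, \<open>d - 1\<close>
  axes are stretched. By \<open>1 + x <= exp x\<close> the first factor is at most
  \<open>exp (- 1 / (d + 1))\<close>, while all the stretched axes together give at most
  \<open>exp (1 / (2 * (d + 1)))\<close>, half of the gain.\<close>

lemma cut_volume_factor:
  fixes d :: nat
  assumes "d \<ge> 1"
  shows "real d / (real d + 1) * (sqrt ((real d)\<^sup>2 / ((real d)\<^sup>2 - 1))) ^ (d - 1)
    \<le> exp (- 1 / (2 * (real d + 1)))"
proof (cases "d = 1")
  case True
  \<comment> \<open>For \<open>d = 1\<close> the exponent \<open>d - 1\<close> is 0, so the root of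
    a quotient by zero disappears and \<open>1 / 2 <= 3 / 4\<close> is enough.\<close>
  have "1 + (- 1 / 4 :: real) \<le> exp (- 1 / 4)"
    by (rule exp_ge_add_one_self)
  then show ?thesis
    using True by simp
next
  case False
  then have d: "real d \<ge> 2"
    using assms by simp
  then have d2: "(real d)\<^sup>2 - 1 > 0"
    using power_mono[of 2 "real d" 2] by simp
  have a: "real d / (real d + 1) \<le> exp (- 1 / (real d + 1))"
    using exp_ge_add_one_self[of "- 1 / (real d + 1)"] d by (simp add: field_simps)
  have "(real d)\<^sup>2 / ((real d)\<^sup>2 - 1) = 1 + 1 / ((real d)\<^sup>2 - 1)"
    using d2 by (simp add: field_simps)
  also have "\<dots> \<le> exp (1 / ((real d)\<^sup>2 - 1))"
    by (rule exp_ge_add_one_self)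
  finally have "sqrt ((real d)\<^sup>2 / ((real d)\<^sup>2 - 1)) \<le> sqrt (exp (1 / ((real d)\<^sup>2 - 1)))"
    by simp
  also have "\<dots> = exp (1 / ((real d)\<^sup>2 - 1) / 2)"
    using exp_double[of "1 / ((real d)\<^sup>2 - 1) / 2"] by (intro real_sqrt_unique) (simp_all only: field_sum_of_halves mult_2 exp_ge_zero)
  finally have "(sqrt ((real d)\<^sup>2 / ((real d)\<^sup>2 - 1))) ^ (d - 1)
      \<le> exp (1 / ((real d)\<^sup>2 - 1) / 2) ^ (d - 1)"
    using d2 by (intro power_mono) auto
  also have "\<dots> = exp (real (d - 1) * (1 / ((real d)\<^sup>2 - 1) / 2))"
    by (simp flip: exp_of_nat_mult)
  also have "real (d - 1) * (1 / ((real d)\<^sup>2 - 1) / 2) = 1 / (2 * (real d + 1))"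
  proof -
    have "(real d)\<^sup>2 - 1 = (real d - 1) * (real d + 1)"
      by (simp add: algebra_simps power2_eq_square)
    then show ?thesis
      using d by (simp add: of_nat_diff)
  qed
  finally have b: "(sqrt ((real d)\<^sup>2 / ((real d)\<^sup>2 - 1))) ^ (d - 1) \<le> exp (1 / (2 * (real d + 1)))" .
  have "real d / (real d + 1) * (sqrt ((real d)\<^sup>2 / ((real d)\<^sup>2 - 1))) ^ (d - 1)
      \<le> exp (- 1 / (real d + 1)) * exp (1 / (2 * (real d + 1)))"
    by (intro mult_mono a b) (use d d2 in auto)
  also have "\<dots> = exp (- 1 / (2 * (real d + 1)))"
  proof -
    have "- 1 / (real d + 1) + 1 / (2 * (real d + 1)) = - 1 / (2 * (real d + 1))"
      using d by (simp add: divide_simps)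
    then show ?thesis
      by (metis exp_add)
  qed
  finally show ?thesis .
qed

text \<open>Here \<open>t\<close> is the coordinate along the cut and \<open>S\<close> the sum of
  the other squares. At \<open>S = 1 - t\<^sup>2\<close> the left side exceeds 1 by
  \<open>2 * (d + 1) * (t * (t + 1)) / d\<^sup>2\<close>, which is not positive on the half
  \<open>-1 <= t <= 0\<close>.\<close>

lemma half_ball_radius:
  fixes d t S :: real
  assumes "d \<ge> 1" "-1 \<le> t" "t \<le> 0" "t\<^sup>2 + S \<le> 1"
  shows "((d + 1) / d * (t + 1 / (d + 1)))\<^sup>2 + (d\<^sup>2 - 1) / d\<^sup>2 * S \<le> 1"
proof -
  have "(d\<^sup>2 - 1) / d\<^sup>2 * S \<le> (d\<^sup>2 - 1) / d\<^sup>2 * (1 - t\<^sup>2)"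
    using assms by (intro mult_left_mono) (auto simp: one_le_power)
  moreover have "((d + 1) / d * (t + 1 / (d + 1)))\<^sup>2 + (d\<^sup>2 - 1) / d\<^sup>2 * (1 - t\<^sup>2)
      = 1 + 2 * (d + 1) * (t * (t + 1)) / d\<^sup>2"
  proof -
    have "(d + 1) * (t + 1 / (d + 1)) = (d + 1) * t + 1"
      using assms by (subst distrib_left) simp
    then have "((d + 1) / d * (t + 1 / (d + 1)))\<^sup>2 = ((d + 1) * t + 1)\<^sup>2 / d\<^sup>2"
      by (metis power_divide times_divide_eq_left)
    moreover have "((d + 1) * t + 1)\<^sup>2 + (d\<^sup>2 - 1) * (1 - t\<^sup>2) = d\<^sup>2 + 2 * (d + 1) * (t * (t + 1))"
      by (simp add: algebra_simps power2_eq_square)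
    ultimately have "((d + 1) / d * (t + 1 / (d + 1)))\<^sup>2 + (d\<^sup>2 - 1) / d\<^sup>2 * (1 - t\<^sup>2)
        = (d\<^sup>2 + 2 * (d + 1) * (t * (t + 1))) / d\<^sup>2"
      by (metis add_divide_distrib times_divide_eq_left)
    then show ?thesis
      using assms by (simp add: add_divide_distrib)
  qed
  moreover have "t * (t + 1) \<le> 0"
    using assms by (simp add: mult_nonpos_nonneg)
  then have "2 * (d + 1) * (t * (t + 1)) / d\<^sup>2 \<le> 0"
    using assms by (simp add: divide_nonpos_nonneg mult_nonneg_nonpos)
  ultimately show ?thesis
    by linarith
qed

text \<open>In the coordinates of the aligned factor \<open>P\<close> the part to be kept is the
  half ball \<open>p $ k <= 0\<close>. It lies in the ellipsoid with centre
  \<open>- 1 / (d + 1)\<close> on the \<open>k\<close>-th axis and semi-axes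
  \<open>d / (d + 1)\<close> along it and \<open>\<kappa>\<close> across it. These semi-axes form
  the diagonal matrix \<open>D\<close>, so \<open>P ** D\<close> factors the new matrix and the
  determinant changes by \<open>det D\<close>.\<close>

lemma ellipsoid_cut:
  fixes L :: "real ^ 'n ^ 'n" and w g :: "real ^ 'n"
  assumes L: "det L \<noteq> 0" and g: "g \<noteq> 0"
  obtains w' L' where "ellipsoid_cut g (w, L ** transpose L) = (w', L' ** transpose L')"
    "det L' \<noteq> 0" "\<bar>det L'\<bar> \<le> exp (- 1 / (2 * (real CARD('n) + 1))) * \<bar>det L\<bar>"
    "\<And>z. z \<in> (\<lambda>u. w + L *v u) ` cball 0 1 \<Longrightarrow> g \<bullet> z \<le> g \<bullet> w
      \<Longrightarrow> z \<in> (\<lambda>u. w' + L' *v u) ` cball 0 1"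
proof -
  define d where "d = real CARD('n)"
  have d1: "d \<ge> 1"
    using zero_less_card_finite[where 'a='n] unfolding d_def by linarith
  \<comment> \<open>Any coordinate can serve as the direction of the cut.\<close>
  fix k :: 'n
  obtain P r where P: "P ** transpose P = L ** transpose L" "\<bar>det P\<bar> = \<bar>det L\<bar>"
    and r: "0 < r" "g v* P = r *\<^sub>R axis k 1"
    and Lu: "\<And>u. \<exists>p. norm p = norm u \<and> L *v u = P *v p"
    using aligned_factor[OF L g, of k] by metis
  \<comment> \<open>In dimension 1 this is the root of a quotient by zero, but there is no
    coordinate other than \<open>k\<close> that it could scale.\<close>
  define \<kappa> where "\<kappa> = sqrt (d\<^sup>2 / (d\<^sup>2 - 1))"
  define D :: "real ^ 'n ^ 'n" where
    "D = (\<chi> i j. if i = j then if i = k then d / (d + 1) else \<kappa> else 0)"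
  define w' where "w' = w - (1 / (d + 1)) *\<^sub>R (P *v axis k 1)"
  have gt1: "d > 1" if "i \<noteq> k" for i
  proof -
    have "card {i, k} \<le> CARD('n)"
      by (rule card_mono) auto
    then show ?thesis
      using that by (simp add: d_def)
  qed
  have d2: "d\<^sup>2 - 1 > 0" if "i \<noteq> k" for i
    using gt1[OF that] by (simp add: one_less_power)
  have dgt: "d > 1" if "CARD('n) \<noteq> 1"
  proof -
    have "CARD('n) > 1"
      using that zero_less_card_finite[where 'a='n] by linarith
    then show ?thesis
      by (simp add: d_def)
  qed
  have AG: "(L ** transpose L) *v g = r *\<^sub>R (P *v axis k 1)"
  proof -
    have "(L ** transpose L) *v g = P *v (g v* P)"
      by (simp flip: P(1) matrix_vector_mul_assoc)
    then show ?thesis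
      by (simp add: r matrix_vector_mult_scaleR)
  qed
  have "g \<bullet> (P *v axis k 1) = (g v* P) \<bullet> axis k 1"
    by (simp add: dot_lmul_matrix)
  then have gP: "g \<bullet> (P *v axis k 1) = r"
    by (simp add: r inner_axis)
  have b: "(1 / sqrt (g \<bullet> ((L ** transpose L) *v g))) *\<^sub>R ((L ** transpose L) *v g) = P *v axis k 1"
    using r(1) by (simp add: AG gP)
  have Pk: "(P *v axis k 1) $ i = P $ i $ k" for i
    by (simp add: matrix_vector_mult_def axis_def if_distrib cong: if_cong)
  have entry: "(P ** D) $ i $ j = P $ i $ j * (if j = k then d / (d + 1) else \<kappa>)" for i j
    by (simp add: matrix_matrix_mult_def D_def if_distrib cong: if_cong)
  have LD: "((P ** D) ** transpose (P ** D)) $ i $ l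
      = (\<Sum>j\<in>UNIV. P $ i $ j * P $ l $ j * (if j = k then d / (d + 1) else \<kappa>)\<^sup>2)" for i l
    by (simp add: matrix_matrix_mult_def[of "P ** D"] entry transpose_def power2_eq_square
        mult_ac cong: if_cong)
  have PP: "(L ** transpose L) $ i $ l = (\<Sum>j\<in>UNIV. P $ i $ j * P $ l $ j)" for i l
    unfolding P(1)[symmetric] by (simp add: matrix_matrix_mult_def transpose_def)
  have A': "(if CARD('n) = 1 then (1 / 4) *\<^sub>R (L ** transpose L)
      else (d\<^sup>2 / (d\<^sup>2 - 1)) *\<^sub>R (L ** transpose L
        - (2 / (d + 1)) *\<^sub>R outer (P *v axis k 1) (P *v axis k 1)))
      = (P ** D) ** transpose (P ** D)"
  proof (cases "CARD('n) = 1")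
    case True
    \<comment> \<open>In dimension 1 only the semi-axis \<open>1 / 2\<close> occurs; its square is
      the factor of the bisection rule.\<close>
    then have "j = k" for j
      using gt1[of j] by (auto simp: d_def)
    then have eq: "(if j = k then d / (d + 1) else \<kappa>)\<^sup>2 = 1 / 4" for j
      using True by (simp add: d_def power2_eq_square)
    have "((P ** D) ** transpose (P ** D)) $ i $ l = ((1 / 4) *\<^sub>R (L ** transpose L)) $ i $ l" for i l
      unfolding LD eq by (simp add: PP sum_distrib_left mult_ac)
    then show ?thesis
      using True by (simp add: vec_eq_iff)
  next
    case False
    then have "d > 1"
      by (rule dgt)
    then have dp: "d\<^sup>2 - 1 > 0"
      by (simp add: one_less_power)
    \<comment> \<open>The rank-one term of the update lowers the common factor
      \<open>\<kappa>\<^sup>2\<close> to the square of the short semi-axis, at the coordinate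
      \<open>k\<close> only.\<close>
    have "(d / (d + 1))\<^sup>2 = d\<^sup>2 / (d\<^sup>2 - 1) - d\<^sup>2 / (d\<^sup>2 - 1) * (2 / (d + 1))"
    proof -
      have e: "d\<^sup>2 - 1 = (d - 1) * (d + 1)"
        by (simp add: algebra_simps power2_eq_square)
      have "1 - 2 / (d + 1) = (d - 1) / (d + 1)"
        using d1 by (simp add: field_simps)
      then have "d\<^sup>2 / (d\<^sup>2 - 1) * (1 - 2 / (d + 1)) = (d / (d + 1))\<^sup>2"
        unfolding e using \<open>d > 1\<close> by (simp add: power2_eq_square)
      then show ?thesis
        by (simp only: right_diff_distrib mult_1_right)
    qed
    moreover have "\<kappa>\<^sup>2 = d\<^sup>2 / (d\<^sup>2 - 1)"
      using dp by (simp add: \<kappa>_def)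
    ultimately have "(if j = k then d / (d + 1) else \<kappa>)\<^sup>2
        = d\<^sup>2 / (d\<^sup>2 - 1) - (if j = k then d\<^sup>2 / (d\<^sup>2 - 1) * (2 / (d + 1)) else 0)" for j
      by simp
    then have "((P ** D) ** transpose (P ** D)) $ i $ l
        = (\<Sum>j\<in>UNIV. d\<^sup>2 / (d\<^sup>2 - 1) * (P $ i $ j * P $ l $ j)
            - (if j = k then d\<^sup>2 / (d\<^sup>2 - 1) * (2 / (d + 1)) * (P $ i $ k * P $ l $ k) else 0))" for i l
      unfolding LD by (intro sum.cong refl) (simp add: right_diff_distrib mult_ac)
    also have "\<dots> i l = d\<^sup>2 / (d\<^sup>2 - 1) * (\<Sum>j\<in>UNIV. P $ i $ j * P $ l $ j)
        - d\<^sup>2 / (d\<^sup>2 - 1) * (2 / (d + 1)) * (P $ i $ k * P $ l $ k)" for i l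
      by (simp add: sum_subtractf sum_distrib_left)
    finally show ?thesis
      using False by (simp add: vec_eq_iff PP outer_def Pk right_diff_distrib mult_ac)
  qed
  have detD: "det D = d / (d + 1) * \<kappa> ^ (CARD('n) - 1)"
  proof -
    have "det D = (\<Prod>i\<in>UNIV. if i = k then d / (d + 1) else \<kappa>)"
      by (subst det_diagonal) (auto simp: D_def)
    also have "\<dots> = d / (d + 1) * (\<Prod>i\<in>UNIV - {k}. \<kappa>)"
      by (subst prod.remove[of _ k]) auto
    finally show ?thesis
      by (simp add: card_Diff_subset)
  qed
  show ?thesis
  proof
    show "ellipsoid_cut g (w, L ** transpose L) = (w', (P ** D) ** transpose (P ** D))"
      using g by (simp only: ellipsoid_cut_def Let_def prod.case b w'_def A' if_False flip: d_def)
    have "\<kappa> ^ (CARD('n) - 1) > 0"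
    proof (cases "CARD('n) = 1")
      case False
      then have "d > 1"
        by (rule dgt)
      then have "\<kappa> > 0"
        by (simp add: \<kappa>_def one_less_power)
      then show ?thesis
        by simp
    qed simp
    then have dD: "det D > 0"
      using d1 by (simp add: detD)
    then show "det (P ** D) \<noteq> 0"
      using P(2) L by (simp add: det_mul)
    have "det D \<le> exp (- 1 / (2 * (real CARD('n) + 1)))"
      using cut_volume_factor[of "CARD('n)"] d1 unfolding detD by (simp add: \<kappa>_def d_def)
    moreover have "\<bar>det (P ** D)\<bar> = det D * \<bar>det L\<bar>"
      using dD by (simp add: det_mul abs_mult P(2))
    ultimately show "\<bar>det (P ** D)\<bar> \<le> exp (- 1 / (2 * (real CARD('n) + 1))) * \<bar>det L\<bar>"
      by (metis abs_ge_zero mult_right_mono)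
    fix z
    assume z: "z \<in> (\<lambda>u. w + L *v u) ` cball 0 1" "g \<bullet> z \<le> g \<bullet> w"
    then obtain u where u: "norm u \<le> 1" "z = w + L *v u"
      by auto
    with Lu obtain p where p: "norm p \<le> 1" "z = w + P *v p"
      by metis
    \<comment> \<open>The preimage under \<open>D\<close> of \<open>p\<close>, shifted by the
      displacement of the centre.\<close>
    define u' :: "real ^ 'n" where
      "u' = (\<chi> j. if j = k then (d + 1) / d * (p $ k + 1 / (d + 1)) else sqrt (d\<^sup>2 - 1) / d * p $ j)"
    have "r * p $ k = g \<bullet> (P *v p)"
      by (simp flip: dot_lmul_matrix add: r inner_axis' )
    also have "\<dots> \<le> 0"
      using z(2) by (simp add: p(2) inner_add_right)
    finally have pk: "p $ k \<le> 0"
      using r(1) by (simp add: mult_le_0_iff)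
    have Dv: "(D *v v) $ j = (if j = k then d / (d + 1) else \<kappa>) * v $ j" for v j
    proof -
      have "(D *v v) $ j = (\<Sum>i\<in>UNIV. if j = i then (if j = k then d / (d + 1) else \<kappa>) * v $ i else 0)"
        by (simp only: matrix_vector_mult_def D_def vec_lambda_beta) (intro sum.cong refl, simp)
      then show ?thesis
        by simp
    qed
    have Du: "(D *v u') $ j = (p + (1 / (d + 1)) *\<^sub>R axis k 1) $ j" for j
    proof (cases "j = k")
      case True
      then show ?thesis
        using d1 by (simp add: Dv u'_def)
    next
      case False
      then show ?thesis
        using d1 d2[OF False] by (simp add: Dv u'_def \<kappa>_def real_sqrt_divide axis_def)
    qed
    have "z = w' + P *v (p + (1 / (d + 1)) *\<^sub>R axis k 1)"
      by (simp add: w'_def p(2) matrix_vector_right_distrib matrix_vector_mult_scaleR)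
    also have "p + (1 / (d + 1)) *\<^sub>R axis k 1 = D *v u'"
      using Du by (simp add: vec_eq_iff)
    finally have "z = w' + (P ** D) *v u'"
      by (simp add: matrix_vector_mul_assoc)
    moreover have "norm u' \<le> 1"
    proof -
      have split: "(norm v)\<^sup>2 = (v $ k)\<^sup>2 + (\<Sum>j\<in>UNIV - {k}. (v $ j)\<^sup>2)" for v :: "real ^ 'n"
        unfolding power2_norm_eq_inner inner_vec_def
        by (subst sum.remove[of _ k]) (auto simp: power2_eq_square)
      define S where "S = (\<Sum>j\<in>UNIV - {k}. (p $ j)\<^sup>2)"
      have "(norm p)\<^sup>2 \<le> 1"
        using p(1) by (simp add: abs_square_le_1)
      then have pS: "(p $ k)\<^sup>2 + S \<le> 1"
        by (simp add: split S_def)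
      have "(u' $ j)\<^sup>2 = (d\<^sup>2 - 1) / d\<^sup>2 * (p $ j)\<^sup>2" if "j \<in> UNIV - {k}" for j
        using that d2[of j] by (simp add: u'_def power_mult_distrib power_divide)
      then have "(\<Sum>j\<in>UNIV - {k}. (u' $ j)\<^sup>2) = (d\<^sup>2 - 1) / d\<^sup>2 * S"
        by (simp add: S_def sum_distrib_left)
      then have "(norm u')\<^sup>2 = ((d + 1) / d * (p $ k + 1 / (d + 1)))\<^sup>2 + (d\<^sup>2 - 1) / d\<^sup>2 * S"
        by (simp add: split) (simp add: u'_def)
      also have "\<dots> \<le> 1"
        using component_le_norm_cart[of p k] p(1)
        by (intro half_ball_radius d1 pk pS) auto
      finally show ?thesis
        by (simp add: abs_square_le_1)
    qed
    ultimately show "z \<in> (\<lambda>u. w' + (P ** D) *v u) ` cball 0 1"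
      by auto
  qed
qed

section \<open>Determinants in place of volumes\<close>

text \<open>By the Leibniz formula. The size of the bound is immaterial: it must only hold for all
  powers of a matrix at once.\<close>

lemma abs_det_le_card_permutations:
  fixes A :: "real ^ 'n ^ 'n"
  assumes "\<And>i j. \<bar>A $ i $ j\<bar> \<le> 1"
  shows "\<bar>det A\<bar> \<le> real (card {p. p permutes (UNIV :: 'n set)})"
proof -
  have "\<bar>det A\<bar> \<le> (\<Sum>p\<in>{p. p permutes (UNIV :: 'n set)}. \<bar>of_int (sign p) * (\<Prod>i\<in>UNIV. A $ i $ p i)\<bar>)"
    unfolding det_def by (rule sum_abs)
  also have "\<dots> \<le> (\<Sum>p\<in>{p. p permutes (UNIV :: 'n set)}. 1)"
  proof (rule sum_mono)
    fix p
    have "(\<Prod>i\<in>UNIV. \<bar>A $ i $ p i\<bar>) \<le> 1"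
      by (rule prod_le_1) (simp add: assms)
    then show "\<bar>of_int (sign p) * (\<Prod>i\<in>UNIV. A $ i $ p i)\<bar> \<le> 1"
      by (simp add: abs_mult sign_def abs_prod)
  qed
  finally show ?thesis
    by simp
qed

text \<open>The determinants of the powers of a contraction are bounded, as the entries of the powers are.\<close>

lemma abs_det_contraction:
  fixes B :: "real ^ 'n ^ 'n"
  assumes "\<And>x. norm (B *v x) \<le> norm x"
  shows "\<bar>det B\<bar> \<le> 1"
proof (rule ccontr)
  assume "\<not> \<bar>det B\<bar> \<le> 1"
  then obtain m where m: "real (card {p. p permutes (UNIV :: 'n set)}) < \<bar>det B\<bar> ^ m"
    using real_arch_pow[of "\<bar>det B\<bar>"] by force
  define pw where "pw k = (((**) B) ^^ k) (mat 1)" for k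
  have det: "det (pw k) = det B ^ k" for k
    by (induction k) (simp_all add: pw_def det_mul)
  have contr: "norm (pw k *v x) \<le> norm x" for k x
  proof (induction k)
    case (Suc k)
    have "pw (Suc k) *v x = B *v (pw k *v x)"
      by (simp add: pw_def matrix_vector_mul_assoc)
    then show ?case
      using assms[of "pw k *v x"] Suc by simp
  qed (simp add: pw_def)
  have "\<bar>pw k $ i $ j\<bar> \<le> 1" for k i j
  proof -
    have "pw k $ i $ j = (pw k *v axis j 1) $ i"
      by (simp add: matrix_vector_mult_def axis_def if_distrib cong: if_cong)
    then have "\<bar>pw k $ i $ j\<bar> \<le> norm (pw k *v axis j 1)"
      by (metis component_le_norm_cart)
    also have "\<dots> \<le> 1"
      using contr[of k "axis j 1"] by simp
    finally show ?thesis .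
  qed
  then have "\<bar>det (pw m)\<bar> \<le> real (card {p. p permutes (UNIV :: 'n set)})"
    by (rule abs_det_le_card_permutations)
  then show False
    using m by (simp add: det power_abs)
qed

text \<open>The inclusion makes \<open>r\<close> times the inverse of \<open>L\<close> a
  contraction, so its determinant is at most 1 in absolute value; multiplying by
  \<open>det L\<close> gives the claim.\<close>

lemma cball_subset_ellipsoid_det:
  fixes L :: "real ^ 'n ^ 'n"
  assumes L: "det L \<noteq> 0" and r: "0 \<le> r"
    and sub: "cball c r \<subseteq> (\<lambda>u. w + L *v u) ` cball 0 1"
  shows "r ^ CARD('n) \<le> \<bar>det L\<bar>"
proof -
  obtain Li where Li: "L ** Li = mat 1" "Li ** L = mat 1"
    using L by (auto simp: invertible_def simp flip: invertible_det_nz)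
  have matr: "mat r *v x = r *\<^sub>R x" for x :: "real ^ 'n"
  proof -
    have "(mat r *v x) $ i = (\<Sum>j\<in>UNIV. if i = j then r * x $ j else 0)" for i
      by (simp only: matrix_vector_mult_def mat_def vec_lambda_beta) (intro sum.cong refl, simp)
    then show ?thesis
      by (simp add: vec_eq_iff)
  qed
  define B where "B = Li ** mat r"
  have unit: "norm (B *v x) \<le> 1" if "norm x \<le> 1" for x
  proof -
    have "norm (r *\<^sub>R x) \<le> r"
      using that r by (simp add: mult_left_le)
    \<comment> \<open>Taking two opposite points of the ball and subtracting their preimages removes
      both unknown centres \<open>c\<close> and \<open>w\<close>.\<close>
    then have c1: "c + r *\<^sub>R x \<in> cball c r" and c2: "c - r *\<^sub>R x \<in> cball c r"
      by (auto simp: dist_norm)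
    obtain u1 where u1: "c + r *\<^sub>R x = w + L *v u1" "u1 \<in> cball 0 1"
      using subsetD[OF sub c1] by (metis imageE)
    obtain u2 where u2: "c - r *\<^sub>R x = w + L *v u2" "u2 \<in> cball 0 1"
      using subsetD[OF sub c2] by (metis imageE)
    have "2 *\<^sub>R (r *\<^sub>R x) = (c + r *\<^sub>R x) - (c - r *\<^sub>R x)"
      by (simp only: scaleR_2) simp
    also have "\<dots> = L *v (u1 - u2)"
      unfolding u1(1) u2(1) by (simp add: matrix_vector_mult_diff_distrib)
    finally have "Li *v (2 *\<^sub>R (r *\<^sub>R x)) = u1 - u2"
      by (simp add: matrix_vector_mul_assoc Li)
    moreover have "B *v x = Li *v (r *\<^sub>R x)"
      unfolding B_def matr[symmetric] by (simp only: matrix_vector_mul_assoc)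
    ultimately have "2 *\<^sub>R (B *v x) = u1 - u2"
      by (simp add: matrix_vector_mult_scaleR)
    then have "2 * norm (B *v x) = norm (u1 - u2)"
      by (metis abs_numeral norm_scaleR)
    also have "\<dots> \<le> 2"
      using norm_triangle_ineq4[of u1 u2] u1(2) u2(2) by simp
    finally show ?thesis
      by simp
  qed
  have "norm (B *v x) \<le> norm x" for x
  proof (cases "x = 0")
    case False
    have "norm (B *v ((1 / norm x) *\<^sub>R x)) \<le> 1"
      by (rule unit) simp
    then show ?thesis
      using False by (simp add: matrix_vector_mult_scaleR divide_le_eq)
  qed simp
  then have "\<bar>det B\<bar> \<le> 1"
    by (rule abs_det_contraction)
  moreover have "det (mat r :: real ^ 'n ^ 'n) = r ^ CARD('n)"
    by (subst det_diagonal) (simp_all add: mat_def)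
  then have "r ^ CARD('n) = det L * det B"
    by (metis B_def Li(1) det_mul matrix_mul_assoc matrix_mul_lid)
  ultimately show ?thesis
    using r by (metis abs_mult abs_of_nonneg mult_left_le abs_ge_zero zero_le_power)
qed

section \<open>Runs of the ellipsoid method\<close>

lemma ellipsoid_run_length:
  "length (snd (ellipsoid_run ext x \<epsilon> n E ps)) \<le> length ps + n"
proof (induction n arbitrary: E ps)
  case (Suc n)
  obtain v s where vs: "ext (- fst E) = (v, s)"
    by fastforce
  show ?case
    using Suc[of "ellipsoid_cut (v - x) E" "ps @ [(v, s)]"]
      Suc[of "ellipsoid_cut (fst E) E" "ps @ [(v, s)]"]
    by (simp add: vs Let_def)
qed simp

lemma ellipsoid_run_Some:
  assumes "fst (ellipsoid_run ext x \<epsilon> n E ps) = Some w"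
  shows "norm w \<le> 1" and "\<epsilon> \<le> (x - fst (ext (- w))) \<bullet> w"
proof -
  have "norm w \<le> 1 \<and> \<epsilon> \<le> (x - fst (ext (- w))) \<bullet> w"
    using assms
  proof (induction n arbitrary: E ps)
    case (Suc n)
    obtain v s where vs: "ext (- fst E) = (v, s)"
      by fastforce
    show ?case
      using Suc.prems Suc.IH[of "ellipsoid_cut (v - x) E" "ps @ [(v, s)]"]
        Suc.IH[of "ellipsoid_cut (fst E) E" "ps @ [(v, s)]"]
      by (auto simp: vs Let_def split: if_splits)
  qed simp
  then show "norm w \<le> 1" and "\<epsilon> \<le> (x - fst (ext (- w))) \<bullet> w"
    by auto
qed

text \<open>The induction moves the starting ellipsoid, so \<open>w\<close> and \<open>L\<close> are
  general, and survival is claimed for those of its points that meet the constraints of all later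
  answers. A vanishing cut vector stops the decay of the determinant, but then \<open>x\<close>
  itself is an answer, hence in their hull; this is the first alternative.\<close>

lemma ellipsoid_run_None:
  fixes L :: "real ^ 'n ^ 'n"
  assumes "fst (ellipsoid_run ext x \<epsilon> n (w, L ** transpose L) ps) = None" and "det L \<noteq> 0"
  shows "\<exists>qs. snd (ellipsoid_run ext x \<epsilon> n (w, L ** transpose L) ps) = ps @ qs \<and> length qs = n
    \<and> set qs \<subseteq> range ext
    \<and> (x \<in> fst ` set qs \<or>
       (\<exists>w' L'. det L' \<noteq> 0 \<and> \<bar>det L'\<bar> \<le> exp (- 1 / (2 * (real CARD('n) + 1))) ^ n * \<bar>det L\<bar> \<and>
          (\<forall>u \<in> (\<lambda>u. w + L *v u) ` cball 0 1.
             norm u \<le> 1 \<longrightarrow> (\<forall>v\<in>fst ` set qs. \<epsilon> \<le> (x - v) \<bullet> u)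
               \<longrightarrow> u \<in> (\<lambda>u. w' + L' *v u) ` cball 0 1)))"
  using assms
proof (induction n arbitrary: w L ps)
  case 0
  show ?case
    by (rule exI[of _ "[]"]) (use 0 in auto)
next
  case (Suc n)
  define e where "e = exp (- 1 / (2 * (real CARD('n) + 1)))"
  obtain v s where vs: "ext (- w) = (v, s)"
    by fastforce
  define g where "g = (if (x - v) \<bullet> w < \<epsilon> then v - x else w)"
  have g: "(x - v) \<bullet> w < \<epsilon> \<or> norm w > 1"
    using Suc.prems(1) by (auto simp: vs Let_def split: if_splits)
  then have run: "ellipsoid_run ext x \<epsilon> (Suc n) (w, L ** transpose L) ps
      = ellipsoid_run ext x \<epsilon> n (ellipsoid_cut g (w, L ** transpose L)) (ps @ [(v, s)])"
    by (auto simp: vs Let_def g_def)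
  \<comment> \<open>Neither kind of cut removes a feasible \<open>u\<close>: for an oracle answer
    the constraint holds at \<open>u\<close> and fails at \<open>w\<close>, and for the norm cut
    \<open>norm u <= 1 < norm w\<close>.\<close>
  have cut: "g \<bullet> u \<le> g \<bullet> w" if "norm u \<le> 1" "\<epsilon> \<le> (x - v) \<bullet> u" for u
  proof (cases "(x - v) \<bullet> w < \<epsilon>")
    case True
    then show ?thesis
      using that by (simp add: g_def inner_diff_left)
  next
    case False
    with g have w: "norm w > 1"
      by simp
    have "w \<bullet> u \<le> norm w * norm u"
      by (rule norm_cauchy_schwarz)
    also have "\<dots> \<le> norm w * norm w"
      using w that by (intro mult_left_mono) auto
    finally show ?thesis
      using False by (simp add: g_def dot_square_norm power2_eq_square)
  qed
  show ?case
  proof (cases "g = 0")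
    case True
    \<comment> \<open>The norm cut uses a \<open>w\<close> of norm above 1, so only
      \<open>v - x\<close> can vanish.\<close>
    with g have "v = x"
      by (auto simp: g_def split: if_splits)
    moreover have "ellipsoid_cut g (w, L ** transpose L) = (w, L ** transpose L)"
      using True by (simp add: ellipsoid_cut_def)
    ultimately obtain qs where qs: "snd (ellipsoid_run ext x \<epsilon> (Suc n) (w, L ** transpose L) ps) = (ps @ [(v, s)]) @ qs"
      "length qs = n" "set qs \<subseteq> range ext"
      using Suc.IH[of w L "ps @ [(v, s)]"] Suc.prems unfolding run by metis
    have "(v, s) \<in> range ext"
      using vs by (metis rangeI)
    then show ?thesis
      using qs \<open>v = x\<close>
      by (intro exI[of _ "(v, s) # qs"]) (auto simp del: ellipsoid_run.simps)
  next
    case False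
    obtain w1 L1 where 1: "ellipsoid_cut g (w, L ** transpose L) = (w1, L1 ** transpose L1)"
      "det L1 \<noteq> 0" "\<bar>det L1\<bar> \<le> e * \<bar>det L\<bar>"
      "\<And>z. z \<in> (\<lambda>u. w + L *v u) ` cball 0 1 \<Longrightarrow> g \<bullet> z \<le> g \<bullet> w
        \<Longrightarrow> z \<in> (\<lambda>u. w1 + L1 *v u) ` cball 0 1"
      using ellipsoid_cut[OF Suc.prems(2) False, of w] unfolding e_def by metis
    obtain qs where qs: "snd (ellipsoid_run ext x \<epsilon> (Suc n) (w, L ** transpose L) ps) = (ps @ [(v, s)]) @ qs"
      "length qs = n" "set qs \<subseteq> range ext" and
      alt: "x \<in> fst ` set qs \<or>
       (\<exists>w' L'. det L' \<noteq> 0 \<and> \<bar>det L'\<bar> \<le> e ^ n * \<bar>det L1\<bar> \<and>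
          (\<forall>u \<in> (\<lambda>u. w1 + L1 *v u) ` cball 0 1.
             norm u \<le> 1 \<longrightarrow> (\<forall>v\<in>fst ` set qs. \<epsilon> \<le> (x - v) \<bullet> u)
               \<longrightarrow> u \<in> (\<lambda>u. w' + L' *v u) ` cball 0 1))"
      using Suc.IH[of w1 L1 "ps @ [(v, s)]"] Suc.prems 1(1,2) unfolding run e_def by metis
    show ?thesis
    proof (rule exI[of _ "(v, s) # qs"], intro conjI)
      show "snd (ellipsoid_run ext x \<epsilon> (Suc n) (w, L ** transpose L) ps) = ps @ (v, s) # qs"
        using qs(1) by simp
      show "length ((v, s) # qs) = Suc n"
        using qs(2) by simp
      show "set ((v, s) # qs) \<subseteq> range ext"
        using qs(3) vs by (auto simp flip: vs)
      show "x \<in> fst ` set ((v, s) # qs) \<or>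
       (\<exists>w' L'. det L' \<noteq> 0 \<and> \<bar>det L'\<bar> \<le> exp (- 1 / (2 * (real CARD('n) + 1))) ^ Suc n * \<bar>det L\<bar> \<and>
          (\<forall>u \<in> (\<lambda>u. w + L *v u) ` cball 0 1.
             norm u \<le> 1 \<longrightarrow> (\<forall>v\<in>fst ` set ((v, s) # qs). \<epsilon> \<le> (x - v) \<bullet> u)
               \<longrightarrow> u \<in> (\<lambda>u. w' + L' *v u) ` cball 0 1))"
        using alt
      proof
        assume "\<exists>w' L'. det L' \<noteq> 0 \<and> \<bar>det L'\<bar> \<le> e ^ n * \<bar>det L1\<bar> \<and>
          (\<forall>u \<in> (\<lambda>u. w1 + L1 *v u) ` cball 0 1.
             norm u \<le> 1 \<longrightarrow> (\<forall>v\<in>fst ` set qs. \<epsilon> \<le> (x - v) \<bullet> u)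
               \<longrightarrow> u \<in> (\<lambda>u. w' + L' *v u) ` cball 0 1)"
        then obtain w' L' where 2: "det L' \<noteq> 0" "\<bar>det L'\<bar> \<le> e ^ n * \<bar>det L1\<bar>"
          "\<And>u. u \<in> (\<lambda>u. w1 + L1 *v u) ` cball 0 1 \<Longrightarrow> norm u \<le> 1
            \<Longrightarrow> (\<forall>v\<in>fst ` set qs. \<epsilon> \<le> (x - v) \<bullet> u) \<Longrightarrow> u \<in> (\<lambda>u. w' + L' *v u) ` cball 0 1"
          by metis
        have "\<bar>det L'\<bar> \<le> e ^ n * (e * \<bar>det L\<bar>)"
          using 2(2) by (rule order_trans) (intro mult_left_mono 1(3), simp add: e_def)
        then have "\<bar>det L'\<bar> \<le> e ^ Suc n * \<bar>det L\<bar>"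
          by (simp add: mult_ac)
        moreover have "u \<in> (\<lambda>u. w' + L' *v u) ` cball 0 1"
          if "u \<in> (\<lambda>u. w + L *v u) ` cball 0 1" "norm u \<le> 1"
            "\<forall>v\<in>fst ` set ((v, s) # qs). \<epsilon> \<le> (x - v) \<bullet> u" for u
          using that by (intro 2(3) 1(4) cut) auto
        ultimately show ?thesis
          using 2(1) unfolding e_def by blast
      qed auto
    qed
  qed
qed

text \<open>\<open>A\<close> stands for the numerator inside the logarithm of the iteration count.
  The surviving ball is centred at \<open>(1 - r) *\<^sub>R u0\<close>, with \<open>u0\<close> the
  unit vector pointing to \<open>x\<close> from the nearest point of the hull: shrinking
  \<open>u0\<close> makes room in the unit ball, and the slack between \<open>3 * \<epsilon>\<close>
  and \<open>\<epsilon>\<close> pays for this and for the radius.\<close>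

lemma ellipsoid_decomposition:
  fixes x :: "real ^ 'n"
  assumes None: "fst (sep_or_dec ext N \<epsilon> x) = None"
    and bound: "\<And>c. norm (x - fst (ext c)) \<le> 2 * A"
    and A: "0 < A" and \<epsilon>: "0 < \<epsilon>"
    and N: "N x > 0" "16 * (real CARD('n))\<^sup>2 * ln (A / \<epsilon>) \<le> real (N x)"
  defines "qs \<equiv> snd (sep_or_dec ext N \<epsilon> x)"
  shows "length qs = N x" and "set qs \<subseteq> range ext"
    and "\<exists>p \<in> convex hull (fst ` set qs). norm (x - p) \<le> 3 * \<epsilon>"
proof -
  define d where "d = real CARD('n)"
  have d: "d \<ge> 1"
    using zero_less_card_finite[where 'a='n] unfolding d_def by linarith
  \<comment> \<open>The initial unit ball has a factor of determinant 1.\<close>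
  have I: "mat 1 = mat 1 ** transpose (mat 1 :: real ^ 'n ^ 'n)"
    by (simp add: transpose_mat)
  have run: "length qs = N x \<and> set qs \<subseteq> range ext
    \<and> (x \<in> fst ` set qs \<or>
       (\<exists>w' L'. det L' \<noteq> 0 \<and> \<bar>det (L' :: real ^ 'n ^ 'n)\<bar> \<le> exp (- 1 / (2 * (d + 1))) ^ N x \<and>
          (\<forall>u. norm u \<le> 1 \<longrightarrow> (\<forall>v\<in>fst ` set qs. \<epsilon> \<le> (x - v) \<bullet> u)
               \<longrightarrow> u \<in> (\<lambda>u. w' + L' *v u) ` cball 0 1)))"
    using ellipsoid_run_None[of ext x \<epsilon> "N x" 0 "mat 1" "[]"] None
    unfolding qs_def sep_or_dec_def d_def I[symmetric] by (auto simp: Ball_def)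
  then show len: "length qs = N x" and rng: "set qs \<subseteq> range ext"
    by auto
  show "\<exists>p \<in> convex hull (fst ` set qs). norm (x - p) \<le> 3 * \<epsilon>"
  proof (rule ccontr)
    assume far: "\<not> ?thesis"
    define H where "H = convex hull (fst ` set qs)"
    have "x \<notin> fst ` set qs"
    proof
      assume "x \<in> fst ` set qs"
      then have "x \<in> H"
        unfolding H_def by (rule hull_inc)
      then show False
        using far \<epsilon> by (force simp: H_def)
    qed
    with run obtain w' L' where L': "det L' \<noteq> 0" "\<bar>det (L' :: real ^ 'n ^ 'n)\<bar> \<le> exp (- 1 / (2 * (d + 1))) ^ N x"
      "\<And>u. norm u \<le> 1 \<Longrightarrow> (\<forall>v\<in>fst ` set qs. \<epsilon> \<le> (x - v) \<bullet> u) \<Longrightarrow> u \<in> (\<lambda>u. w' + L' *v u) ` cball 0 1"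
      by metis
    have H: "closed H" "convex H" "H \<noteq> {}"
      using N(1) len by (auto simp: H_def finite_imp_compact_convex_hull compact_imp_closed)
    define p where "p = closest_point H x"
    have "p \<in> H"
      unfolding p_def using H by (intro closest_point_in_set)
    then have \<delta>: "norm (x - p) > 3 * \<epsilon>"
      using far by (auto simp: H_def)
    then have xp: "norm (x - p) > 0"
      using \<epsilon> by linarith
    define u0 where "u0 = (1 / norm (x - p)) *\<^sub>R (x - p)"
    have u0: "norm u0 = 1"
      using xp by (simp add: u0_def)
    have sep: "norm (x - p) \<le> (x - v) \<bullet> u0" if "v \<in> H" for v
    proof -
      have "(x - p) \<bullet> (v - p) \<le> 0"
        unfolding p_def using H that by (intro closest_point_dot)
      then have "norm (x - p) * norm (x - p) \<le> (x - v) \<bullet> (x - p)"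
        by (simp flip: power2_eq_square add: power2_norm_eq_inner inner_diff inner_commute)
      then show ?thesis
        by (simp only: u0_def inner_scaleR_right times_divide_eq_left mult_1_left pos_le_divide_eq[OF xp])
    qed
    have "norm (x - v) \<le> 2 * A" if v: "v \<in> fst ` set qs" for v
    proof -
      obtain c where "v = fst (ext c)"
        using v rng by blast
      then show ?thesis
        using bound by simp
    qed
    then have "fst ` set qs \<subseteq> cball x (2 * A)"
      by (intro subsetI) (simp add: dist_norm)
    then have "H \<subseteq> cball x (2 * A)"
      unfolding H_def by (intro hull_minimal convex_cball)
    then have HA: "norm (x - v) \<le> 2 * A" if "v \<in> H" for v
      using that by (auto simp: dist_norm)
    \<comment> \<open>This forces \<open>A / \<epsilon>\<close> above \<open>3 / 2\<close>, so the
      logarithm in the iteration count is positive and can absorb additive constants.\<close>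
    have a: "3 * \<epsilon> < 2 * A"
      using HA[OF \<open>p \<in> H\<close>] \<delta> by linarith
    \<comment> \<open>The radius solves
      \<open>(1 - r) * (3 * \<epsilon>) - 2 * A * r = \<epsilon>\<close>: the shrunk
      \<open>u0\<close> keeps margin \<open>(1 - r) * (3 * \<epsilon>)\<close>, and moving inside
      the ball loses at most \<open>2 * A * r\<close>.\<close>
    define r where "r = 2 * \<epsilon> / (2 * A + 3 * \<epsilon>)"
    have r: "0 < r" "r \<le> 1"
      using A \<epsilon> a by (auto simp: r_def divide_simps)
    have "r * (2 * A + 3 * \<epsilon>) = 2 * \<epsilon>"
      using A \<epsilon> by (simp add: r_def)
    then have rA: "(1 - r) * (3 * \<epsilon>) - 2 * A * r = \<epsilon>"
      by (simp add: algebra_simps)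
    have "cball ((1 - r) *\<^sub>R u0) r \<subseteq> (\<lambda>u. w' + L' *v u) ` cball 0 1"
    proof
      fix u
      assume "u \<in> cball ((1 - r) *\<^sub>R u0) r"
      then have u: "norm (u - (1 - r) *\<^sub>R u0) \<le> r"
        by (simp add: dist_norm norm_minus_commute)
      show "u \<in> (\<lambda>u. w' + L' *v u) ` cball 0 1"
      proof (rule L'(3))
        have "norm u \<le> norm ((1 - r) *\<^sub>R u0) + norm (u - (1 - r) *\<^sub>R u0)"
          using norm_triangle_ineq[of "(1 - r) *\<^sub>R u0" "u - (1 - r) *\<^sub>R u0"] by simp
        then show "norm u \<le> 1"
          using u u0 r by simp
        show "\<forall>v\<in>fst ` set qs. \<epsilon> \<le> (x - v) \<bullet> u"
        proof
          fix v
          assume "v \<in> fst ` set qs"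
          then have v: "v \<in> H"
            unfolding H_def by (rule hull_inc)
          have "3 * \<epsilon> \<le> (x - v) \<bullet> u0"
            using sep[OF v] \<delta> by linarith
          then have "(1 - r) * (3 * \<epsilon>) \<le> (1 - r) * ((x - v) \<bullet> u0)"
            using r by (intro mult_left_mono) auto
          moreover have "\<bar>(x - v) \<bullet> (u - (1 - r) *\<^sub>R u0)\<bar> \<le> 2 * A * r"
            using Cauchy_Schwarz_ineq2[of "x - v" "u - (1 - r) *\<^sub>R u0"]
              mult_mono[OF HA[OF v] u] A by simp
          moreover have "(x - v) \<bullet> u = (1 - r) * ((x - v) \<bullet> u0) + (x - v) \<bullet> (u - (1 - r) *\<^sub>R u0)"
            by (simp add: inner_diff_right)
          ultimately show "\<epsilon> \<le> (x - v) \<bullet> u"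
            using rA by linarith
        qed
      qed
    qed
    then have "r ^ CARD('n) \<le> \<bar>det L'\<bar>"
      using L'(1) r by (intro cball_subset_ellipsoid_det) auto
    also have "\<dots> \<le> exp (- 1 / (2 * (d + 1))) ^ N x"
      by (rule L'(2))
    finally have "ln (r ^ CARD('n)) \<le> ln (exp (- 1 / (2 * (d + 1))) ^ N x)"
      using r by (subst ln_le_cancel_iff) auto
    then have "d * ln r \<le> real (N x) * (- 1 / (2 * (d + 1)))"
      using r by (simp add: ln_realpow d_def)
    then have N1: "real (N x) / (2 * (d + 1)) \<le> d * ln (1 / r)"
      using r by (simp add: ln_div)
    define b where "b = A / \<epsilon>"
    have b: "b > 3 / 2"
      using a \<epsilon> by (simp add: b_def field_simps)
    have "1 / r = b + 3 / 2"
      using A \<epsilon> by (simp add: r_def b_def field_simps)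
    \<comment> \<open>From \<open>b > 3 / 2\<close> the power \<open>b ^ 4\<close> dominates
      \<open>b + 3 / 2\<close>, so \<open>ln (1 / r) < 4 * ln b\<close>. Together with
      \<open>2 * (d + 1) <= 4 * d\<close> this is the origin of the 16 in the iteration
      count.\<close>
    also have "\<dots> < b * b ^ 3"
    proof -
      have "(3 / 2) ^ 3 \<le> b ^ 3"
        using b by (intro power_mono) auto
      then have "b * (27 / 8) \<le> b * b ^ 3"
        using b by (intro mult_left_mono) (auto simp: power3_eq_cube)
      then show ?thesis
        using b by linarith
    qed
    finally have "ln (1 / r) < ln (b ^ 4)"
      using r b by (subst ln_less_cancel_iff) (auto simp: power_numeral_reduce)
    then have "ln (1 / r) < 4 * ln b"
      using b by (simp add: ln_realpow)
    then have "d * ln (1 / r) < d * (4 * ln b)"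
      using d by simp
    with N1 have "real (N x) / (2 * (d + 1)) < d * (4 * ln b)"
      by linarith
    then have "real (N x) < (d * (4 * ln b)) * (2 * (d + 1))"
      using d by (simp add: pos_divide_less_eq)
    also have "\<dots> \<le> (d * (4 * ln b)) * (4 * d)"
      using d b by (intro mult_left_mono) auto
    also have "\<dots> = 16 * d\<^sup>2 * ln b"
      by (simp add: power2_eq_square)
    also have "\<dots> \<le> real (N x)"
      using N(2) by (simp add: b_def d_def)
    finally show False
      by simp
  qed
qed

section \<open>The infeasible projection\<close>

lemma inner_nonneg_orthant:
  assumes "u \<in> nonneg_orthant" "v \<in> nonneg_orthant"
  shows "0 \<le> u \<bullet> v"
  using assms by (auto simp: nonneg_orthant_def inner_vec_def intro!: sum_nonneg)

lemma pos_part_nonneg: "pos_part c \<in> nonneg_orthant"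
  and neg_part_nonpos: "- neg_part c \<in> nonneg_orthant"
  and pos_part_plus_neg_part: "pos_part c + neg_part c = c"
  and pos_part_inner_neg_part: "pos_part c \<bullet> neg_part c = 0"
  by (auto simp: pos_part_def neg_part_def nonneg_orthant_def vec_eq_iff inner_vec_def max_def min_def
      intro!: sum.neutral)

lemma sgn_nonneg_orthant: "v \<in> nonneg_orthant \<Longrightarrow> sgn v \<in> nonneg_orthant"
  by (auto simp: nonneg_orthant_def sgn_div_norm)

lemma sgn_inner_self: "sgn v \<bullet> v = norm v" for v :: "'a :: real_inner"
  by (simp add: sgn_div_norm dot_square_norm power2_eq_square divide_simps)

lemma norm_sgn_le_1: "norm (sgn v) \<le> 1" for v :: "'a :: real_normed_vector"
  by (simp add: norm_sgn)

text \<open>Weights belong to positions of a list in which answers may repeat, so the combinations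
  over positions are shown to form a convex set containing all entries. It lets a point of the hull
  compete with the optimum of the solver.\<close>

lemma convex_hull_weights:
  assumes "p \<in> convex hull (set vs)"
  shows "\<exists>a. weights (length vs) a \<and> p = (\<Sum>i<length vs. (a ! i) *\<^sub>R (vs ! i))"
proof -
  define S where "S = {(\<Sum>i<length vs. u i *\<^sub>R (vs ! i)) |u.
    (\<forall>i<length vs. 0 \<le> u i) \<and> (\<Sum>i<length vs. u i) = (1 :: real)}"
  have "convex S"
  proof (rule convexI)
    fix x y and s t :: real
    assume "x \<in> S" "y \<in> S" and st: "0 \<le> s" "0 \<le> t" "s + t = 1"
    then obtain u u' where u: "\<forall>i<length vs. 0 \<le> u i" "(\<Sum>i<length vs. u i) = 1"
        "x = (\<Sum>i<length vs. u i *\<^sub>R (vs ! i))"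
      and u': "\<forall>i<length vs. 0 \<le> u' i" "(\<Sum>i<length vs. u' i) = 1"
        "y = (\<Sum>i<length vs. u' i *\<^sub>R (vs ! i))"
      by (auto simp: S_def)
    show "s *\<^sub>R x + t *\<^sub>R y \<in> S"
      unfolding S_def
    proof (rule CollectI, rule exI[of _ "\<lambda>i. s * u i + t * u' i"], intro conjI)
      show "s *\<^sub>R x + t *\<^sub>R y = (\<Sum>i<length vs. (s * u i + t * u' i) *\<^sub>R (vs ! i))"
        by (simp add: u u' scaleR_sum_right sum.distrib scaleR_add_left)
      show "(\<Sum>i<length vs. s * u i + t * u' i) = 1"
        using u(2) u'(2) st(3) by (simp add: sum.distrib flip: sum_distrib_left)
    qed (use u u' st in simp)
  qed
  moreover have "set vs \<subseteq> S"
  proof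
    fix v
    assume "v \<in> set vs"
    then obtain k where k: "k < length vs" "v = vs ! k"
      by (auto simp: in_set_conv_nth)
    show "v \<in> S"
      unfolding S_def
    proof (rule CollectI, rule exI[of _ "\<lambda>i. if i = k then 1 else 0"], intro conjI)
      show "v = (\<Sum>i<length vs. (if i = k then 1 else 0) *\<^sub>R (vs ! i))"
        using k by (simp add: if_distrib[of "\<lambda>x. x *\<^sub>R _"] cong: if_cong)
    qed (use k in simp_all)
  qed
  ultimately have "p \<in> S"
    using assms by (metis hull_minimal subsetD)
  then obtain u where u: "\<forall>i<length vs. 0 \<le> u i" "(\<Sum>i<length vs. u i) = 1"
    "p = (\<Sum>i<length vs. u i *\<^sub>R (vs ! i))"
    by (auto simp: S_def)
  show ?thesis
    by (rule exI[of _ "map u [0..<length vs]"]) (use u in \<open>simp add: weights_def\<close>)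
qed

text \<open>Radial scaling is the nearest-point map of the ball. For \<open>y\<close> outside,
  Cauchy-Schwarz leaves \<open>(norm y - \<rho>)\<^sup>2\<close> as a lower bound for the gain in
  squared distance.\<close>

lemma norm_scale_to_ball_diff_le:
  fixes y z :: "'a :: real_inner"
  assumes "0 < \<rho>" "norm z \<le> \<rho>"
  shows "norm ((1 / max 1 (norm y / \<rho>)) *\<^sub>R y - z) \<le> norm (y - z)"
    and "norm ((1 / max 1 (norm y / \<rho>)) *\<^sub>R y) \<le> \<rho>"
proof -
  have "norm ((1 / max 1 (norm y / \<rho>)) *\<^sub>R y - z) \<le> norm (y - z) \<and>
    norm ((1 / max 1 (norm y / \<rho>)) *\<^sub>R y) \<le> \<rho>"
  proof (cases "norm y \<le> \<rho>")
    case True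
    then have "max 1 (norm y / \<rho>) = 1"
      using assms by simp
    then show ?thesis
      using True by simp
  next
    case False
    then have ny: "norm y > 0"
      using assms by linarith
    define t where "t = \<rho> / norm y"
    have m: "1 / max 1 (norm y / \<rho>) = t"
      using False assms by (simp add: t_def max_def field_simps)
    have t: "0 < t" "t < 1" "t * norm y = \<rho>"
      using False assms ny by (auto simp: t_def field_simps)
    have "y \<bullet> z \<le> norm y * norm z"
      by (rule norm_cauchy_schwarz)
    also have "\<dots> \<le> norm y * \<rho>"
      using assms by (simp add: mult_left_mono)
    finally have "(2 * (1 - t)) * (y \<bullet> z) \<le> (2 * (1 - t)) * (norm y * \<rho>)"
      using t by (intro mult_left_mono) auto
    moreover have "(norm (y - z))\<^sup>2 - (norm (t *\<^sub>R y - z))\<^sup>2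
        = (norm y)\<^sup>2 - (t * norm y)\<^sup>2 - (2 * (1 - t)) * (y \<bullet> z)"
      by (simp add: power2_norm_eq_inner inner_diff inner_commute power_mult_distrib algebra_simps)
        (simp add: power2_eq_square)
    moreover have "(norm y)\<^sup>2 - (t * norm y)\<^sup>2 - (2 * (1 - t)) * (norm y * \<rho>) = (norm y - \<rho>)\<^sup>2"
    proof -
      have "(1 - t) * norm y = norm y - \<rho>"
        using t(3) by (simp add: left_diff_distrib)
      then have eq: "(2 * (1 - t)) * (norm y * \<rho>) = 2 * ((norm y - \<rho>) * \<rho>)"
        by (metis mult.assoc)
      show ?thesis
        unfolding t(3) eq by (simp add: power2_eq_square algebra_simps)
    qed
    ultimately have "(norm (t *\<^sub>R y - z))\<^sup>2 \<le> (norm (y - z))\<^sup>2"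
      using zero_le_power2[of "norm y - \<rho>"] by linarith
    then have "norm (t *\<^sub>R y - z) \<le> norm (y - z)"
      by (rule power2_le_imp_le) simp
    then show ?thesis
      unfolding m using t by simp
  qed
  then show "norm ((1 / max 1 (norm y / \<rho>)) *\<^sub>R y - z) \<le> norm (y - z)"
    and "norm ((1 / max 1 (norm y / \<rho>)) *\<^sub>R y) \<le> \<rho>"
    by auto
qed

text \<open>The sign \<open>\<sigma>\<close> lets the cases of losses and of payoffs be treated at once.\<close>

locale approximate_projection =
  fixes K :: "(real ^ 'n) set" and \<alpha> R \<epsilon> c :: real
    and orc :: "real ^ 'n \<Rightarrow> real ^ 'n" and N :: "real ^ 'n \<Rightarrow> nat"
    and opt :: "real ^ 'n \<Rightarrow> (real ^ 'n) list \<Rightarrow> real list"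
  assumes \<alpha>_pos: "\<alpha> > 0" and R_pos: "R > 0" and \<epsilon>_pos: "\<epsilon> > 0"
    and K_nonempty: "K \<noteq> {}"
    and K_nonneg: "K \<subseteq> nonneg_orthant"
    and K_bounded: "x \<in> K \<Longrightarrow> norm x \<le> R"
    and approx: "approx_oracle \<alpha> K orc"
    and iterations: "admissible_iterations c \<alpha> R \<epsilon> N"
    and solver: "optimal_solver opt"
begin

definition \<sigma> :: real where
  "\<sigma> = (if \<alpha> \<ge> 1 then 1 else -1)"

abbreviation ext :: "real ^ 'n \<Rightarrow> (real ^ 'n) \<times> (real ^ 'n)" where
  "ext \<equiv> ext_oracle \<alpha> R orc"

lemma oracle_in_K: "u \<in> nonneg_orthant \<Longrightarrow> orc u \<in> K"
  using approx by (simp add: approx_oracle_def)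

lemma oracle_loss:
  assumes "\<alpha> \<ge> 1" "u \<in> nonneg_orthant" "x \<in> K"
  shows "orc u \<bullet> u \<le> \<alpha> * (x \<bullet> u)"
proof -
  have "orc u \<bullet> u \<le> \<alpha> * (INF x\<in>K. x \<bullet> u)"
    using approx assms by (simp add: approx_oracle_def)
  also have "(INF x\<in>K. x \<bullet> u) \<le> x \<bullet> u"
    using assms K_nonneg inner_nonneg_orthant
    by (intro cINF_lower bdd_belowI2[of _ 0]) auto
  finally show ?thesis
    using \<alpha>_pos by simp
qed

lemma oracle_payoff:
  assumes "\<alpha> < 1" "u \<in> nonneg_orthant" "x \<in> K"
  shows "\<alpha> * (x \<bullet> u) \<le> orc u \<bullet> u"
proof -
  have "x \<bullet> u \<le> R * norm u" if "x \<in> K" for x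
    using norm_cauchy_schwarz[of x u] mult_right_mono[OF K_bounded[OF that] norm_ge_zero[of u]]
    by linarith
  then have "x \<bullet> u \<le> (SUP x\<in>K. x \<bullet> u)"
    using assms by (intro cSUP_upper bdd_aboveI2[of _ _ "R * norm u"]) auto
  then have "\<alpha> * (x \<bullet> u) \<le> \<alpha> * (SUP x\<in>K. x \<bullet> u)"
    using \<alpha>_pos by simp
  also have "\<dots> \<le> orc u \<bullet> u"
    using approx assms by (simp add: approx_oracle_def)
  finally show ?thesis .
qed

lemma ext_oracle_in_K: "snd (ext u) \<in> K"
  by (simp add: ext_oracle_def Let_def oracle_in_K pos_part_nonneg neg_part_nonpos)

text \<open>Covers both cases: \<open>R + \<alpha> * R\<close> for losses and \<open>R + R\<close>
  for payoffs.\<close>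

lemma norm_ext_oracle: "norm (fst (ext u)) \<le> (\<alpha> + 2) * R"
proof -
  have "norm (s - r *\<^sub>R sgn v) \<le> R + r" if "s \<in> K" "0 \<le> r" for s v :: "real ^ 'n" and r
  proof -
    have "norm (r *\<^sub>R sgn v) \<le> r"
      using that mult_left_le[OF norm_sgn_le_1[of v]] by simp
    then show ?thesis
      using norm_triangle_ineq4[of s "r *\<^sub>R sgn v"] K_bounded[OF that(1)] by linarith
  qed
  from this[of "orc (pos_part u)" "\<alpha> * R" "neg_part u"] this[of "orc (- neg_part u)" R "pos_part u"]
  have "norm (orc (pos_part u) - (\<alpha> * R) *\<^sub>R sgn (neg_part u)) \<le> R + \<alpha> * R"
    "norm (orc (- neg_part u) - R *\<^sub>R sgn (pos_part u)) \<le> R + R"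
    using \<alpha>_pos R_pos oracle_in_K pos_part_nonneg neg_part_nonpos by auto
  moreover have "0 < \<alpha> * R"
    using \<alpha>_pos R_pos by simp
  moreover have "(\<alpha> + 2) * R = \<alpha> * R + 2 * R"
    by (rule distrib_right)
  ultimately show ?thesis
    using R_pos unfolding ext_oracle_def Let_def by (cases "\<alpha> \<ge> 1") simp_all
qed

text \<open>The oracle handles one sign of the coordinates, the correction term the other. For
  losses \<open>- R * norm (neg_part u)\<close> is below \<open>x \<bullet> neg_part u\<close> by
  Cauchy-Schwarz; for payoffs \<open>- R * norm (pos_part u)\<close> cancels whatever
  \<open>s\<close> costs on the positive coordinates. As the two parts have disjoint supports, the
  correction does not disturb the oracle's share.\<close>

lemma ext_oracle_minimizes:
  assumes "x \<in> K"
  shows "fst (ext u) \<bullet> u \<le> \<alpha> * (x \<bullet> u)"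
proof -
  have split: "v \<bullet> u = v \<bullet> pos_part u + v \<bullet> neg_part u" for v :: "real ^ 'n"
    by (metis inner_add_right pos_part_plus_neg_part)
  have x: "0 \<le> x \<bullet> pos_part u" "x \<bullet> neg_part u \<le> 0"
    using inner_nonneg_orthant[of x "pos_part u"] inner_nonneg_orthant[of x "- neg_part u"]
      assms K_nonneg pos_part_nonneg[of u] neg_part_nonpos[of u] by auto
  have orth: "sgn (neg_part u) \<bullet> pos_part u = 0" "sgn (pos_part u) \<bullet> neg_part u = 0"
    using pos_part_inner_neg_part[of u] by (auto simp: sgn_div_norm inner_commute)
  have cs: "\<bar>y \<bullet> v\<bar> \<le> R * norm v" if "y \<in> K" for y v :: "real ^ 'n"
    using Cauchy_Schwarz_ineq2[of y v] mult_right_mono[OF K_bounded[OF that] norm_ge_zero[of v]]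
    by linarith
  show ?thesis
  proof (cases "\<alpha> \<ge> 1")
    case True
    define s where "s = orc (pos_part u)"
    have s: "s \<in> K"
      by (simp add: s_def oracle_in_K pos_part_nonneg)
    have "fst (ext u) \<bullet> u = s \<bullet> pos_part u + s \<bullet> neg_part u - \<alpha> * R * norm (neg_part u)"
      using True by (simp add: ext_oracle_def Let_def s_def[symmetric] split inner_diff_left orth sgn_inner_self)
    also have "s \<bullet> pos_part u \<le> \<alpha> * (x \<bullet> pos_part u)"
      unfolding s_def using True pos_part_nonneg assms by (rule oracle_loss)
    also have "s \<bullet> neg_part u \<le> 0"
      using inner_nonneg_orthant[of s "- neg_part u"] s K_nonneg neg_part_nonpos[of u] by auto
    also have "\<alpha> * (x \<bullet> pos_part u) + 0 - \<alpha> * R * norm (neg_part u) \<le> \<alpha> * (x \<bullet> u)"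
    proof -
      have "- (R * norm (neg_part u)) \<le> x \<bullet> neg_part u"
        using cs[OF assms, of "neg_part u"] by linarith
      then have "\<alpha> * - (R * norm (neg_part u)) \<le> \<alpha> * (x \<bullet> neg_part u)"
        using \<alpha>_pos by (intro mult_left_mono) auto
      then show ?thesis
        by (simp add: split distrib_left)
    qed
    finally show ?thesis
      by simp
  next
    case False
    define s where "s = orc (- neg_part u)"
    have s: "s \<in> K"
      by (simp add: s_def oracle_in_K neg_part_nonpos)
    have "fst (ext u) \<bullet> u = s \<bullet> pos_part u + s \<bullet> neg_part u - R * norm (pos_part u)"
      using False by (simp add: ext_oracle_def Let_def s_def[symmetric] split inner_diff_left orth sgn_inner_self)
    also have "s \<bullet> pos_part u \<le> R * norm (pos_part u)"
      using cs[OF s, of "pos_part u"] by linarith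
    also have "s \<bullet> neg_part u \<le> \<alpha> * (x \<bullet> neg_part u)"
      using oracle_payoff[of "- neg_part u" x] False assms neg_part_nonpos[of u] by (simp add: s_def)
    also have "R * norm (pos_part u) + \<alpha> * (x \<bullet> neg_part u) - R * norm (pos_part u) \<le> \<alpha> * (x \<bullet> u)"
      using x \<alpha>_pos by (simp add: split distrib_left)
    finally show ?thesis
      by simp
  qed
qed

text \<open>The vector \<open>v - s\<close> lies in the orthant for losses and in its negative for
  payoffs. Playing the feasible \<open>s\<close> in place of \<open>v\<close>, which may lie outside
  \<open>K\<close>, therefore never hurts.\<close>

lemma ext_oracle_dominates:
  assumes "\<phi> \<in> nonneg_orthant"
  shows "\<sigma> * (snd (ext u) \<bullet> \<phi>) \<le> \<sigma> * (fst (ext u) \<bullet> \<phi>)"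
proof -
  have "0 \<le> sgn (- neg_part u) \<bullet> \<phi>" "0 \<le> sgn (pos_part u) \<bullet> \<phi>"
    using assms pos_part_nonneg[of u] neg_part_nonpos[of u]
    by (auto intro!: inner_nonneg_orthant sgn_nonneg_orthant simp del: sgn_minus)
  then have "(\<alpha> * R) * (sgn (neg_part u) \<bullet> \<phi>) \<le> 0" "0 \<le> R * (sgn (pos_part u) \<bullet> \<phi>)"
    using \<alpha>_pos R_pos by (auto simp: sgn_minus mult_nonneg_nonpos)
  then show ?thesis
    by (simp add: \<sigma>_def ext_oracle_def Let_def inner_diff_left)
qed

end

section \<open>Steps and cost of the projection loop\<close>

lemma norm_diff_scaleR_square:
  fixes v w :: "'a :: real_inner"
  shows "(norm (v - r *\<^sub>R w))\<^sup>2 = (norm v)\<^sup>2 - 2 * r * (v \<bullet> w) + r\<^sup>2 * (norm w)\<^sup>2"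
  unfolding power2_norm_eq_inner
  by (simp add: inner_diff inner_commute algebra_simps power2_eq_square)

context approximate_projection
begin

text \<open>The inputs that occur are within \<open>2 * \<alpha> * R\<close> of a point of norm at
  most \<open>\<alpha> * R\<close>. Hence their norm is at most \<open>3 * \<alpha> * R\<close>,
  which added to \<open>(\<alpha> + 1) * R\<close> gives the factor
  \<open>4 * \<alpha> + 1\<close>.\<close>

definition call_bound :: real where
  "call_bound = c * ((real CARD('n))\<^sup>2 * max 1 (ln ((4 * \<alpha> + 1) * R / \<epsilon>)))"

abbreviation sep_dec :: "real ^ 'n \<Rightarrow> (real ^ 'n) option \<times> ((real ^ 'n) \<times> (real ^ 'n)) list" where
  "sep_dec \<equiv> sep_or_dec ext N \<epsilon>"

lemma iterations_pos: "N y > 0"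
  and iterations_lower: "16 * (real CARD('n))\<^sup>2 * ln (((\<alpha> + 1) * R + norm y) / \<epsilon>) \<le> real (N y)"
  and iterations_upper:
    "real (N y) \<le> c * ((real CARD('n))\<^sup>2 * max 1 (ln (((\<alpha> + 1) * R + norm y) / \<epsilon>)))"
  using iterations by (auto simp: admissible_iterations_def)

text \<open>A positive iteration count below a multiple of \<open>c\<close> forces the sign.\<close>

lemma iterations_constant_pos: "c > 0"
proof -
  have "0 < c * ((real CARD('n))\<^sup>2 * max 1 (ln (((\<alpha> + 1) * R + norm (0 :: real ^ 'n)) / \<epsilon>)))"
    using iterations_pos[of 0] iterations_upper[of 0] by linarith
  moreover have "0 < (real CARD('n))\<^sup>2 * max 1 (ln (((\<alpha> + 1) * R + norm (0 :: real ^ 'n)) / \<epsilon>))"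
    by (intro mult_pos_pos) auto
  ultimately show ?thesis
    by (simp only: zero_less_mult_pos2)
qed

lemma call_bound_nonneg: "0 \<le> call_bound"
  unfolding call_bound_def using iterations_constant_pos by (intro mult_nonneg_nonneg) auto

lemma iterations_le_call_bound:
  assumes "x \<in> K" "norm (y - \<alpha> *\<^sub>R x) \<le> 2 * \<alpha> * R"
  shows "real (N y) \<le> call_bound"
proof -
  have "norm (\<alpha> *\<^sub>R x) \<le> \<alpha> * R"
    using \<alpha>_pos K_bounded[OF assms(1)] by simp
  then have "norm y \<le> 3 * \<alpha> * R"
    using norm_triangle_sub[of y "\<alpha> *\<^sub>R x"] assms(2) by linarith
  then have "(\<alpha> + 1) * R + norm y \<le> (4 * \<alpha> + 1) * R"
    by (simp add: algebra_simps)
  then have le: "((\<alpha> + 1) * R + norm y) / \<epsilon> \<le> (4 * \<alpha> + 1) * R / \<epsilon>"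
    using \<epsilon>_pos by (simp add: divide_right_mono)
  moreover have pos: "0 < ((\<alpha> + 1) * R + norm y) / \<epsilon>"
    using \<alpha>_pos R_pos \<epsilon>_pos by (intro divide_pos_pos add_pos_nonneg mult_pos_pos) auto
  ultimately have "ln (((\<alpha> + 1) * R + norm y) / \<epsilon>) \<le> ln ((4 * \<alpha> + 1) * R / \<epsilon>)"
    by (subst ln_le_cancel_iff) linarith+
  then have "c * ((real CARD('n))\<^sup>2 * max 1 (ln (((\<alpha> + 1) * R + norm y) / \<epsilon>))) \<le> call_bound"
    unfolding call_bound_def using iterations_constant_pos by (intro mult_left_mono) auto
  then show ?thesis
    using iterations_upper[of y] by linarith
qed

text \<open>The extended oracle at \<open>- w\<close> bounds all of
  \<open>\<alpha> *\<^sub>R x\<close>, so the margin \<open>\<epsilon>\<close> against the single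
  answer \<open>v\<close> is a margin against every \<open>x\<close> in \<open>K\<close>. In the
  expanded square the cross term gains \<open>2 * \<epsilon>\<^sup>2\<close> and the step of length
  at most \<open>\<epsilon>\<close> loses \<open>\<epsilon>\<^sup>2\<close>.\<close>

lemma sep_dec_Some:
  assumes "fst (sep_dec y) = Some w" "x \<in> K"
  shows "(norm (y - \<epsilon> *\<^sub>R w - \<alpha> *\<^sub>R x))\<^sup>2 + \<epsilon>\<^sup>2 \<le> (norm (y - \<alpha> *\<^sub>R x))\<^sup>2"
proof -
  have w: "norm w \<le> 1" "\<epsilon> \<le> (y - fst (ext (- w))) \<bullet> w"
    using ellipsoid_run_Some assms(1) unfolding sep_or_dec_def by blast+
  have "\<alpha> * (x \<bullet> w) \<le> fst (ext (- w)) \<bullet> w"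
    using ext_oracle_minimizes[OF assms(2), of "- w"] by simp
  then have "\<epsilon> \<le> (y - \<alpha> *\<^sub>R x) \<bullet> w"
    using w(2) by (simp add: inner_diff_left)
  then have "2 * \<epsilon> * \<epsilon> \<le> 2 * \<epsilon> * ((y - \<alpha> *\<^sub>R x) \<bullet> w)"
    using \<epsilon>_pos by (intro mult_left_mono) auto
  moreover have "\<epsilon>\<^sup>2 * (norm w)\<^sup>2 \<le> \<epsilon>\<^sup>2 * 1"
    using w(1) by (intro mult_left_mono) (auto simp: abs_square_le_1)
  moreover have "(norm ((y - \<alpha> *\<^sub>R x) - \<epsilon> *\<^sub>R w))\<^sup>2
      = (norm (y - \<alpha> *\<^sub>R x))\<^sup>2 - 2 * \<epsilon> * ((y - \<alpha> *\<^sub>R x) \<bullet> w) + \<epsilon>\<^sup>2 * (norm w)\<^sup>2"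
    by (rule norm_diff_scaleR_square)
  moreover have "2 * \<epsilon> * \<epsilon> = 2 * \<epsilon>\<^sup>2"
    by (simp add: power2_eq_square)
  ultimately have "(norm ((y - \<alpha> *\<^sub>R x) - \<epsilon> *\<^sub>R w))\<^sup>2 + \<epsilon>\<^sup>2 \<le> (norm (y - \<alpha> *\<^sub>R x))\<^sup>2"
    by linarith
  then show ?thesis
    by (simp only: diff_diff_eq add.commute[of "\<epsilon> *\<^sub>R w"])
qed

lemma sep_dec_None:
  assumes "fst (sep_dec y) = None"
  shows "snd (sep_dec y) \<noteq> []" and "set (snd (sep_dec y)) \<subseteq> range ext"
    and "\<exists>p \<in> convex hull (fst ` set (snd (sep_dec y))). norm (y - p) \<le> 3 * \<epsilon>"
proof -
  define A where "A = (\<alpha> + 1) * R + norm y"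
  have "0 < A"
    using \<alpha>_pos R_pos by (simp add: A_def add_pos_nonneg)
  moreover have "norm (y - fst (ext u)) \<le> 2 * A" for u
  proof -
    \<comment> \<open>The factor 2 lets \<open>A\<close>, built with \<open>\<alpha> + 1\<close>,
      cover the radius \<open>(\<alpha> + 2) * R\<close> of the oracle answers.\<close>
    have "2 * A = 2 * (\<alpha> * R) + 2 * R + 2 * norm y" "(\<alpha> + 2) * R = \<alpha> * R + 2 * R"
      by (simp_all add: A_def algebra_simps)
    moreover have "0 \<le> \<alpha> * R"
      using \<alpha>_pos R_pos by simp
    ultimately show ?thesis
      using norm_triangle_ineq4[of y "fst (ext u)"] norm_ext_oracle[of u] norm_ge_zero[of y] by linarith
  qed
  ultimately have *: "length (snd (sep_dec y)) = N y" "set (snd (sep_dec y)) \<subseteq> range ext"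
    "\<exists>p \<in> convex hull (fst ` set (snd (sep_dec y))). norm (y - p) \<le> 3 * \<epsilon>"
    using ellipsoid_decomposition[OF assms _ _ \<epsilon>_pos iterations_pos, of A] iterations_lower[of y]
    unfolding A_def by blast+
  then show "set (snd (sep_dec y)) \<subseteq> range ext"
    "\<exists>p \<in> convex hull (fst ` set (snd (sep_dec y))). norm (y - p) \<le> 3 * \<epsilon>"
    by auto
  show "snd (sep_dec y) \<noteq> []"
    using *(1) iterations_pos[of y] by auto
qed

lemma sep_dec_calls: "length (snd (sep_dec y)) \<le> N y"
  using ellipsoid_run_length[of ext y \<epsilon> "N y" "(0, mat 1)" "[]"] by (simp add: sep_or_dec_def)

text \<open>The witness \<open>j\<close> counts the completed steps and is the same for all
  \<open>x\<close>: a step makes at most \<open>call_bound\<close> calls and lowers every squared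
  distance by \<open>\<epsilon>\<^sup>2\<close>. As distances only decrease, the bound
  \<open>2 * \<alpha> * R\<close> persists and later steps do not become more expensive.\<close>

lemma projection_loop:
  assumes near: "\<And>x. x \<in> K \<Longrightarrow> norm (y0 - \<alpha> *\<^sub>R x) \<le> 2 * \<alpha> * R"
  defines "st \<equiv> while (\<lambda>(y', k). fst (sep_dec y') \<noteq> None)
    (\<lambda>(y', k). (y' - \<epsilon> *\<^sub>R the (fst (sep_dec y')), k + length (snd (sep_dec y')))) (y0, 0)"
  shows "fst (sep_dec (fst st)) = None"
    and "\<exists>j. real (snd st) \<le> call_bound * real j \<and>
      (\<forall>x\<in>K. (norm (fst st - \<alpha> *\<^sub>R x))\<^sup>2 + \<epsilon>\<^sup>2 * real j \<le> (norm (y0 - \<alpha> *\<^sub>R x))\<^sup>2)"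
proof -
  obtain x0 where x0: "x0 \<in> K"
    using K_nonempty by blast
  define P where "P s \<longleftrightarrow> (\<exists>j. real (snd s) \<le> call_bound * real j \<and>
    (\<forall>x\<in>K. (norm (fst s - \<alpha> *\<^sub>R x))\<^sup>2 + \<epsilon>\<^sup>2 * real j \<le> (norm (y0 - \<alpha> *\<^sub>R x))\<^sup>2))"
    for s :: "(real ^ 'n) \<times> nat"
  have "P st \<and> fst (sep_dec (fst st)) = None"
    unfolding st_def
  \<comment> \<open>Termination: in units of \<open>\<epsilon>\<^sup>2\<close>, the squared distance
    to one fixed point drops by at least 1 per step, so its integer part drops strictly.\<close>
  proof (rule while_rule[where P = P and
      r = "Wellfounded.measure (\<lambda>s. nat \<lfloor>(norm (fst s - \<alpha> *\<^sub>R x0))\<^sup>2 / \<epsilon>\<^sup>2\<rfloor>)"])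
    show "P (y0, 0)"
      unfolding P_def by (rule exI[of _ 0]) simp
    show "P s \<and> fst (sep_dec (fst s)) = None"
      if "P s" "\<not> (case s of (y', k) \<Rightarrow> fst (sep_dec y') \<noteq> None)" for s
      using that by (simp add: case_prod_beta)
    fix s
    assume Ps: "P s" and bs: "case s of (y', k) \<Rightarrow> fst (sep_dec y') \<noteq> None"
    obtain y k where s: "s = (y, k)"
      by fastforce
    obtain w where w: "fst (sep_dec y) = Some w"
      using bs by (auto simp: s)
    obtain j where j: "real k \<le> call_bound * real j"
      "\<And>x. x \<in> K \<Longrightarrow> (norm (y - \<alpha> *\<^sub>R x))\<^sup>2 + \<epsilon>\<^sup>2 * real j \<le> (norm (y0 - \<alpha> *\<^sub>R x))\<^sup>2"
      using Ps by (auto simp: P_def s)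
    have step: "(case s of (y', k) \<Rightarrow> (y' - \<epsilon> *\<^sub>R the (fst (sep_dec y')), k + length (snd (sep_dec y'))))
        = (y - \<epsilon> *\<^sub>R w, k + length (snd (sep_dec y)))"
      by (simp add: s w)
    have "(norm (y - \<alpha> *\<^sub>R x0))\<^sup>2 \<le> (norm (y0 - \<alpha> *\<^sub>R x0))\<^sup>2"
      using j(2)[OF x0] mult_nonneg_nonneg[OF zero_le_power2[of \<epsilon>] of_nat_0_le_iff[of j]] by linarith
    then have "norm (y - \<alpha> *\<^sub>R x0) \<le> norm (y0 - \<alpha> *\<^sub>R x0)"
      by (rule power2_le_imp_le) simp
    then have "norm (y - \<alpha> *\<^sub>R x0) \<le> 2 * \<alpha> * R"
      using near[OF x0] by linarith
    then have "real (N y) \<le> call_bound"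
      by (rule iterations_le_call_bound[OF x0])
    then have "real (length (snd (sep_dec y))) \<le> call_bound"
      using sep_dec_calls[of y] by linarith
    then have "real (k + length (snd (sep_dec y))) \<le> call_bound * real (Suc j)"
      using j(1) by (simp add: algebra_simps)
    moreover have "(norm (y - \<epsilon> *\<^sub>R w - \<alpha> *\<^sub>R x))\<^sup>2 + \<epsilon>\<^sup>2 * real (Suc j) \<le> (norm (y0 - \<alpha> *\<^sub>R x))\<^sup>2"
      if "x \<in> K" for x
      using sep_dec_Some[OF w that] j(2)[OF that] by (simp add: algebra_simps)
    ultimately show "P (case s of (y', k) \<Rightarrow> (y' - \<epsilon> *\<^sub>R the (fst (sep_dec y')), k + length (snd (sep_dec y'))))"
      unfolding step P_def by (intro exI[of _ "Suc j"]) simp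
    have "(norm (y - \<epsilon> *\<^sub>R w - \<alpha> *\<^sub>R x0))\<^sup>2 / \<epsilon>\<^sup>2 + 1 \<le> (norm (y - \<alpha> *\<^sub>R x0))\<^sup>2 / \<epsilon>\<^sup>2"
      using divide_right_mono[OF sep_dec_Some[OF w x0], of "\<epsilon>\<^sup>2"] \<epsilon>_pos by (simp add: add_divide_distrib)
    then have "\<lfloor>(norm (y - \<epsilon> *\<^sub>R w - \<alpha> *\<^sub>R x0))\<^sup>2 / \<epsilon>\<^sup>2\<rfloor> + 1 \<le> \<lfloor>(norm (y - \<alpha> *\<^sub>R x0))\<^sup>2 / \<epsilon>\<^sup>2\<rfloor>"
      by linarith
    moreover have "0 \<le> \<lfloor>(norm (y - \<epsilon> *\<^sub>R w - \<alpha> *\<^sub>R x0))\<^sup>2 / \<epsilon>\<^sup>2\<rfloor>"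
      by simp
    ultimately have "nat \<lfloor>(norm (y - \<epsilon> *\<^sub>R w - \<alpha> *\<^sub>R x0))\<^sup>2 / \<epsilon>\<^sup>2\<rfloor> < nat \<lfloor>(norm (y - \<alpha> *\<^sub>R x0))\<^sup>2 / \<epsilon>\<^sup>2\<rfloor>"
      by (subst nat_mono_iff) linarith+
    then show "((case s of (y', k) \<Rightarrow> (y' - \<epsilon> *\<^sub>R the (fst (sep_dec y')), k + length (snd (sep_dec y')))), s)
        \<in> Wellfounded.measure (\<lambda>s. nat \<lfloor>(norm (fst s - \<alpha> *\<^sub>R x0))\<^sup>2 / \<epsilon>\<^sup>2\<rfloor>)"
      unfolding step by (simp only: s in_measure fst_conv)
  qed simp
  then show "fst (sep_dec (fst st)) = None"
    and "\<exists>j. real (snd st) \<le> call_bound * real j \<and>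
      (\<forall>x\<in>K. (norm (fst st - \<alpha> *\<^sub>R x))\<^sup>2 + \<epsilon>\<^sup>2 * real j \<le> (norm (y0 - \<alpha> *\<^sub>R x))\<^sup>2)"
    by (auto simp: P_def)
qed

text \<open>The optimal weights do at least as well as those of the nearby point of the hull, whence
  \<open>3 * \<epsilon>\<close>. The initial scaling only brings the point nearer to each
  \<open>\<alpha> *\<^sub>R x\<close>, so the cost can be charged to the distance from the unscaled
  input \<open>y\<close>.\<close>

lemma projection:
  assumes "projection \<alpha> R orc N opt \<epsilon> y = (y', a, ps, k)"
  shows "weights (length ps) a" and "set ps \<subseteq> range ext"
    and "norm ((\<Sum>i<length ps. (a ! i) *\<^sub>R fst (ps ! i)) - y') \<le> 3 * \<epsilon>"
    and "x \<in> K \<Longrightarrow> norm (y' - \<alpha> *\<^sub>R x) \<le> 2 * \<alpha> * R"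
    and "x \<in> K \<Longrightarrow> \<epsilon>\<^sup>2 * real k \<le> call_bound *
      (\<epsilon>\<^sup>2 + (norm (y - \<alpha> *\<^sub>R x))\<^sup>2 - (norm (y' - \<alpha> *\<^sub>R x))\<^sup>2)"
    and "x \<in> K \<Longrightarrow> norm (y' - \<alpha> *\<^sub>R x) \<le> norm (y - \<alpha> *\<^sub>R x)"
proof -
  define y0 where "y0 = (1 / max 1 (norm y / (\<alpha> * R))) *\<^sub>R y"
  define st where "st = while (\<lambda>(y', k). fst (sep_dec y') \<noteq> None)
    (\<lambda>(y', k). (y' - \<epsilon> *\<^sub>R the (fst (sep_dec y')), k + length (snd (sep_dec y')))) (y0, 0)"
  have res: "y' = fst st" "a = opt y' (map fst ps)" "ps = snd (sep_dec y')" "k = snd st + length ps"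
    using assms by (auto simp: projection_def Let_def st_def y0_def split: prod.splits)
  have \<rho>: "0 < \<alpha> * R"
    using \<alpha>_pos R_pos by simp
  have \<alpha>x: "norm (\<alpha> *\<^sub>R x) \<le> \<alpha> * R" if "x \<in> K" for x
    using \<alpha>_pos K_bounded[OF that] by simp
  have y0: "norm (y0 - \<alpha> *\<^sub>R x) \<le> norm (y - \<alpha> *\<^sub>R x)" "norm (y0 - \<alpha> *\<^sub>R x) \<le> 2 * \<alpha> * R" if "x \<in> K" for x
    using norm_scale_to_ball_diff_le[OF \<rho> \<alpha>x[OF that], of y] \<alpha>x[OF that]
      norm_triangle_ineq4[of y0 "\<alpha> *\<^sub>R x"] unfolding y0_def by linarith+
  have None: "fst (sep_dec y') = None"
    using projection_loop(1)[OF y0(2)] by (simp add: res(1) st_def)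
  obtain j where j: "real (snd st) \<le> call_bound * real j"
    "\<And>x. x \<in> K \<Longrightarrow> (norm (y' - \<alpha> *\<^sub>R x))\<^sup>2 + \<epsilon>\<^sup>2 * real j \<le> (norm (y0 - \<alpha> *\<^sub>R x))\<^sup>2"
    using projection_loop(2)[OF y0(2)] unfolding res(1) st_def by blast
  note sd = sep_dec_None[OF None, folded res(3)]
  show "set ps \<subseteq> range ext"
    by (rule sd(2))
  have opt: "weights (length (map fst ps)) a"
    "\<And>b. weights (length (map fst ps)) b \<Longrightarrow>
      decomposition_error y' (map fst ps) a \<le> decomposition_error y' (map fst ps) b"
    using solver[unfolded optimal_solver_def, rule_format, of "map fst ps" y'] sd(1)
    unfolding res(2) by blast+
  then show "weights (length ps) a"
    by simp
  obtain p where p: "p \<in> convex hull (fst ` set ps)" "norm (y' - p) \<le> 3 * \<epsilon>"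
    using sd(3) by blast
  obtain b where b: "weights (length (map fst ps)) b"
    "p = (\<Sum>i<length (map fst ps). (b ! i) *\<^sub>R (map fst ps ! i))"
    using convex_hull_weights[of p "map fst ps"] p(1) by auto
  have err: "decomposition_error y' (map fst ps) u
      = 1 / 2 * (norm ((\<Sum>i<length (map fst ps). (u ! i) *\<^sub>R (map fst ps ! i)) - y'))\<^sup>2" for u
    by (simp add: decomposition_error_def)
  have "(norm ((\<Sum>i<length (map fst ps). (a ! i) *\<^sub>R (map fst ps ! i)) - y'))\<^sup>2 \<le> (norm (p - y'))\<^sup>2"
    using opt(2)[OF b(1)] unfolding err b(2)[symmetric] by simp
  then have "norm ((\<Sum>i<length (map fst ps). (a ! i) *\<^sub>R (map fst ps ! i)) - y') \<le> norm (p - y')"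
    by (rule power2_le_imp_le) simp
  moreover have "(\<Sum>i<length (map fst ps). (a ! i) *\<^sub>R (map fst ps ! i))
      = (\<Sum>i<length ps. (a ! i) *\<^sub>R fst (ps ! i))"
    by simp
  ultimately show "norm ((\<Sum>i<length ps. (a ! i) *\<^sub>R fst (ps ! i)) - y') \<le> 3 * \<epsilon>"
    using p(2) by (simp add: norm_minus_commute)
  assume x: "x \<in> K"
  have "(norm (y' - \<alpha> *\<^sub>R x))\<^sup>2 \<le> (norm (y0 - \<alpha> *\<^sub>R x))\<^sup>2"
    using j(2)[OF x] mult_nonneg_nonneg[OF zero_le_power2[of \<epsilon>] of_nat_0_le_iff[of j]] by linarith
  then have y'0: "norm (y' - \<alpha> *\<^sub>R x) \<le> norm (y0 - \<alpha> *\<^sub>R x)"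
    by (rule power2_le_imp_le) simp
  then show near: "norm (y' - \<alpha> *\<^sub>R x) \<le> 2 * \<alpha> * R" and "norm (y' - \<alpha> *\<^sub>R x) \<le> norm (y - \<alpha> *\<^sub>R x)"
    using y0[OF x] by linarith+
  \<comment> \<open>The last call of the procedure, which returns the decomposition, follows the
    \<open>j\<close> steps; it is the 1 in \<open>1 + real j\<close> and the extra
    \<open>\<epsilon>\<^sup>2\<close> of the bound.\<close>
  have "real (length ps) \<le> call_bound"
    using sep_dec_calls[of y'] iterations_le_call_bound[OF x near] unfolding res(3) by linarith
  then have k: "real k \<le> call_bound * (1 + real j)"
    using j(1) by (simp add: res(4) algebra_simps)
  have "\<epsilon>\<^sup>2 * real k \<le> \<epsilon>\<^sup>2 * (call_bound * (1 + real j))"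
    using k by (intro mult_left_mono) auto
  also have "\<dots> = call_bound * (\<epsilon>\<^sup>2 + \<epsilon>\<^sup>2 * real j)"
    by (simp add: algebra_simps)
  also have "\<dots> \<le> call_bound * (\<epsilon>\<^sup>2 + (norm (y - \<alpha> *\<^sub>R x))\<^sup>2 - (norm (y' - \<alpha> *\<^sub>R x))\<^sup>2)"
  proof (rule mult_left_mono[OF _ call_bound_nonneg])
    have "(norm (y0 - \<alpha> *\<^sub>R x))\<^sup>2 \<le> (norm (y - \<alpha> *\<^sub>R x))\<^sup>2"
      using y0(1)[OF x] by (simp add: power_mono)
    then show "\<epsilon>\<^sup>2 + \<epsilon>\<^sup>2 * real j \<le> \<epsilon>\<^sup>2 + (norm (y - \<alpha> *\<^sub>R x))\<^sup>2 - (norm (y' - \<alpha> *\<^sub>R x))\<^sup>2"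
      using j(2)[OF x] by linarith
  qed
  finally show "\<epsilon>\<^sup>2 * real k \<le> call_bound *
      (\<epsilon>\<^sup>2 + (norm (y - \<alpha> *\<^sub>R x))\<^sup>2 - (norm (y' - \<alpha> *\<^sub>R x))\<^sup>2)" .
qed

end

section \<open>Rounds of the bandit algorithm\<close>

lemma expectation_bind_finite:
  fixes h :: "'b \<Rightarrow> real"
  assumes "finite (set_pmf p)" "\<And>x. x \<in> set_pmf p \<Longrightarrow> finite (set_pmf (f x))"
  shows "measure_pmf.expectation (p \<bind> f) h = measure_pmf.expectation p (\<lambda>x. measure_pmf.expectation (f x) h)"
  using assms by (subst pmf_expectation_bind[of "set_pmf p"]) (auto simp: integral_measure_pmf[of "set_pmf p"])

lemma expectation_mono_finite:
  fixes h h' :: "'a \<Rightarrow> real"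
  assumes "finite (set_pmf p)" "\<And>x. x \<in> set_pmf p \<Longrightarrow> h x \<le> h' x"
  shows "measure_pmf.expectation p h \<le> measure_pmf.expectation p h'"
  using assms by (intro integral_mono_AE) (auto simp: integrable_measure_pmf_finite AE_measure_pmf_iff)

lemma expectation_le_finite:
  fixes h :: "'a \<Rightarrow> real"
  assumes "finite (set_pmf p)" "\<And>x. x \<in> set_pmf p \<Longrightarrow> h x \<le> b"
  shows "measure_pmf.expectation p h \<le> b"
  using expectation_mono_finite[of p h "\<lambda>_. b"] assms by simp

lemma expectation_pmf_of_list:
  fixes h :: "'a \<Rightarrow> real"
  assumes "pmf_of_list_wf xs"
  shows "measure_pmf.expectation (pmf_of_list xs) h = (\<Sum>z\<leftarrow>xs. snd z * h (fst z))"
proof -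
  \<comment> \<open>The set \<open>A\<close> stays fixed during the induction because the set of
    values shrinks with the list. A value may occur at several positions, and its masses are
    added.\<close>
  have "(\<Sum>x\<in>A. sum_list (map snd (filter (\<lambda>z. fst z = x) ys)) * h x) = (\<Sum>z\<leftarrow>ys. snd z * h (fst z))"
    if "finite A" "fst ` set ys \<subseteq> A" for A and ys :: "('a \<times> real) list"
    using that(2)
  proof (induction ys)
    case (Cons z ys)
    have "(\<Sum>x\<in>A. sum_list (map snd (filter (\<lambda>z. fst z = x) (z # ys))) * h x)
        = (\<Sum>x\<in>A. (if fst z = x then snd z * h x else 0)
            + sum_list (map snd (filter (\<lambda>z. fst z = x) ys)) * h x)"
      by (intro sum.cong refl) (simp add: distrib_right)
    also have "\<dots> = snd z * h (fst z) + (\<Sum>z\<leftarrow>ys. snd z * h (fst z))"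
      using Cons that(1) by (simp add: sum.distrib)
    finally show ?case
      by simp
  qed simp
  from this[of "fst ` set xs" xs] show ?thesis
    using set_pmf_of_list[OF assms]
    by (subst integral_measure_pmf[of "fst ` set xs"]) (auto simp: pmf_pmf_of_list[OF assms])
qed

lemma weights_pmf_of_list:
  assumes "weights (length xs) a"
  shows "pmf_of_list_wf (zip xs a)"
    and "measure_pmf.expectation (pmf_of_list (zip xs a)) h = (\<Sum>i<length xs. (a ! i) * h (xs ! i))"
proof -
  have len: "length a = length xs"
    using assms by (simp add: weights_def)
  have "sum_list a = 1" "\<And>x. x \<in> set a \<Longrightarrow> 0 \<le> x"
    using assms by (auto simp: weights_def sum_list_sum_nth in_set_conv_nth atLeast0LessThan)
  then show wf: "pmf_of_list_wf (zip xs a)"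
    using len by (intro pmf_of_list_wfI) simp_all
  show "measure_pmf.expectation (pmf_of_list (zip xs a)) h = (\<Sum>i<length xs. (a ! i) * h (xs ! i))"
    unfolding expectation_pmf_of_list[OF wf]
    using len by (simp add: sum_list_sum_nth atLeast0LessThan)
qed

lemma finite_bandit_play: "finite (set_pmf (bandit_play \<gamma> q f s))"
  unfolding bandit_play_def Let_def by auto

lemma expectation_bandit_play:
  fixes h :: "_ \<Rightarrow> real" and q :: "'n \<Rightarrow> real ^ 'n"
  assumes "0 < \<gamma>" "\<gamma> < 1"
  shows "measure_pmf.expectation (bandit_play \<gamma> q f s) h =
    \<gamma> * (\<Sum>i\<in>UNIV. h (q i, (real CARD('n) * (q i \<bullet> f) / \<gamma>) *\<^sub>R (matrix_inv (spanner_matrix q) *v q i)))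
      / real CARD('n) + (1 - \<gamma>) * h (s, 0)"
  unfolding bandit_play_def Let_def using assms
  by (simp add: expectation_bind_finite integral_pmf_of_set)

lemma spanner_matrix_vector: "spanner_matrix q *v v = (\<Sum>i\<in>UNIV. (q i \<bullet> v) *\<^sub>R q i)"
proof -
  have "(spanner_matrix q *v v) $ j = (\<Sum>i\<in>UNIV. (q i \<bullet> v) *\<^sub>R q i) $ j" for j
    unfolding spanner_matrix_def outer_def matrix_vector_mult_def inner_vec_def
    by (simp add: sum_distrib_left sum_distrib_right mult_ac) (rule sum.swap)
  then show ?thesis
    by (simp add: vec_eq_iff)
qed

lemma matrix_inv_spanner:
  assumes "invertible (spanner_matrix q)"
  shows "(\<Sum>i\<in>UNIV. (q i \<bullet> v) *\<^sub>R (matrix_inv (spanner_matrix q) *v q i)) = v"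
proof -
  have "(\<Sum>i\<in>UNIV. (q i \<bullet> v) *\<^sub>R (matrix_inv (spanner_matrix q) *v q i))
      = matrix_inv (spanner_matrix q) *v (spanner_matrix q *v v)"
    by (simp add: spanner_matrix_vector linear_sum[OF matrix_vector_mul_linear] matrix_vector_mult_scaleR)
  also have "\<dots> = v"
    using someI_ex[OF assms[unfolded invertible_def]]
    by (simp add: matrix_vector_mul_assoc matrix_inv_def)
  finally show ?thesis .
qed

text \<open>The estimate is unbiased because the exploration points reproduce every vector through \<open>Q\<close>.\<close>

lemma bandit_play_estimate:
  fixes q :: "'n \<Rightarrow> real ^ 'n"
  assumes \<gamma>: "0 < \<gamma>" "\<gamma> < 1" and inv: "invertible (spanner_matrix q)"
  shows "measure_pmf.expectation (bandit_play \<gamma> q f s) (\<lambda>(p, g). g \<bullet> v) = f \<bullet> v"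
proof -
  have "measure_pmf.expectation (bandit_play \<gamma> q f s) (\<lambda>(p, g). g \<bullet> v)
      = (\<Sum>i\<in>UNIV. (q i \<bullet> f) *\<^sub>R (matrix_inv (spanner_matrix q) *v q i)) \<bullet> v"
    using \<gamma> by (simp add: expectation_bandit_play inner_sum_left sum_distrib_left sum_divide_distrib)
  then show ?thesis
    by (simp add: matrix_inv_spanner[OF inv])
qed

text \<open>The estimate vanishes except with probability \<open>\<gamma>\<close>, and then its norm
  is at most \<open>G / \<gamma>\<close>. The first moment is thus free of \<open>\<gamma>\<close>,
  while the second keeps one factor \<open>1 / \<gamma>\<close>.\<close>

lemma bandit_play_estimate_norm:
  fixes q :: "'n \<Rightarrow> real ^ 'n"
  assumes \<gamma>: "0 < \<gamma>" "\<gamma> < 1"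
    and \<beta>: "\<And>i. norm (matrix_inv (spanner_matrix q) *v q i) \<le> \<beta>"
    and C: "\<And>i. \<bar>q i \<bullet> f\<bar> \<le> C"
  shows "measure_pmf.expectation (bandit_play \<gamma> q f s) (\<lambda>(p, g). norm g) \<le> real CARD('n) * C * \<beta>"
    and "measure_pmf.expectation (bandit_play \<gamma> q f s) (\<lambda>(p, g). (norm g)\<^sup>2)
      \<le> (real CARD('n) * C * \<beta>)\<^sup>2 / \<gamma>"
proof -
  define g where "g i = (real CARD('n) * (q i \<bullet> f) / \<gamma>) *\<^sub>R (matrix_inv (spanner_matrix q) *v q i)" for i
  define G where "G = real CARD('n) * C * \<beta>"
  have g: "norm (g i) \<le> G / \<gamma>" for i
  proof -
    have "\<bar>q i \<bullet> f\<bar> * norm (matrix_inv (spanner_matrix q) *v q i) \<le> C * \<beta>"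
      using C[of i] by (intro mult_mono \<beta> C) auto
    then have "real CARD('n) / \<gamma> * (\<bar>q i \<bullet> f\<bar> * norm (matrix_inv (spanner_matrix q) *v q i))
        \<le> real CARD('n) / \<gamma> * (C * \<beta>)"
      using \<gamma> by (intro mult_left_mono) auto
    then show ?thesis
      using \<gamma> by (simp add: g_def G_def abs_mult mult_ac)
  qed
  have "(\<Sum>i\<in>(UNIV :: 'n set). norm (g i)) \<le> (\<Sum>i\<in>(UNIV :: 'n set). G / \<gamma>)"
    by (intro sum_mono g)
  then have "\<gamma> * (\<Sum>i\<in>UNIV. norm (g i)) / real CARD('n) \<le> \<gamma> * (real CARD('n) * (G / \<gamma>)) / real CARD('n)"
    using \<gamma> by (intro divide_right_mono mult_left_mono) auto
  then show "measure_pmf.expectation (bandit_play \<gamma> q f s) (\<lambda>(p, g). norm g) \<le> real CARD('n) * C * \<beta>"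
    using \<gamma> by (simp add: expectation_bandit_play g_def[symmetric] G_def)
  have "(\<Sum>i\<in>(UNIV :: 'n set). (norm (g i))\<^sup>2) \<le> (\<Sum>i\<in>(UNIV :: 'n set). (G / \<gamma>)\<^sup>2)"
    by (intro sum_mono power_mono g) simp
  then have "\<gamma> * (\<Sum>i\<in>UNIV. (norm (g i))\<^sup>2) / real CARD('n)
      \<le> \<gamma> * (real CARD('n) * (G / \<gamma>)\<^sup>2) / real CARD('n)"
    using \<gamma> by (intro divide_right_mono mult_left_mono) auto
  also have "\<dots> = G\<^sup>2 / \<gamma>"
    using \<gamma> by (simp add: power2_eq_square)
  finally show "measure_pmf.expectation (bandit_play \<gamma> q f s) (\<lambda>(p, g). (norm g)\<^sup>2)
      \<le> (real CARD('n) * C * \<beta>)\<^sup>2 / \<gamma>"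
    using \<gamma> by (simp add: expectation_bandit_play g_def[symmetric] G_def)
qed

text \<open>All values lie in an interval of length \<open>C\<close>, so replacing \<open>s\<close>
  by an exploration point costs at most \<open>C\<close>, and this happens with probability
  \<open>\<gamma>\<close>.\<close>

lemma bandit_play_loss:
  fixes q :: "'n \<Rightarrow> real ^ 'n" and \<tau> :: real
  assumes \<gamma>: "0 < \<gamma>" "\<gamma> < 1" and \<tau>: "\<tau> = 1 \<or> \<tau> = -1"
    and q: "\<And>i. 0 \<le> q i \<bullet> f \<and> q i \<bullet> f \<le> C" and s: "0 \<le> s \<bullet> f \<and> s \<bullet> f \<le> C"
  shows "measure_pmf.expectation (bandit_play \<gamma> q f s) (\<lambda>(p, g). \<tau> * (p \<bullet> f)) \<le> \<tau> * (s \<bullet> f) + \<gamma> * C"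
proof -
  have le: "\<tau> * (q i \<bullet> f) \<le> \<tau> * (s \<bullet> f) + C" for i
    using \<tau> q[of i] s by (cases "\<tau> = 1") auto
  have "(\<Sum>i\<in>(UNIV :: 'n set). \<tau> * (q i \<bullet> f)) \<le> (\<Sum>i\<in>(UNIV :: 'n set). \<tau> * (s \<bullet> f) + C)"
    by (intro sum_mono le)
  then have "\<gamma> * (\<Sum>i\<in>UNIV. \<tau> * (q i \<bullet> f)) / real CARD('n)
      \<le> \<gamma> * (real CARD('n) * (\<tau> * (s \<bullet> f) + C)) / real CARD('n)"
    using \<gamma> by (intro divide_right_mono mult_left_mono) auto
  also have "\<dots> = \<gamma> * (\<tau> * (s \<bullet> f) + C)"
    by simp
  finally show ?thesis
    using \<gamma> by (simp add: expectation_bandit_play algebra_simps)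
qed

context approximate_projection
begin

text \<open>For given \<open>y\<close> and \<open>g\<close> the outputs \<open>y'\<close> and
  \<open>k'\<close> are deterministic; only \<open>s'\<close> is random. For the last claim its mean
  is compared with the mean of the infeasible answers under the same weights: the latter is no
  better in the direction of \<open>\<phi>\<close>, and it is \<open>3 * \<epsilon>\<close> close to
  \<open>y'\<close>.\<close>

lemma full_info_update:
  fixes \<eta> :: real and y g :: "real ^ 'n"
  defines "U \<equiv> full_info_update \<alpha> R orc N opt \<eta> \<epsilon> y g"
  defines "y1 \<equiv> y - (\<sigma> * \<eta>) *\<^sub>R g"
  shows "finite (set_pmf U)"
    and "\<lbrakk>(s', y', k') \<in> set_pmf U\<rbrakk> \<Longrightarrow> s' \<in> K"
    and "\<lbrakk>(s', y', k') \<in> set_pmf U; x \<in> K\<rbrakk> \<Longrightarrow> norm (y' - \<alpha> *\<^sub>R x) \<le> 2 * \<alpha> * R"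
    and "\<lbrakk>(s', y', k') \<in> set_pmf U; x \<in> K\<rbrakk> \<Longrightarrow> norm (y' - \<alpha> *\<^sub>R x) \<le> norm (y1 - \<alpha> *\<^sub>R x)"
    and "\<lbrakk>(s', y', k') \<in> set_pmf U; x \<in> K\<rbrakk> \<Longrightarrow> \<epsilon>\<^sup>2 * real k' \<le> call_bound *
      (\<epsilon>\<^sup>2 + (norm (y1 - \<alpha> *\<^sub>R x))\<^sup>2 - (norm (y' - \<alpha> *\<^sub>R x))\<^sup>2)"
    and "\<lbrakk>\<phi> \<in> nonneg_orthant; norm \<phi> \<le> B\<rbrakk> \<Longrightarrow>
      measure_pmf.expectation U (\<lambda>(s', y', k'). \<sigma> * ((s' - y') \<bullet> \<phi>)) \<le> 3 * \<epsilon> * B"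
proof -
  obtain y2 a ps k2 where pr: "projection \<alpha> R orc N opt \<epsilon> y1 = (y2, a, ps, k2)"
    by (metis prod_cases4)
  have "(if \<alpha> \<ge> 1 then y - \<eta> *\<^sub>R g else y + \<eta> *\<^sub>R g) = y1"
    by (simp add: y1_def \<sigma>_def)
  then have U: "U = map_pmf (\<lambda>s. (s, y2, k2)) (pmf_of_list (zip (map snd ps) a))"
    unfolding U_def full_info_update_def by (simp only: Let_def pr prod.case)
  note pp = projection[OF pr]
  have w: "weights (length (map snd ps)) a"
    using pp(1) by simp
  note wf = weights_pmf_of_list[OF w]
  show "finite (set_pmf U)"
    by (simp add: U finite_set_pmf_of_list[OF wf(1)])
  have supp: "y' = y2 \<and> k' = k2 \<and> s' \<in> snd ` set ps" if "(s', y', k') \<in> set_pmf U" for s' y' k'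
    using that set_pmf_of_list[OF wf(1)] by (auto simp: U dest!: subsetD set_zip_leftD)
  show "s' \<in> K" if "(s', y', k') \<in> set_pmf U"
    using supp[OF that] pp(2) ext_oracle_in_K by auto
  show "norm (y' - \<alpha> *\<^sub>R x) \<le> 2 * \<alpha> * R" if "(s', y', k') \<in> set_pmf U" "x \<in> K"
    using supp[OF that(1)] pp(4)[OF that(2)] by simp
  show "norm (y' - \<alpha> *\<^sub>R x) \<le> norm (y1 - \<alpha> *\<^sub>R x)" if "(s', y', k') \<in> set_pmf U" "x \<in> K"
    using supp[OF that(1)] pp(6)[OF that(2)] by simp
  show "\<epsilon>\<^sup>2 * real k' \<le> call_bound * (\<epsilon>\<^sup>2 + (norm (y1 - \<alpha> *\<^sub>R x))\<^sup>2 - (norm (y' - \<alpha> *\<^sub>R x))\<^sup>2)"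
    if "(s', y', k') \<in> set_pmf U" "x \<in> K"
    using supp[OF that(1)] pp(5)[OF that(2)] by simp
  assume \<phi>: "\<phi> \<in> nonneg_orthant" "norm \<phi> \<le> B"
  have a: "\<And>i. i < length ps \<Longrightarrow> 0 \<le> a ! i" "(\<Sum>i<length ps. a ! i) = 1"
    using pp(1) by (auto simp: weights_def)
  define v where "v = (\<Sum>i<length ps. (a ! i) *\<^sub>R fst (ps ! i))"
  have "measure_pmf.expectation U (\<lambda>(s', y', k'). \<sigma> * ((s' - y2) \<bullet> \<phi>))
      = (\<Sum>i<length ps. (a ! i) * (\<sigma> * ((snd (ps ! i) - y2) \<bullet> \<phi>)))"
    unfolding U by (simp add: wf(2) sum_distrib_left mult.left_commute)
  moreover have "measure_pmf.expectation U (\<lambda>(s', y', k'). \<sigma> * ((s' - y') \<bullet> \<phi>))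
      = measure_pmf.expectation U (\<lambda>(s', y', k'). \<sigma> * ((s' - y2) \<bullet> \<phi>))"
    unfolding U by simp
  moreover have "(\<Sum>i<length ps. (a ! i) * (\<sigma> * ((snd (ps ! i) - y2) \<bullet> \<phi>)))
      \<le> (\<Sum>i<length ps. (a ! i) * (\<sigma> * ((fst (ps ! i) - y2) \<bullet> \<phi>)))"
  proof (rule sum_mono)
    fix i
    assume "i \<in> {..<length ps}"
    then have i: "i < length ps"
      by simp
    then obtain u where "ps ! i = ext u"
      using pp(2) nth_mem by blast
    then have "\<sigma> * ((snd (ps ! i) - y2) \<bullet> \<phi>) \<le> \<sigma> * ((fst (ps ! i) - y2) \<bullet> \<phi>)"
      using ext_oracle_dominates[OF \<phi>(1), of u] by (simp add: inner_diff_left right_diff_distrib)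
    then show "(a ! i) * (\<sigma> * ((snd (ps ! i) - y2) \<bullet> \<phi>)) \<le> (a ! i) * (\<sigma> * ((fst (ps ! i) - y2) \<bullet> \<phi>))"
      by (rule mult_left_mono) (rule a(1)[OF i])
  qed
  moreover have "(\<Sum>i<length ps. (a ! i) * (\<sigma> * ((fst (ps ! i) - y2) \<bullet> \<phi>))) = \<sigma> * ((v - y2) \<bullet> \<phi>)"
  proof -
    have "(\<Sum>i<length ps. (a ! i) * (\<sigma> * ((fst (ps ! i) - y2) \<bullet> \<phi>)))
        = \<sigma> * ((\<Sum>i<length ps. (a ! i) * (fst (ps ! i) \<bullet> \<phi>)) - (\<Sum>i<length ps. a ! i) * (y2 \<bullet> \<phi>))"
      by (simp add: sum_distrib_left sum_distrib_right sum_subtractf[symmetric] inner_diff_left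
          right_diff_distrib mult_ac)
    also have "\<dots> = \<sigma> * ((v - y2) \<bullet> \<phi>)"
      by (simp add: a(2) v_def inner_diff_left inner_sum_left)
    finally show ?thesis .
  qed
  moreover have "\<sigma> * ((v - y2) \<bullet> \<phi>) \<le> 3 * \<epsilon> * B"
  proof -
    have "\<sigma> * ((v - y2) \<bullet> \<phi>) \<le> \<bar>(v - y2) \<bullet> \<phi>\<bar>"
      by (simp add: \<sigma>_def abs_ge_self abs_ge_minus_self)
    also have "\<dots> \<le> norm (v - y2) * norm \<phi>"
      by (rule Cauchy_Schwarz_ineq2)
    also have "\<dots> \<le> 3 * \<epsilon> * B"
      using pp(3) \<phi>(2) \<epsilon>_pos unfolding v_def by (intro mult_mono) auto
    finally show ?thesis .
  qed
  ultimately show "measure_pmf.expectation U (\<lambda>(s', y', k'). \<sigma> * ((s' - y') \<bullet> \<phi>)) \<le> 3 * \<epsilon> * B"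
    by linarith
qed

end

section \<open>Regret and oracle calls\<close>

locale bandit_analysis = approximate_projection K \<alpha> R \<epsilon> c orc N opt
  for K :: "(real ^ 'n) set" and \<alpha> R \<epsilon> c :: real
    and orc :: "real ^ 'n \<Rightarrow> real ^ 'n" and N :: "real ^ 'n \<Rightarrow> nat"
    and opt :: "real ^ 'n \<Rightarrow> (real ^ 'n) list \<Rightarrow> real list" +
  fixes \<eta> \<gamma> F C \<beta> :: real and q :: "'n \<Rightarrow> real ^ 'n" and s1 :: "real ^ 'n"
    and f :: "nat \<Rightarrow> real ^ 'n" and T :: nat
  assumes \<eta>_pos: "\<eta> > 0" and \<gamma>: "0 < \<gamma>" "\<gamma> < 1" and C_pos: "C > 0" and \<beta>_pos: "\<beta> > 0"
    and q_in_K: "q i \<in> K" and q_inv: "invertible (spanner_matrix q)"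
    and q_norm: "norm (matrix_inv (spanner_matrix q) *v q i) \<le> \<beta>"
    and s1_in_K: "s1 \<in> K"
    and f_nonneg: "t \<in> {1..T} \<Longrightarrow> f t \<in> nonneg_orthant"
    and f_norm: "t \<in> {1..T} \<Longrightarrow> norm (f t) \<le> F"
    and f_bounded: "t \<in> {1..T} \<Longrightarrow> x \<in> K \<Longrightarrow> 0 \<le> x \<bullet> f t \<and> x \<bullet> f t \<le> C"
begin

abbreviation state :: "nat \<Rightarrow> ((real ^ 'n) \<times> (real ^ 'n) \<times> (nat \<Rightarrow> real ^ 'n) \<times> nat) pmf" where
  "state \<equiv> bandit_state \<alpha> R orc N opt \<eta> \<epsilon> \<gamma> q s1 f"

abbreviation play :: "nat \<Rightarrow> real ^ 'n \<Rightarrow> ((real ^ 'n) \<times> (real ^ 'n)) pmf" where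
  "play t \<equiv> bandit_play \<gamma> q (f (Suc t))"

abbreviation update :: "real ^ 'n \<Rightarrow> real ^ 'n \<Rightarrow> ((real ^ 'n) \<times> (real ^ 'n) \<times> nat) pmf" where
  "update \<equiv> full_info_update \<alpha> R orc N opt \<eta> \<epsilon>"

text \<open>Bounds the mean norm of an estimate; the bound for a single estimate is
  \<open>G / \<gamma>\<close>.\<close>

definition G :: real where
  "G = real CARD('n) * C * \<beta>"

text \<open>Finite support makes every function integrable, so expectations split without further
  conditions.\<close>

lemma finite_state: "finite (set_pmf (state t))"
  by (induction t) (auto simp: finite_bandit_play full_info_update(1) split_beta)

text \<open>A case distinction is enough: the projection restores the distance bound whatever it is
  fed, and sampled points come from oracle answers. Only the initial \<open>y\<close>, which is
  \<open>\<alpha> *\<^sub>R s1\<close>, needs its own argument.\<close>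

lemma state_invariant:
  assumes "(s, y, p, k) \<in> set_pmf (state t)"
  shows "s \<in> K" and "x \<in> K \<Longrightarrow> norm (y - \<alpha> *\<^sub>R x) \<le> 2 * \<alpha> * R"
proof -
  have "s \<in> K \<and> (\<forall>x\<in>K. norm (y - \<alpha> *\<^sub>R x) \<le> 2 * \<alpha> * R)"
  proof (cases t)
    case 0
    have "norm (\<alpha> *\<^sub>R s1 - \<alpha> *\<^sub>R x) \<le> 2 * \<alpha> * R" if "x \<in> K" for x
    proof -
      have "norm (s1 - x) \<le> 2 * R"
        using norm_triangle_ineq4[of s1 x] K_bounded[OF that] K_bounded[OF s1_in_K] by linarith
      then have "\<alpha> * norm (s1 - x) \<le> \<alpha> * (2 * R)"
        using \<alpha>_pos by (intro mult_left_mono) auto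
      then show ?thesis
        using \<alpha>_pos by (simp flip: scaleR_diff_right)
    qed
    then show ?thesis
      using assms 0 s1_in_K by simp
  next
    case (Suc t')
    then obtain y0 g where "(s, y, k - snd (snd (snd (s, y, p, k)))) = (s, y, 0)"
      and "\<exists>k'. (s, y, k') \<in> set_pmf (update y0 g)"
      using assms by (auto simp: split_beta) metis
    then show ?thesis
      using full_info_update(2,3) by blast
  qed
  then show "s \<in> K" and "x \<in> K \<Longrightarrow> norm (y - \<alpha> *\<^sub>R x) \<le> 2 * \<alpha> * R"
    by auto
qed

lemma expectation_state_Suc:
  fixes h :: "_ \<Rightarrow> real"
  shows "measure_pmf.expectation (state (Suc t)) h = measure_pmf.expectation (state t) (\<lambda>(s, y, p, k).
    measure_pmf.expectation (play t s) (\<lambda>(s_hat, g).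
      measure_pmf.expectation (update y g) (\<lambda>(s', y', k'). h (s', y', p(Suc t := s_hat), k + k'))))"
proof -
  have "measure_pmf.expectation (state (Suc t)) h =
    measure_pmf.expectation (state t) (\<lambda>x. case x of (s, y, p, k) \<Rightarrow> measure_pmf.expectation (play t s \<bind>
      (\<lambda>(s_hat, g). update y g \<bind> (\<lambda>(s', y', k'). return_pmf (s', y', p(Suc t := s_hat), k + k')))) h)"
    by (simp add: expectation_bind_finite finite_state finite_bandit_play full_info_update(1) split_beta)
  then show ?thesis
    by (simp add: expectation_bind_finite finite_bandit_play full_info_update(1) case_prod_beta'
        del: bandit_state.simps)
qed

lemma integrable_play: "integrable (measure_pmf (play t s)) (h :: _ \<Rightarrow> real)"
  by (rule integrable_measure_pmf_finite[OF finite_bandit_play])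

lemma integrable_update: "integrable (measure_pmf (update y g)) (h :: _ \<Rightarrow> real)"
  by (rule integrable_measure_pmf_finite[OF full_info_update(1)])

lemma norm_gradient_step:
  "(norm (v - (\<sigma> * \<eta>) *\<^sub>R g))\<^sup>2 = (norm v)\<^sup>2 - 2 * \<eta> * \<sigma> * (g \<bullet> v) + \<eta>\<^sup>2 * (norm g)\<^sup>2" for v g :: "real ^ 'n"
proof -
  have "\<sigma> * \<sigma> = 1"
    by (simp add: \<sigma>_def)
  then have "(\<sigma> * \<eta>)\<^sup>2 = \<eta>\<^sup>2"
    by (simp add: power_mult_distrib power2_eq_square)
  moreover have "(norm (v - (\<sigma> * \<eta>) *\<^sub>R g))\<^sup>2 = (norm v)\<^sup>2 - 2 * (\<sigma> * \<eta>) * (g \<bullet> v) + (\<sigma> * \<eta>)\<^sup>2 * (norm g)\<^sup>2"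
    by (simp only: norm_diff_scaleR_square inner_commute[of v])
  ultimately show ?thesis
    by simp
qed

text \<open>The potential carries the term \<open>s - y\<close> for the next loss vector \<open>\<phi>\<close>, which is still
  arbitrary: the output \<open>s\<close> is only good in expectation over its own sampling.\<close>

definition potential :: "real ^ 'n \<Rightarrow> real ^ 'n \<Rightarrow> nat
    \<Rightarrow> (real ^ 'n) \<times> (real ^ 'n) \<times> (nat \<Rightarrow> real ^ 'n) \<times> nat \<Rightarrow> real" where
  "potential x \<phi> t = (\<lambda>(s, y, p, k). 2 * \<eta> * (\<Sum>\<tau>=1..t. \<sigma> * ((p \<tau> - \<alpha> *\<^sub>R x) \<bullet> f \<tau>))
     + (norm (y - \<alpha> *\<^sub>R x))\<^sup>2 + 2 * \<eta> * (\<sigma> * ((s - y) \<bullet> \<phi>)))"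

text \<open>The price of one round: the squared length of the gradient step, exploration, and the
  projection error seen by the next sampled point. The factor \<open>2 * \<eta>\<close> is that of
  the regret inside the potential.\<close>

definition potential_increment :: real where
  "potential_increment = \<eta>\<^sup>2 * (G\<^sup>2 / \<gamma>) + 2 * \<eta> * (\<gamma> * C) + 2 * \<eta> * (3 * \<epsilon> * F)"

text \<open>The state is fixed, so the estimate is unbiased given \<open>s\<close> and
  \<open>y\<close>. Exploration aside, the round adds the regret of \<open>s\<close> against
  \<open>\<alpha> *\<^sub>R x\<close>, and the drift of the squared distance subtracts that of
  \<open>y\<close>. What remains, \<open>s - y\<close> against \<open>f (Suc t)\<close>, is the term
  that the old potential carries; the new term for \<open>\<phi>\<close> is bounded through the
  sampling of \<open>s'\<close>.\<close>

lemma potential_step: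
  assumes t: "Suc t \<le> T" and x: "x \<in> K" and \<phi>: "\<phi> \<in> nonneg_orthant" "norm \<phi> \<le> F" and s: "s \<in> K"
  shows "measure_pmf.expectation (play t s) (\<lambda>(s_hat, g). measure_pmf.expectation (update y g)
      (\<lambda>(s', y', k'). potential x \<phi> (Suc t) (s', y', p(Suc t := s_hat), k + k')))
    \<le> potential x (f (Suc t)) t (s, y, p, k) + potential_increment"
proof -
  have t1: "Suc t \<in> {1..T}"
    using t by simp
  define A where "A = 2 * \<eta> * (\<Sum>\<tau>=1..t. \<sigma> * ((p \<tau> - \<alpha> *\<^sub>R x) \<bullet> f \<tau>))"
  define Y where "Y = y - \<alpha> *\<^sub>R x"
  have sum: "(\<Sum>\<tau>=1..Suc t. \<sigma> * (((p(Suc t := s_hat)) \<tau> - \<alpha> *\<^sub>R x) \<bullet> f \<tau>))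
      = (\<Sum>\<tau>=1..t. \<sigma> * ((p \<tau> - \<alpha> *\<^sub>R x) \<bullet> f \<tau>)) + \<sigma> * ((s_hat - \<alpha> *\<^sub>R x) \<bullet> f (Suc t))" for s_hat
    by simp
  have upd: "measure_pmf.expectation (update y g)
      (\<lambda>(s', y', k'). potential x \<phi> (Suc t) (s', y', p(Suc t := s_hat), k + k'))
      \<le> A + (2 * \<eta> * (\<sigma> * (s_hat \<bullet> f (Suc t))) - 2 * \<eta> * (\<sigma> * ((\<alpha> *\<^sub>R x) \<bullet> f (Suc t))))
        + ((norm Y)\<^sup>2 - 2 * \<eta> * \<sigma> * (g \<bullet> Y) + \<eta>\<^sup>2 * (norm g)\<^sup>2) + 2 * \<eta> * (3 * \<epsilon> * F)" for s_hat g
  proof -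
    define a where "a = A + (2 * \<eta> * (\<sigma> * (s_hat \<bullet> f (Suc t))) - 2 * \<eta> * (\<sigma> * ((\<alpha> *\<^sub>R x) \<bullet> f (Suc t))))"
    define b where "b = (norm Y)\<^sup>2 - 2 * \<eta> * \<sigma> * (g \<bullet> Y) + \<eta>\<^sup>2 * (norm g)\<^sup>2"
    have "measure_pmf.expectation (update y g)
        (\<lambda>(s', y', k'). potential x \<phi> (Suc t) (s', y', p(Suc t := s_hat), k + k'))
      \<le> measure_pmf.expectation (update y g) (\<lambda>z. a + b + 2 * \<eta> * (case z of (s', y', k') \<Rightarrow> \<sigma> * ((s' - y') \<bullet> \<phi>)))"
    proof (rule expectation_mono_finite[OF full_info_update(1)])
      fix z
      assume z: "z \<in> set_pmf (update y g)"
      obtain s' y' k' where z': "z = (s', y', k')"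
        by (metis prod_cases3)
      have "norm (y' - \<alpha> *\<^sub>R x) \<le> norm (Y - (\<sigma> * \<eta>) *\<^sub>R g)"
        using full_info_update(4)[OF z[unfolded z'] x] by (simp add: Y_def algebra_simps)
      then have "(norm (y' - \<alpha> *\<^sub>R x))\<^sup>2 \<le> b"
        unfolding b_def norm_gradient_step[symmetric] by (simp add: power_mono)
      then show "(case z of (s', y', k') \<Rightarrow> potential x \<phi> (Suc t) (s', y', p(Suc t := s_hat), k + k'))
          \<le> a + b + 2 * \<eta> * (case z of (s', y', k') \<Rightarrow> \<sigma> * ((s' - y') \<bullet> \<phi>))"
        unfolding z' potential_def prod.case sum a_def A_def
        by (simp only: distrib_left inner_diff_left right_diff_distrib)
    qed
    also have "\<dots> = a + b + 2 * \<eta> * measure_pmf.expectation (update y g) (\<lambda>(s', y', k'). \<sigma> * ((s' - y') \<bullet> \<phi>))"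
      by (simp add: integrable_update)
    also have "\<dots> \<le> a + b + 2 * \<eta> * (3 * \<epsilon> * F)"
      by (intro add_left_mono mult_left_mono full_info_update(6)[OF \<phi>]) (use \<eta>_pos in simp)
    finally show ?thesis
      by (simp only: a_def b_def)
  qed
  define D where "D = A - 2 * \<eta> * (\<sigma> * ((\<alpha> *\<^sub>R x) \<bullet> f (Suc t))) + (norm Y)\<^sup>2 + 2 * \<eta> * (3 * \<epsilon> * F)"
  have "measure_pmf.expectation (play t s) (\<lambda>(s_hat, g). measure_pmf.expectation (update y g)
      (\<lambda>(s', y', k'). potential x \<phi> (Suc t) (s', y', p(Suc t := s_hat), k + k')))
    \<le> measure_pmf.expectation (play t s) (\<lambda>z. D + 2 * \<eta> * (case z of (s_hat, g) \<Rightarrow> \<sigma> * (s_hat \<bullet> f (Suc t)))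
        - 2 * \<eta> * \<sigma> * (case z of (s_hat, g) \<Rightarrow> g \<bullet> Y) + \<eta>\<^sup>2 * (case z of (s_hat, g) \<Rightarrow> (norm g)\<^sup>2))"
    by (rule expectation_mono_finite[OF finite_bandit_play])
      (use upd in \<open>auto simp: D_def split: prod.splits intro: order_trans[OF upd]\<close>)
  also have "\<dots> = D + 2 * \<eta> * measure_pmf.expectation (play t s) (\<lambda>(s_hat, g). \<sigma> * (s_hat \<bullet> f (Suc t)))
      - 2 * \<eta> * \<sigma> * measure_pmf.expectation (play t s) (\<lambda>(s_hat, g). g \<bullet> Y)
      + \<eta>\<^sup>2 * measure_pmf.expectation (play t s) (\<lambda>(s_hat, g). (norm g)\<^sup>2)"
    by (simp add: integrable_play)
  also have "\<dots> \<le> D + 2 * \<eta> * (\<sigma> * (s \<bullet> f (Suc t)) + \<gamma> * C) - 2 * \<eta> * \<sigma> * (f (Suc t) \<bullet> Y) + \<eta>\<^sup>2 * (G\<^sup>2 / \<gamma>)"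
  proof -
    have "measure_pmf.expectation (play t s) (\<lambda>(s_hat, g). \<sigma> * (s_hat \<bullet> f (Suc t)))
        \<le> \<sigma> * (s \<bullet> f (Suc t)) + \<gamma> * C"
      by (rule bandit_play_loss[OF \<gamma>]) (use f_bounded[OF t1] q_in_K s in \<open>auto simp: \<sigma>_def\<close>)
    then have "2 * \<eta> * measure_pmf.expectation (play t s) (\<lambda>(s_hat, g). \<sigma> * (s_hat \<bullet> f (Suc t)))
        \<le> 2 * \<eta> * (\<sigma> * (s \<bullet> f (Suc t)) + \<gamma> * C)"
      using \<eta>_pos by (intro mult_left_mono) auto
    moreover have "measure_pmf.expectation (play t s) (\<lambda>(s_hat, g). (norm g)\<^sup>2) \<le> G\<^sup>2 / \<gamma>"
      unfolding G_def by (rule bandit_play_estimate_norm[OF \<gamma> q_norm]) (use f_bounded[OF t1] q_in_K in auto)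
    then have "\<eta>\<^sup>2 * measure_pmf.expectation (play t s) (\<lambda>(s_hat, g). (norm g)\<^sup>2) \<le> \<eta>\<^sup>2 * (G\<^sup>2 / \<gamma>)"
      by (intro mult_left_mono) auto
    ultimately show ?thesis
      unfolding bandit_play_estimate[OF \<gamma> q_inv] by linarith
  qed
  also have "\<dots> = potential x (f (Suc t)) t (s, y, p, k) + potential_increment"
  proof -
    have fY: "f (Suc t) \<bullet> Y = y \<bullet> f (Suc t) - (\<alpha> *\<^sub>R x) \<bullet> f (Suc t)"
      by (simp add: Y_def inner_diff_right inner_commute)
    show ?thesis
      unfolding potential_def prod.case A_def[symmetric] Y_def[symmetric] D_def potential_increment_def fY
      by (simp add: inner_diff_left algebra_simps)
  qed
  finally show ?thesis .
qed

text \<open>The sign of \<open>x \<bullet> z\<close> halves the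
  \<open>4 * \<alpha>\<^sup>2 * R\<^sup>2\<close> of the triangle inequality; the remaining 2
  cancels against \<open>2 * \<eta>\<close>.\<close>

lemma norm_diff_nonneg_orthant:
  assumes "x \<in> K" "z \<in> K"
  shows "(norm (\<alpha> *\<^sub>R x - \<alpha> *\<^sub>R z))\<^sup>2 \<le> 2 * \<alpha>\<^sup>2 * R\<^sup>2"
proof -
  have "0 \<le> x \<bullet> z"
    using assms K_nonneg by (intro inner_nonneg_orthant) auto
  then have "(norm (x - z))\<^sup>2 \<le> (norm x)\<^sup>2 + (norm z)\<^sup>2"
    by (simp add: power2_norm_eq_inner inner_diff inner_commute)
  also have "\<dots> \<le> R\<^sup>2 + R\<^sup>2"
    using assms K_bounded by (intro add_mono power_mono) auto
  finally have "\<alpha>\<^sup>2 * (norm (x - z))\<^sup>2 \<le> \<alpha>\<^sup>2 * (R\<^sup>2 + R\<^sup>2)"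
    by (intro mult_left_mono) auto
  then show ?thesis
    by (simp add: power_mult_distrib algebra_simps flip: scaleR_diff_right)
qed

text \<open>\<open>\<phi>\<close> must be arbitrary in the induction: the step for round
  \<open>Suc t\<close> needs the earlier bound at \<open>f (Suc t)\<close>.\<close>

lemma expectation_potential:
  assumes "t \<le> T" "x \<in> K" "\<phi> \<in> nonneg_orthant" "norm \<phi> \<le> F"
  shows "measure_pmf.expectation (state t) (potential x \<phi> t)
    \<le> 2 * \<alpha>\<^sup>2 * R\<^sup>2 + real t * potential_increment"
  using assms(1,3,4)
proof (induction t arbitrary: \<phi>)
  case 0
  have "0 \<le> s1 \<bullet> \<phi>"
    using s1_in_K K_nonneg 0 by (intro inner_nonneg_orthant) auto
  \<comment> \<open>The first point is not sampled, but \<open>\<sigma> * (1 - \<alpha>)\<close> is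
    never positive, so starting at \<open>\<alpha> *\<^sub>R s1\<close> costs nothing.\<close>
  then have "\<sigma> * ((s1 - \<alpha> *\<^sub>R s1) \<bullet> \<phi>) \<le> 0"
    using mult_right_mono[of 1 \<alpha> "s1 \<bullet> \<phi>"] mult_right_mono[of \<alpha> 1 "s1 \<bullet> \<phi>"]
    by (auto simp: \<sigma>_def inner_diff_left)
  then have "2 * \<eta> * (\<sigma> * ((s1 - \<alpha> *\<^sub>R s1) \<bullet> \<phi>)) \<le> 0"
    using \<eta>_pos by (simp add: mult_nonneg_nonpos)
  then show ?case
    using norm_diff_nonneg_orthant[OF s1_in_K assms(2)] by (simp add: potential_def)
next
  case (Suc t)
  have t1: "Suc t \<in> {1..T}"
    using Suc.prems by simp
  have "measure_pmf.expectation (state (Suc t)) (potential x \<phi> (Suc t))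
      \<le> measure_pmf.expectation (state t) (\<lambda>z. potential x (f (Suc t)) t z + potential_increment)"
    unfolding expectation_state_Suc
  proof (rule expectation_mono_finite[OF finite_state])
    fix z
    assume z: "z \<in> set_pmf (state t)"
    obtain s y p k where z': "z = (s, y, p, k)"
      by (metis prod_cases4)
    show "(case z of (s, y, p, k) \<Rightarrow> measure_pmf.expectation (play t s) (\<lambda>(s_hat, g).
        measure_pmf.expectation (update y g)
          (\<lambda>(s', y', k'). potential x \<phi> (Suc t) (s', y', p(Suc t := s_hat), k + k'))))
      \<le> potential x (f (Suc t)) t z + potential_increment"
      unfolding z' prod.case
      by (rule potential_step[OF Suc.prems(1) assms(2) Suc.prems(2,3) state_invariant(1)[OF z[unfolded z']]])
  qed
  also have "\<dots> = measure_pmf.expectation (state t) (potential x (f (Suc t)) t) + potential_increment"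
    by (simp add: integrable_measure_pmf_finite[OF finite_state])
  also have "\<dots> \<le> 2 * \<alpha>\<^sup>2 * R\<^sup>2 + real t * potential_increment + potential_increment"
    using Suc.prems(1) by (intro add_right_mono Suc.IH f_nonneg[OF t1] f_norm[OF t1]) simp
  finally show ?case
    by (simp add: algebra_simps)
qed

lemma expectation_regret:
  assumes "x \<in> K" "F > 0"
  shows "measure_pmf.expectation (state T) (\<lambda>(s, y, p, k). \<Sum>\<tau>=1..T. \<sigma> * ((p \<tau> - \<alpha> *\<^sub>R x) \<bullet> f \<tau>))
    \<le> \<alpha>\<^sup>2 * R\<^sup>2 / \<eta> + real T * (\<eta> * G\<^sup>2 / (2 * \<gamma>) + 3 * \<epsilon> * F + \<gamma> * C)"
proof -
  define E where "E = measure_pmf.expectation (state T) (\<lambda>(s, y, p, k). \<Sum>\<tau>=1..T. \<sigma> * ((p \<tau> - \<alpha> *\<^sub>R x) \<bullet> f \<tau>))"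
  have "2 * \<eta> * E = measure_pmf.expectation (state T)
      (\<lambda>z. 2 * \<eta> * (case z of (s, y, p, k) \<Rightarrow> \<Sum>\<tau>=1..T. \<sigma> * ((p \<tau> - \<alpha> *\<^sub>R x) \<bullet> f \<tau>)))"
    by (simp add: E_def)
  \<comment> \<open>After the last round no loss is pending, so \<open>\<phi> = 0\<close>, and the
    squared distance is dropped.\<close>
  also have "\<dots> \<le> measure_pmf.expectation (state T) (potential x 0 T)"
    by (rule expectation_mono_finite[OF finite_state]) (auto simp: potential_def)
  also have "\<dots> \<le> 2 * \<alpha>\<^sup>2 * R\<^sup>2 + real T * potential_increment"
    using assms by (intro expectation_potential) (auto simp: nonneg_orthant_def)
  finally have "E \<le> (2 * \<alpha>\<^sup>2 * R\<^sup>2 + real T * potential_increment) / (2 * \<eta>)"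
    using \<eta>_pos by (simp add: pos_le_divide_eq mult.commute)
  also have "\<dots> = 2 * \<alpha>\<^sup>2 * R\<^sup>2 / (2 * \<eta>) + real T * (potential_increment / (2 * \<eta>))"
    by (simp add: add_divide_distrib)
  also have "potential_increment / (2 * \<eta>) = \<eta> * G\<^sup>2 / (2 * \<gamma>) + 3 * \<epsilon> * F + \<gamma> * C"
    using \<eta>_pos \<gamma> by (simp add: potential_increment_def add_divide_distrib power2_eq_square)
  also have "2 * \<alpha>\<^sup>2 * R\<^sup>2 / (2 * \<eta>) = \<alpha>\<^sup>2 * R\<^sup>2 / \<eta>"
    by simp
  finally show ?thesis
    by (simp only: E_def)
qed

text \<open>Amortisation: the calls of a projection are paid by the decrease of the squared distance
  to \<open>\<alpha> *\<^sub>R s1\<close>, and a gradient step can raise that distance only in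
  proportion to the moments of the estimate. With this comparator the potential starts at 0.\<close>

lemma expectation_calls:
  "measure_pmf.expectation (state t) (\<lambda>(s, y, p, k). \<epsilon>\<^sup>2 * real k + call_bound * (norm (y - \<alpha> *\<^sub>R s1))\<^sup>2)
    \<le> real t * (call_bound * (\<epsilon>\<^sup>2 + 4 * \<eta> * \<alpha> * R * G + \<eta>\<^sup>2 * (G\<^sup>2 / \<gamma>)))"
  if "t \<le> T"
  using that
proof (induction t)
  case 0
  then show ?case
    by simp
next
  case (Suc t)
  have t1: "Suc t \<in> {1..T}"
    using Suc.prems by simp
  define I where "I = call_bound * (\<epsilon>\<^sup>2 + 4 * \<eta> * \<alpha> * R * G + \<eta>\<^sup>2 * (G\<^sup>2 / \<gamma>))"
  have "measure_pmf.expectation (state (Suc t)) (\<lambda>(s, y, p, k). \<epsilon>\<^sup>2 * real k + call_bound * (norm (y - \<alpha> *\<^sub>R s1))\<^sup>2)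
      \<le> measure_pmf.expectation (state t)
        (\<lambda>z. (case z of (s, y, p, k) \<Rightarrow> \<epsilon>\<^sup>2 * real k + call_bound * (norm (y - \<alpha> *\<^sub>R s1))\<^sup>2) + I)"
    unfolding expectation_state_Suc
  proof (rule expectation_mono_finite[OF finite_state])
    fix z
    assume z: "z \<in> set_pmf (state t)"
    obtain s y p k where z': "z = (s, y, p, k)"
      by (metis prod_cases4)
    define Y where "Y = y - \<alpha> *\<^sub>R s1"
    have Y: "norm Y \<le> 2 * \<alpha> * R"
      unfolding Y_def by (rule state_invariant(2)[OF z[unfolded z'] s1_in_K])
    have upd: "measure_pmf.expectation (update y g)
        (\<lambda>(s', y', k'). \<epsilon>\<^sup>2 * real (k + k') + call_bound * (norm (y' - \<alpha> *\<^sub>R s1))\<^sup>2)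
        \<le> \<epsilon>\<^sup>2 * real k + call_bound * (\<epsilon>\<^sup>2 + (norm Y)\<^sup>2 + 4 * \<eta> * \<alpha> * R * norm g + \<eta>\<^sup>2 * (norm g)\<^sup>2)" for g
    proof (rule expectation_le_finite[OF full_info_update(1)])
      fix u
      assume u: "u \<in> set_pmf (update y g)"
      obtain s' y' k' where u': "u = (s', y', k')"
        by (metis prod_cases3)
      have "y - (\<sigma> * \<eta>) *\<^sub>R g - \<alpha> *\<^sub>R s1 = Y - (\<sigma> * \<eta>) *\<^sub>R g"
        by (simp add: Y_def)
      then have k': "\<epsilon>\<^sup>2 * real k' \<le> call_bound *
          (\<epsilon>\<^sup>2 + ((norm Y)\<^sup>2 - 2 * \<eta> * \<sigma> * (g \<bullet> Y) + \<eta>\<^sup>2 * (norm g)\<^sup>2) - (norm (y' - \<alpha> *\<^sub>R s1))\<^sup>2)"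
        using full_info_update(5)[OF u[unfolded u'] s1_in_K] by (simp only: norm_gradient_step)
      have "- (\<sigma> * (g \<bullet> Y)) \<le> \<bar>g \<bullet> Y\<bar>"
        by (simp add: \<sigma>_def abs_ge_self abs_ge_minus_self)
      also have "\<dots> \<le> norm g * norm Y"
        by (rule Cauchy_Schwarz_ineq2)
      also have "\<dots> \<le> norm g * (2 * \<alpha> * R)"
        using Y by (intro mult_left_mono) auto
      finally have "2 * \<eta> * (- (\<sigma> * (g \<bullet> Y))) \<le> 2 * \<eta> * (norm g * (2 * \<alpha> * R))"
        using \<eta>_pos by (intro mult_left_mono) auto
      then have "- 2 * \<eta> * \<sigma> * (g \<bullet> Y) \<le> 4 * \<eta> * \<alpha> * R * norm g"
        by (simp add: mult_ac)
      then have "\<epsilon>\<^sup>2 + ((norm Y)\<^sup>2 - 2 * \<eta> * \<sigma> * (g \<bullet> Y) + \<eta>\<^sup>2 * (norm g)\<^sup>2) - (norm (y' - \<alpha> *\<^sub>R s1))\<^sup>2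
          \<le> \<epsilon>\<^sup>2 + (norm Y)\<^sup>2 + 4 * \<eta> * \<alpha> * R * norm g + \<eta>\<^sup>2 * (norm g)\<^sup>2 - (norm (y' - \<alpha> *\<^sub>R s1))\<^sup>2"
        by simp
      from mult_left_mono[OF this call_bound_nonneg] k'
      show "(case u of (s', y', k') \<Rightarrow> \<epsilon>\<^sup>2 * real (k + k') + call_bound * (norm (y' - \<alpha> *\<^sub>R s1))\<^sup>2)
          \<le> \<epsilon>\<^sup>2 * real k + call_bound * (\<epsilon>\<^sup>2 + (norm Y)\<^sup>2 + 4 * \<eta> * \<alpha> * R * norm g + \<eta>\<^sup>2 * (norm g)\<^sup>2)"
        unfolding u' prod.case of_nat_add distrib_left right_diff_distrib by linarith
    qed
    have "measure_pmf.expectation (play t s) (\<lambda>(s_hat, g). measure_pmf.expectation (update y g)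
        (\<lambda>(s', y', k'). \<epsilon>\<^sup>2 * real (k + k') + call_bound * (norm (y' - \<alpha> *\<^sub>R s1))\<^sup>2))
      \<le> measure_pmf.expectation (play t s) (\<lambda>z. (\<epsilon>\<^sup>2 * real k + call_bound * (\<epsilon>\<^sup>2 + (norm Y)\<^sup>2))
          + (call_bound * (4 * \<eta> * \<alpha> * R)) * (case z of (s_hat, g) \<Rightarrow> norm g)
          + (call_bound * \<eta>\<^sup>2) * (case z of (s_hat, g) \<Rightarrow> (norm g)\<^sup>2))"
    proof (rule expectation_mono_finite[OF finite_bandit_play])
      fix v :: "(real ^ 'n) \<times> (real ^ 'n)"
      show "(case v of (s_hat, g) \<Rightarrow> measure_pmf.expectation (update y g)
          (\<lambda>(s', y', k'). \<epsilon>\<^sup>2 * real (k + k') + call_bound * (norm (y' - \<alpha> *\<^sub>R s1))\<^sup>2))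
        \<le> (\<epsilon>\<^sup>2 * real k + call_bound * (\<epsilon>\<^sup>2 + (norm Y)\<^sup>2))
          + (call_bound * (4 * \<eta> * \<alpha> * R)) * (case v of (s_hat, g) \<Rightarrow> norm g)
          + (call_bound * \<eta>\<^sup>2) * (case v of (s_hat, g) \<Rightarrow> (norm g)\<^sup>2)"
        using upd[of "snd v"] by (simp add: split_beta algebra_simps)
    qed
    also have "\<dots> = (\<epsilon>\<^sup>2 * real k + call_bound * (\<epsilon>\<^sup>2 + (norm Y)\<^sup>2))
        + (call_bound * (4 * \<eta> * \<alpha> * R)) * measure_pmf.expectation (play t s) (\<lambda>(s_hat, g). norm g)
        + (call_bound * \<eta>\<^sup>2) * measure_pmf.expectation (play t s) (\<lambda>(s_hat, g). (norm g)\<^sup>2)"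
      by (simp add: integrable_play)
    also have "\<dots> \<le> (\<epsilon>\<^sup>2 * real k + call_bound * (\<epsilon>\<^sup>2 + (norm Y)\<^sup>2))
        + (call_bound * (4 * \<eta> * \<alpha> * R)) * G + (call_bound * \<eta>\<^sup>2) * (G\<^sup>2 / \<gamma>)"
    proof (intro add_mono mult_left_mono order.refl)
      show "measure_pmf.expectation (play t s) (\<lambda>(s_hat, g). norm g) \<le> G"
        unfolding G_def by (rule bandit_play_estimate_norm[OF \<gamma> q_norm]) (use f_bounded[OF t1] q_in_K in auto)
      show "measure_pmf.expectation (play t s) (\<lambda>(s_hat, g). (norm g)\<^sup>2) \<le> G\<^sup>2 / \<gamma>"
        unfolding G_def by (rule bandit_play_estimate_norm[OF \<gamma> q_norm]) (use f_bounded[OF t1] q_in_K in auto)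
    qed (use call_bound_nonneg \<alpha>_pos \<eta>_pos R_pos in auto)
    also have "\<dots> = \<epsilon>\<^sup>2 * real k + call_bound * (norm Y)\<^sup>2 + I"
      by (simp add: I_def algebra_simps)
    finally show "(case z of (s, y, p, k) \<Rightarrow> measure_pmf.expectation (play t s) (\<lambda>(s_hat, g).
        measure_pmf.expectation (update y g) (\<lambda>(s', y', k').
          case (s', y', p(Suc t := s_hat), k + k') of (s, y, p, k) \<Rightarrow>
            \<epsilon>\<^sup>2 * real k + call_bound * (norm (y - \<alpha> *\<^sub>R s1))\<^sup>2)))
      \<le> (case z of (s, y, p, k) \<Rightarrow> \<epsilon>\<^sup>2 * real k + call_bound * (norm (y - \<alpha> *\<^sub>R s1))\<^sup>2) + I"
      unfolding z' prod.case Y_def .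
  qed
  also have "\<dots> = measure_pmf.expectation (state t)
      (\<lambda>(s, y, p, k). \<epsilon>\<^sup>2 * real k + call_bound * (norm (y - \<alpha> *\<^sub>R s1))\<^sup>2) + I"
    by (simp add: integrable_measure_pmf_finite[OF finite_state])
  also have "\<dots> \<le> real t * I + I"
    using Suc unfolding I_def by simp
  also have "\<dots> = real (Suc t) * I"
    by (simp add: algebra_simps)
  finally show ?case
    by (simp only: I_def)
qed

lemma expectation_calls_per_round:
  assumes "T > 0"
  shows "measure_pmf.expectation (state T) (\<lambda>(s, y, p, k). real k / real T)
    \<le> call_bound * (1 + (4 * (\<eta> * \<alpha> * R * G) + (\<eta> * G)\<^sup>2 / \<gamma>) / \<epsilon>\<^sup>2)"
proof -
  define E where "E = measure_pmf.expectation (state T) (\<lambda>(s, y, p, k). real k / real T)"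
  define I where "I = call_bound * (\<epsilon>\<^sup>2 + 4 * \<eta> * \<alpha> * R * G + \<eta>\<^sup>2 * (G\<^sup>2 / \<gamma>))"
  have "(\<epsilon>\<^sup>2 * real T) * E = measure_pmf.expectation (state T)
      (\<lambda>z. (\<epsilon>\<^sup>2 * real T) * (case z of (s, y, p, k) \<Rightarrow> real k / real T))"
    by (simp add: E_def)
  also have "\<dots> \<le> measure_pmf.expectation (state T)
      (\<lambda>(s, y, p, k). \<epsilon>\<^sup>2 * real k + call_bound * (norm (y - \<alpha> *\<^sub>R s1))\<^sup>2)"
    using assms call_bound_nonneg
    by (intro expectation_mono_finite[OF finite_state]) (auto simp: split_beta)
  also have "\<dots> \<le> real T * I"
    unfolding I_def by (rule expectation_calls) simp
  finally have "E \<le> (real T * I) / (\<epsilon>\<^sup>2 * real T)"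
    using assms \<epsilon>_pos by (simp add: pos_le_divide_eq mult_ac)
  also have "\<dots> = I / \<epsilon>\<^sup>2"
    using assms by simp
  also have "\<dots> = call_bound * (1 + (4 * (\<eta> * \<alpha> * R * G) + (\<eta> * G)\<^sup>2 / \<gamma>) / \<epsilon>\<^sup>2)"
    using \<epsilon>_pos by (simp add: I_def add_divide_distrib distrib_left power_mult_distrib mult_ac)
  finally show ?thesis
    by (simp only: E_def)
qed

end

section \<open>Expected regret and calls of the whole run\<close>

context bandit_analysis
begin

text \<open>By compactness the optimum is attained, at a point that depends on \<open>f\<close> but
  not on \<open>p\<close>. One deterministic comparator thus serves every outcome of the algorithm,
  so the expectation can be taken with \<open>x\<close> fixed.\<close>

lemma alpha_regret_eq:
  assumes "compact K"
  obtains x where "x \<in> K"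
    "\<And>p. alpha_regret \<alpha> K T p f = (\<Sum>\<tau>=1..T. \<sigma> * ((p \<tau> - \<alpha> *\<^sub>R x) \<bullet> f \<tau>)) / real T"
proof -
  define g where "g z = 1 / real T * (\<Sum>t=1..T. z \<bullet> f t)" for z
  have cont: "continuous_on K g"
    unfolding g_def by (intro continuous_intros)
  show ?thesis
  proof (cases "\<alpha> \<ge> 1")
    case True
    obtain x where x: "x \<in> K" "\<And>z. z \<in> K \<Longrightarrow> g x \<le> g z"
      using continuous_attains_inf[OF assms K_nonempty cont] by blast
    have "(INF z\<in>K. g z) = g x"
      using x by (intro cInf_eq_minimum) auto
    then have "alpha_regret \<alpha> K T p f = 1 / real T * (\<Sum>t=1..T. p t \<bullet> f t) - \<alpha> * g x" for p
      using True by (simp add: alpha_regret_def g_def)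
    moreover have "\<dots> p = (\<Sum>\<tau>=1..T. \<sigma> * ((p \<tau> - \<alpha> *\<^sub>R x) \<bullet> f \<tau>)) / real T" for p
      using True by (simp add: g_def \<sigma>_def inner_diff_left sum_subtractf diff_divide_distrib sum_distrib_left
          sum_divide_distrib)
    ultimately show ?thesis
      using that x(1) by simp
  next
    case False
    obtain x where x: "x \<in> K" "\<And>z. z \<in> K \<Longrightarrow> g z \<le> g x"
      using continuous_attains_sup[OF assms K_nonempty cont] by blast
    have "(SUP z\<in>K. g z) = g x"
      using x by (intro cSup_eq_maximum) auto
    then have "alpha_regret \<alpha> K T p f = \<alpha> * g x - 1 / real T * (\<Sum>t=1..T. p t \<bullet> f t)" for p
      using False by (simp add: alpha_regret_def g_def)
    moreover have "\<dots> p = (\<Sum>\<tau>=1..T. \<sigma> * ((p \<tau> - \<alpha> *\<^sub>R x) \<bullet> f \<tau>)) / real T" for p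
      using False by (simp add: g_def \<sigma>_def inner_diff_left sum_subtractf diff_divide_distrib sum_distrib_left
          sum_divide_distrib)
    ultimately show ?thesis
      using that x(1) by simp
  qed
qed

lemma expectation_alpha_regret:
  assumes "compact K" "F > 0" "T > 0"
  shows "measure_pmf.expectation (bandit \<alpha> R orc N opt \<eta> \<epsilon> \<gamma> q s1 f T)
      (\<lambda>(s_hat, k). alpha_regret \<alpha> K T s_hat f)
    \<le> \<alpha>\<^sup>2 * R\<^sup>2 / (\<eta> * real T) + \<eta> * G\<^sup>2 / (2 * \<gamma>) + 3 * \<epsilon> * F + \<gamma> * C"
proof -
  obtain x where x: "x \<in> K"
    "\<And>p. alpha_regret \<alpha> K T p f = (\<Sum>\<tau>=1..T. \<sigma> * ((p \<tau> - \<alpha> *\<^sub>R x) \<bullet> f \<tau>)) / real T"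
    using alpha_regret_eq[OF assms(1)] by blast
  have "measure_pmf.expectation (bandit \<alpha> R orc N opt \<eta> \<epsilon> \<gamma> q s1 f T)
      (\<lambda>(s_hat, k). alpha_regret \<alpha> K T s_hat f)
    = measure_pmf.expectation (state T) (\<lambda>(s, y, p, k). \<Sum>\<tau>=1..T. \<sigma> * ((p \<tau> - \<alpha> *\<^sub>R x) \<bullet> f \<tau>)) / real T"
    by (simp add: bandit_def x(2) case_prod_beta')
  also have "\<dots> \<le> (\<alpha>\<^sup>2 * R\<^sup>2 / \<eta> + real T * (\<eta> * G\<^sup>2 / (2 * \<gamma>) + 3 * \<epsilon> * F + \<gamma> * C)) / real T"
    by (intro divide_right_mono expectation_regret x(1) assms(2)) simp
  also have "\<dots> = \<alpha>\<^sup>2 * R\<^sup>2 / (\<eta> * real T) + (\<eta> * G\<^sup>2 / (2 * \<gamma>) + 3 * \<epsilon> * F + \<gamma> * C)"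
    using assms(3) by (simp add: add_divide_distrib)
  finally show ?thesis
    by simp
qed

lemma expectation_bandit_calls:
  assumes "T > 0"
  shows "measure_pmf.expectation (bandit \<alpha> R orc N opt \<eta> \<epsilon> \<gamma> q s1 f T) (\<lambda>(s_hat, k). real k / real T)
    \<le> call_bound * (1 + (4 * (\<eta> * \<alpha> * R * G) + (\<eta> * G)\<^sup>2 / \<gamma>) / \<epsilon>\<^sup>2)"
  using expectation_calls_per_round[OF assms] by (simp add: bandit_def case_prod_beta')

end

section \<open>Constants and tuned parameters\<close>

lemma ln_four_mult:
  assumes "0 < \<alpha>" "0 < R" "0 < (\<epsilon> :: real)"
  shows "ln ((4 * \<alpha> + 1) * R / \<epsilon>) \<le> 2 * ln 2 + ln ((\<alpha> + 1) * R / \<epsilon>)"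
proof -
  have pos: "0 < (\<alpha> + 1) * R / \<epsilon>"
    using assms by simp
  have "(4 * \<alpha> + 1) * R / \<epsilon> \<le> 2 * (2 * ((\<alpha> + 1) * R / \<epsilon>))"
    using assms by (simp add: field_simps)
  moreover have "0 < (4 * \<alpha> + 1) * R / \<epsilon>"
    using assms by simp
  ultimately have "ln ((4 * \<alpha> + 1) * R / \<epsilon>) \<le> ln (2 * (2 * ((\<alpha> + 1) * R / \<epsilon>)))"
    using pos by (subst ln_le_cancel_iff) auto
  also have "\<dots> = ln 2 + (ln 2 + ln ((\<alpha> + 1) * R / \<epsilon>))"
    by (simp only: ln_mult_pos pos mult_pos_pos zero_less_numeral)
  finally show ?thesis
    by simp
qed

text \<open>With \<open>T = 1 / (u * u * u)\<close> every term is a multiple of \<open>u\<close>: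
  the first two are \<open>\<alpha> * \<beta> * d * C * R * u\<close> and half of it, and the factor
  3 comes from \<open>3 * \<epsilon> * F\<close>.\<close>

lemma tuned_regret:
  fixes \<alpha> \<beta> d C R F T :: real
  assumes pos: "\<alpha> > 0" "\<beta> > 0" "d > 0" "C > 0" "R > 0" "F > 0" "T > 0"
  defines "u \<equiv> T powr (- 1 / 3)"
  defines "\<eta> \<equiv> \<alpha> * R / (\<beta> * d * C) * T powr (- 2 / 3)"
  shows "\<alpha>\<^sup>2 * R\<^sup>2 / (\<eta> * T) + \<eta> * d\<^sup>2 * C\<^sup>2 * \<beta>\<^sup>2 / (2 * u) + 3 * (\<alpha> * R * u) * F + u * C
    \<le> 3 * ((\<alpha> * \<beta> * d * C * R + \<alpha> * R * F + C) * u)"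
proof -
  have u: "u > 0"
    using pos by (simp add: u_def)
  have u2: "T powr (- 2 / 3) = u\<^sup>2"
    by (simp add: u_def power2_eq_square flip: powr_add)
  have "u * u * u = T powr (- 1)"
    by (simp add: u_def flip: powr_add)
  then have "u * u * u = 1 / T"
    using pos by (simp add: powr_minus_divide)
  then have T: "T = 1 / (u * u * u)"
    using u pos by (simp add: field_simps)
  have \<eta>: "\<eta> = \<alpha> * R * (u * u) / (\<beta> * d * C)"
    unfolding \<eta>_def u2 by (simp add: power2_eq_square)
  have "\<alpha>\<^sup>2 * R\<^sup>2 / (\<eta> * T) = (\<alpha> * \<beta> * d * C * R) * u"
    unfolding \<eta> T using pos u by (simp add: power2_eq_square)
  moreover have "\<eta> * d\<^sup>2 * C\<^sup>2 * \<beta>\<^sup>2 / (2 * u) = (\<alpha> * \<beta> * d * C * R) * u / 2"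
    unfolding \<eta> using pos u by (simp add: power2_eq_square)
  moreover have "0 < (\<alpha> * \<beta> * d * C * R) * u" "0 < u * C"
    using pos u by simp_all
  ultimately show ?thesis
    by (simp add: algebra_simps)
qed

text \<open>The parameters balance: the first term of the numerator equals the denominator and the
  second is \<open>u\<close> times it, so the sum is \<open>1 + 1 + u\<close>.\<close>

lemma tuned_projections:
  fixes \<alpha> \<beta> d C R T :: real
  assumes pos: "\<alpha> > 0" "\<beta> > 0" "d > 0" "C > 0" "R > 0" "T \<ge> 1"
  defines "u \<equiv> T powr (- 1 / 3)"
  defines "\<eta> \<equiv> \<alpha> * R / (\<beta> * d * C) * T powr (- 2 / 3)"
  shows "1 + (\<eta> * \<alpha> * \<beta> * d * C * R + (\<eta> * d * C * \<beta>)\<^sup>2 / u) / (\<alpha> * R * u)\<^sup>2 \<le> 3"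
proof -
  have u: "u > 0" "u \<le> 1"
    using pos powr_mono[of "- 1 / 3" 0 T] by (simp_all add: u_def)
  have u2: "T powr (- 2 / 3) = u\<^sup>2"
    by (simp add: u_def power2_eq_square flip: powr_add)
  have \<eta>: "\<eta> * (\<beta> * d * C) = \<alpha> * R * u\<^sup>2"
    unfolding \<eta>_def u2 using pos by simp
  have "\<eta> * \<alpha> * \<beta> * d * C * R = (\<eta> * (\<beta> * d * C)) * (\<alpha> * R)"
    by simp
  also have "\<dots> = (\<alpha> * R * u)\<^sup>2"
    unfolding \<eta> by (simp add: power2_eq_square)
  finally have 1: "\<eta> * \<alpha> * \<beta> * d * C * R = (\<alpha> * R * u)\<^sup>2" .
  have "\<eta> * d * C * \<beta> = \<eta> * (\<beta> * d * C)"
    by simp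
  then have 2: "(\<eta> * d * C * \<beta>)\<^sup>2 / u = (\<alpha> * R * u)\<^sup>2 * u"
    unfolding \<eta> using u by (simp add: power2_eq_square)
  have "(\<alpha> * R * u)\<^sup>2 > 0"
    using pos u by simp
  then show ?thesis
    unfolding 1 2 using u(2) by (simp add: add_divide_distrib)
qed

lemma tuned_log:
  fixes \<alpha> R T :: real
  assumes pos: "\<alpha> > 0" "R > 0" "T \<ge> 1"
  shows "ln ((\<alpha> + 1) * R / (\<alpha> * R * T powr (- 1 / 3))) \<le> ln ((\<alpha> + 1) / \<alpha> * T)"
proof -
  have "T powr (1 / 3) \<le> T"
    using powr_mono[of "1 / 3" 1 T] pos by simp
  then have "(\<alpha> + 1) / \<alpha> * T powr (1 / 3) \<le> (\<alpha> + 1) / \<alpha> * T"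
    using pos by (intro mult_left_mono) auto
  moreover have "(\<alpha> + 1) * R / (\<alpha> * R * T powr (- 1 / 3)) = (\<alpha> + 1) / \<alpha> * T powr (1 / 3)"
    using pos powr_minus_divide[of T "1 / 3"] by simp
  moreover have "0 < (\<alpha> + 1) / \<alpha> * T powr (1 / 3)"
    using pos by simp
  ultimately show ?thesis
    by (subst ln_le_cancel_iff) linarith+
qed

text \<open>For \<open>\<epsilon>\<close> of the order of \<open>(\<alpha> + 1) * R\<close> or
  larger the logarithm may vanish or be negative, although a projection makes at least one call.
  Hence the two forms of the bound on \<open>calls\<close>: with the bare logarithm for smaller
  \<open>\<epsilon>\<close>, and with \<open>max 1\<close> in general. All constants are explicit
  multiples of \<open>c\<close>, so none depends on the dimension.\<close>

theorem theorem2: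
  fixes K Fset :: "(real ^ 'n) set"
    and \<alpha> R F C \<beta> \<eta> \<epsilon> \<gamma> c :: real
    and orc :: "real ^ 'n \<Rightarrow> real ^ 'n"
    and q :: "'n \<Rightarrow> real ^ 'n"
    and N :: "real ^ 'n \<Rightarrow> nat"
    and opt :: "real ^ 'n \<Rightarrow> (real ^ 'n) list \<Rightarrow> real list"
    and s1 :: "real ^ 'n"
    and f :: "nat \<Rightarrow> real ^ 'n"
    and T :: nat
  assumes "\<alpha> > 0" and "R > 0" and "F > 0" and "C > 0"
    and "compact K" and "K \<subseteq> nonneg_orthant" and "span K = UNIV"
    and "\<forall>x\<in>K. norm x \<le> R"
    and "compact Fset" and "Fset \<subseteq> nonneg_orthant"
    and "\<forall>f\<in>Fset. norm f \<le> F"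
    and "\<forall>x\<in>K. \<forall>f\<in>Fset. 0 \<le> x \<bullet> f \<and> x \<bullet> f \<le> C"
    and "approx_oracle \<alpha> K orc"
    and "\<beta> > 0" and "barycentric_spanner \<beta> K q"
    and "\<eta> > 0" and "0 < \<epsilon>" and "\<epsilon> \<le> (\<alpha> + 2) * R" and "0 < \<gamma>" and "\<gamma> < 1"
    and "admissible_iterations c \<alpha> R \<epsilon> N"
    and "optimal_solver opt"
    and "s1 \<in> K"
    and "T > 0" and "\<forall>t\<in>{1..T}. f t \<in> Fset"
  shows
    "let d = real CARD('n);
         B = bandit \<alpha> R orc N opt \<eta> \<epsilon> \<gamma> q s1 f T;
         regret = measure_pmf.expectation B (\<lambda>(s_hat, k). alpha_regret \<alpha> K T s_hat f);
         calls = measure_pmf.expectation B (\<lambda>(s_hat, k). real k / real T);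
         projections = 1 + (\<eta> * \<alpha> * \<beta> * d * C * R + (\<eta> * d * C * \<beta>)^2 / \<gamma>) / \<epsilon>^2
     in
       regret \<le> \<alpha>^2 * R^2 / (\<eta> * real T) + \<eta> * d^2 * C^2 * \<beta>^2 / (2 * \<gamma>) + 3 * \<epsilon> * F + \<gamma> * C
       \<and> (2 * \<epsilon> \<le> (\<alpha> + 1) * R \<longrightarrow>
            calls \<le> (30 * c) * (projections * (d^2 * ln ((\<alpha> + 1) * R / \<epsilon>))))
       \<and> calls \<le> (20 * c) * (projections * (d^2 * max 1 (ln ((\<alpha> + 1) * R / \<epsilon>))))
       \<and> (\<eta> = \<alpha> * R / (\<beta> * d * C) * real T powr (- 2 / 3)
            \<and> \<epsilon> = \<alpha> * R * real T powr (- 1 / 3)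
            \<and> \<gamma> = real T powr (- 1 / 3) \<longrightarrow>
            regret \<le> 3 * ((\<alpha> * \<beta> * d * C * R + \<alpha> * R * F + C) * real T powr (- 1 / 3))
            \<and> calls \<le> (100 * c) * (d^2 * ln ((\<alpha> + 1) / \<alpha> * real T)))"
proof -
  note a = assms
  define d where "d = real CARD('n)"
  have d: "d > 0"
    unfolding d_def by simp
  have q: "range q \<subseteq> K" "invertible (spanner_matrix q)"
    "(MAX i\<in>UNIV. norm (matrix_inv (spanner_matrix q) *v q i)) \<le> \<beta>"
    using \<open>barycentric_spanner \<beta> K q\<close> by (auto simp: barycentric_spanner_def)
  have q\<beta>: "norm (matrix_inv (spanner_matrix q) *v q i) \<le> \<beta>" for i
    using q(3) by (subst (asm) Max_le_iff) auto
  interpret bandit_analysis K \<alpha> R \<epsilon> c orc N opt \<eta> \<gamma> F C \<beta> q s1 f T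
    by unfold_locales (use a q q\<beta> in blast)+
  define regret where "regret = measure_pmf.expectation (bandit \<alpha> R orc N opt \<eta> \<epsilon> \<gamma> q s1 f T)
    (\<lambda>(s_hat, k). alpha_regret \<alpha> K T s_hat f)"
  define calls where "calls = measure_pmf.expectation (bandit \<alpha> R orc N opt \<eta> \<epsilon> \<gamma> q s1 f T)
    (\<lambda>(s_hat, k). real k / real T)"
  define P where "P = 1 + (\<eta> * \<alpha> * \<beta> * d * C * R + (\<eta> * d * C * \<beta>)^2 / \<gamma>) / \<epsilon>^2"
  define L where "L = ln ((\<alpha> + 1) * R / \<epsilon>)"
  have G: "G = d * C * \<beta>"
    by (simp add: G_def d_def)
  have reg: "regret \<le> \<alpha>^2 * R^2 / (\<eta> * real T) + \<eta> * d^2 * C^2 * \<beta>^2 / (2 * \<gamma>) + 3 * \<epsilon> * F + \<gamma> * C"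
    using expectation_alpha_regret[OF \<open>compact K\<close> \<open>F > 0\<close> \<open>T > 0\<close>]
    unfolding regret_def G by (simp add: power_mult_distrib mult.assoc)
  have P: "P \<ge> 1"
    unfolding P_def using a d by simp
  have c: "c * d\<^sup>2 > 0"
    using iterations_constant_pos d by simp
  define X where "X = \<eta> * \<alpha> * \<beta> * d * C * R"
  define Z where "Z = (\<eta> * d * C * \<beta>)\<^sup>2 / \<gamma>"
  define W where "W = (X + Z) / \<epsilon>\<^sup>2"
  have PW: "P = 1 + W"
    by (simp only: P_def W_def X_def Z_def)
  have XZ: "0 \<le> X" "0 \<le> Z"
    unfolding X_def Z_def using a d by simp_all
  have "calls \<le> call_bound * (1 + (4 * X + Z) / \<epsilon>\<^sup>2)"
    using expectation_bandit_calls[OF \<open>T > 0\<close>] unfolding calls_def G X_def Z_def by (simp add: mult_ac)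
  also have "\<dots> \<le> call_bound * (4 * P)"
  proof (rule mult_left_mono[OF _ call_bound_nonneg])
    \<comment> \<open>The 4 is twice the factor of the cross term in the squared gradient step times
      the distance bound \<open>2 * \<alpha> * R\<close>; it is spread over all of
      \<open>P\<close>.\<close>
    have "(4 * X + Z) / \<epsilon>\<^sup>2 \<le> (4 * X + 4 * Z) / \<epsilon>\<^sup>2"
      using XZ by (intro divide_right_mono) auto
    also have "\<dots> = 4 * W"
      by (simp add: W_def)
    finally have "(4 * X + Z) / \<epsilon>\<^sup>2 \<le> 4 * W" .
    moreover have "4 * P = 4 + 4 * W"
      by (simp add: PW)
    ultimately show "1 + (4 * X + Z) / \<epsilon>\<^sup>2 \<le> 4 * P"
      by simp
  qed
  also have "call_bound = (c * d\<^sup>2) * max 1 (ln ((4 * \<alpha> + 1) * R / \<epsilon>))"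
    by (simp add: call_bound_def d_def)
  finally have calls: "calls \<le> (c * d\<^sup>2) * (max 1 (ln ((4 * \<alpha> + 1) * R / \<epsilon>)) * (4 * P))"
    by (simp only: mult.assoc)
  have calls': "calls \<le> (c * d\<^sup>2) * (b * (4 * P))" if "max 1 (ln ((4 * \<alpha> + 1) * R / \<epsilon>)) \<le> b" for b
    using calls by (rule order_trans) (intro mult_left_mono mult_right_mono that, use c P in auto)
  have ln4: "ln ((4 * \<alpha> + 1) * R / \<epsilon>) \<le> 2 * ln 2 + L"
    unfolding L_def using a by (intro ln_four_mult)
  have ln2: "2 / 3 \<le> ln (2 :: real)" "ln (2 :: real) \<le> 25 / 36"
    by (rule ln2_ge_two_thirds, rule ln2_le_25_over_36)
  have A: "calls \<le> (30 * c) * (P * (d^2 * L))" if "2 * \<epsilon> \<le> (\<alpha> + 1) * R"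
  proof -
    have "2 \<le> (\<alpha> + 1) * R / \<epsilon>"
      using that a by (simp add: pos_le_divide_eq)
    then have "ln 2 \<le> L"
      unfolding L_def by (subst ln_le_cancel_iff) auto
    \<comment> \<open>From \<open>ln 2 <= L\<close> both \<open>2 * ln 2 + L <= 3 * L\<close> and
      \<open>1 <= 3 * L\<close> follow; with the factor 4 this gives 12, within the stated
      30.\<close>
    then have m: "max 1 (ln ((4 * \<alpha> + 1) * R / \<epsilon>)) \<le> 3 * L" and "0 \<le> L"
      using ln4 ln2 by auto
    have "calls \<le> (c * d\<^sup>2) * ((3 * L) * (4 * P))"
      by (rule calls'[OF m])
    also have "\<dots> = (c * d\<^sup>2) * (12 * (P * L))"
      by simp
    also have "\<dots> \<le> (c * d\<^sup>2) * (30 * (P * L))"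
      using c P \<open>0 \<le> L\<close> by (intro mult_left_mono mult_right_mono) auto
    finally show ?thesis
      by (simp add: mult_ac)
  qed
  have B: "calls \<le> (20 * c) * (P * (d^2 * max 1 L))"
  proof -
    \<comment> \<open>Since \<open>2 * ln 2\<close> is below 2, the factor 5 is ample; with the
      factor 4 it gives the 20.\<close>
    have m: "max 1 (ln ((4 * \<alpha> + 1) * R / \<epsilon>)) \<le> 5 * max 1 L"
      using ln4 ln2 by auto
    show ?thesis
      using calls'[OF m] by (simp add: mult_ac)
  qed
  have S: "regret \<le> 3 * ((\<alpha> * \<beta> * d * C * R + \<alpha> * R * F + C) * real T powr (- 1 / 3))
      \<and> calls \<le> (100 * c) * (d^2 * ln ((\<alpha> + 1) / \<alpha> * real T))"
    if \<eta>: "\<eta> = \<alpha> * R / (\<beta> * d * C) * real T powr (- 2 / 3)"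
      and \<epsilon>: "\<epsilon> = \<alpha> * R * real T powr (- 1 / 3)" and g: "\<gamma> = real T powr (- 1 / 3)"
  proof
    have T1: "real T \<ge> 1"
      using \<open>T > 0\<close> by simp
    \<comment> \<open>A single round would give \<open>\<gamma> = 1\<close>. From
      \<open>T >= 2\<close> the final logarithm is at least \<open>ln 2\<close>, so it can absorb
      constants as before.\<close>
    have "T \<noteq> 1"
      using g \<open>\<gamma> < 1\<close> by auto
    then have T2: "real T \<ge> 2"
      using \<open>T > 0\<close> by simp
    have \<epsilon>': "\<epsilon> = \<alpha> * R * \<gamma>"
      using \<epsilon> g by simp
    show "regret \<le> 3 * ((\<alpha> * \<beta> * d * C * R + \<alpha> * R * F + C) * real T powr (- 1 / 3))"
      using reg tuned_regret[of \<alpha> \<beta> d C R F "real T"] a d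
      unfolding \<eta>[symmetric] g[symmetric] \<epsilon>'[symmetric] by simp
    have P3: "P \<le> 3"
      using tuned_projections[of \<alpha> \<beta> d C R "real T"] a d T1
      unfolding \<eta>[symmetric] g[symmetric] \<epsilon>'[symmetric] P_def by simp
    define L' where "L' = ln ((\<alpha> + 1) / \<alpha> * real T)"
    have "L \<le> L'"
      using tuned_log[of \<alpha> R "real T"] a T1 unfolding \<epsilon>[symmetric] L_def L'_def by simp
    moreover have "ln 2 \<le> L'"
    proof -
      have "1 * 2 \<le> (\<alpha> + 1) / \<alpha> * real T"
        using a T2 by (intro mult_mono) auto
      then show ?thesis
        unfolding L'_def by (subst ln_le_cancel_iff) auto
    qed
    ultimately have m: "max 1 (ln ((4 * \<alpha> + 1) * R / \<epsilon>)) \<le> 3 * L'" and L': "0 \<le> L'"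
      using ln4 ln2 by auto
    have "calls \<le> (c * d\<^sup>2) * ((3 * L') * (4 * P))"
      by (rule calls'[OF m])
    also have "\<dots> \<le> (c * d\<^sup>2) * ((3 * L') * (4 * 3))"
      using c P3 L' by (intro mult_left_mono) auto
    also have "\<dots> = (c * d\<^sup>2) * (36 * L')"
      by simp
    also have "\<dots> \<le> (c * d\<^sup>2) * (100 * L')"
      using c L' by (intro mult_left_mono mult_right_mono) auto
    finally show "calls \<le> (100 * c) * (d^2 * ln ((\<alpha> + 1) / \<alpha> * real T))"
      by (simp add: L'_def mult_ac)
  qed
  show ?thesis
    unfolding Let_def d_def[symmetric] regret_def[symmetric] calls_def[symmetric] P_def[symmetric] L_def[symmetric]
    using reg A B S by blast
qed

end
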